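(* Let $\mathbf z_1,\dots,\mathbf z_n$ be a random sample from the distribution of a random vector $\mathbf z\in\mathbb R^p$ with mutually independent components having mean $0$ and variance $1$. Notation is as in the context. (i) Suppose $\mathbf z$ has finite sixth moments and at most one of $\gamma_1,\dots,\gamma_p$ is zero. Then for $\alpha=1$ there is a sequence of all-cumulant-matrices solutions $\hat{\mathbf W}\to_P\mathbf I_p$ such that the limiting distribution of $\sqrt n\,\mathrm{vec}(\hat{\mathbf W}-\mathbf I_p)$ is multivariate normal with mean vector $\mathbf 0$ and asymptotic variances $$ASV(\hat w_{kk})=\frac{\kappa_k+2}{4},\qquad ASV(\hat w_{kl})=\frac{\zeta_{11}}{(\gamma_k^2+\gamma_l^2)^2},\quad k\ne l,$$ where $\zeta_{11}=\gamma_k^2(\nu_k-\gamma_k^2)+\gamma_l^2(\nu_l-\gamma_l^2)+\gamma_l^4$. (ii) Suppose $\mathbf z$ has finite eighth moments and at most one of $\kappa_1,\dots,\kappa_p$ is zero. Then for $\alpha=0$ there is a sequence of all-cumulant-matrices solutions $\hat{\mathbf W}\to_P\mathbf I_p$ such that the limiting distribution of $\sqrt n\,\mathrm{vec}(\hat{\mathbf W}-\mathbf I_p)$ is multivariate normal with mean vector $\mathbf 0$ and asymptotic variances $$ASV(\hat w_{kk})=\frac{\kappa_k+2}{4},\qquad ASV(\hat w_{kl})=\frac{\zeta_{22}}{(\kappa_k^2+\kappa_l^2)^2},\quad k\ne l,$$ where $\zeta_{22}=\kappa_k^2(\omega_k-\beta_k^2)+\kappa_l^2(\omega_l-\beta_l^2)+\kappa_l^4$.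 (iii) Suppose $\mathbf z$ has finite eighth moments and $\gamma_k=\kappa_k=0$ for at most one $k$. Then there is a sequence of all-cumulant-matrices solutions $\hat{\mathbf W}\to_P\mathbf I_p$ based on both skewness and kurtosis such that the limiting distribution of $\sqrt n\,\mathrm{vec}(\hat{\mathbf W}-\mathbf I_p)$ is multivariate normal with mean vector $\mathbf 0$ and asymptotic variances $$ASV(\hat w_{kk})=\frac{\kappa_k+2}{4},\qquad ASV(\hat w_{kl})=\frac{\alpha^2\zeta_{11}+(1-\alpha)^2\zeta_{22}+2\alpha(1-\alpha)\zeta_{12}}{(\alpha(\gamma_k^2+\gamma_l^2)+(1-\alpha)(\kappa_k^2+\kappa_l^2))^2},\quad k\neq l,$$ where $\alpha\in[0,1]$ is the proportion of weight given to skewness, $\zeta_{11},\zeta_{22}$ are as in (i), (ii), and $\zeta_{12}=\gamma_k\kappa_k(\eta_k-\gamma_k\beta_k)+\gamma_l\kappa_l(\eta_l-\gamma_l\beta_l)+\gamma_l^2\kappa_l^2$.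
   Context: Moments, with $z_k$ the $k$th component of $\mathbf z$: $\gamma_k=E(z_k^3)$, $\beta_k=E(z_k^4)$, $\kappa_k=\beta_k-3$, $\omega_k=E(z_k^6)-E(z_k^3)^2$, $\nu_k=E(z_k^4)-1$, $\eta_k=E(z_k^5)-E(z_k^3)$. $ASV(\hat w_{kl})$ denotes the variance of the $(k,l)$ coordinate of the limiting distribution of $\sqrt n(\hat{\mathbf W}-\mathbf I_p)$ as $n\to\infty$. Cumulant matrices: for a random $p$-vector $\mathbf x$ with mean zero, $\mathbf C^{3i}(\mathbf x)=E[x_i\mathbf x\mathbf x^T]$ and $\mathbf C^{4ij}(\mathbf x)=E[x_ix_j\mathbf x\mathbf x^T]-E(x_ix_j)E(\mathbf x\mathbf x^T)-E(x_i\mathbf x)E(x_j\mathbf x^T)-E(x_j\mathbf x)E(x_i\mathbf x^T)$, $i,j=1,\dots,p$. Estimate based on all cumulant matrices (weight $\alpha\in[0,1]$): let $\bar{\mathbf z}=\frac1n\sum_i\mathbf z_i$, $\hat{\boldsymbol\Sigma}=\frac1n\sum_i(\mathbf z_i-\bar{\mathbf z})(\mathbf z_i-\bar{\mathbf z})^T$ (nonsingular with probability tending to one), and let $\hat{\mathbf C}^{3i},\hat{\mathbf C}^{4ij}$ be the cumulant matrices $\mathbf C^{3i}(\mathbf x),\mathbf C^{4ij}(\mathbf x)$ with $\mathbf x$ distributed according to the empirical distribution of $\hat{\boldsymbol\Sigma}^{-1/2}(\mathbf z_i-\bar{\mathbf z})$, $i=1,\dots,n$ (symmetric positive definite root). An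 all-cumulant-matrices solution is $\hat{\mathbf W}=(\hat w_{kl})=\hat{\mathbf U}\hat{\boldsymbol\Sigma}^{-1/2}$, where $\hat{\mathbf U}$ maximizes $$\alpha\sum_{i=1}^p\|\mathrm{diag}(\mathbf U\hat{\mathbf C}^{3i}\mathbf U^T)\|^2+(1-\alpha)\sum_{i=1}^p\sum_{j=1}^p\|\mathrm{diag}(\mathbf U\hat{\mathbf C}^{4ij}\mathbf U^T)\|^2$$ over orthogonal $\mathbf U$; $\mathrm{diag}(\mathbf A)$ is the diagonal matrix with the diagonal of $\mathbf A$ and $\|\cdot\|$ is the Frobenius norm.
   Formalization: In (iii), at α=1 it is additionally assumed that at most one γ_k is zero, and at α=0 that at most one κ_k is zero; otherwise the denominator of ASV(ŵ_kl) vanishes for some pair k≠l and the formula is undefined. *)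

theory Defs
  imports "HOL-Probability.Probability"
begin

definition tendsto_in_probability ::
  "'a measure \<Rightarrow> (nat \<Rightarrow> 'a \<Rightarrow> 'v::metric_space) \<Rightarrow> 'v \<Rightarrow> bool" where
  "tendsto_in_probability M X c \<longleftrightarrow>
     (\<forall>\<epsilon>>0. (\<lambda>n. measure M {\<omega> \<in> space M. dist (X n \<omega>) c > \<epsilon>}) \<longlonglongrightarrow> 0)"

text \<open>The library's \<^const>\<open>weak_conv_m\<close> is phrased with distribution functions and covers laws
  on the real line only.\<close>

definition converges_in_distribution ::
  "'a measure \<Rightarrow> (nat \<Rightarrow> 'a \<Rightarrow> 'v::euclidean_space) \<Rightarrow> 'v measure \<Rightarrow> bool" where
  "converges_in_distribution M X L \<longleftrightarrow>
     (\<forall>f::'v \<Rightarrow> real. continuous_on UNIV f \<longrightarrow> bounded (range f) \<longrightarrow>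
        (\<lambda>n. \<integral>\<omega>. f (X n \<omega>) \<partial>M) \<longlonglongrightarrow> (\<integral>x. f x \<partial>L))"

text \<open>All linear functionals have a univariate normal law. Zero variance (a point mass) is
  allowed, so the covariance matrix may be singular.\<close>

definition multivariate_normal :: "'v::euclidean_space measure \<Rightarrow> bool" where
  "multivariate_normal L \<longleftrightarrow> prob_space L \<and> sets L = sets borel \<and>
     (\<forall>a. \<exists>m s. s \<ge> 0 \<and> distr L borel (\<lambda>x. a \<bullet> x) =
        (if s = 0 then return borel m else density lborel (normal_density m s)))"

definition m_gamma :: "'a measure \<Rightarrow> ('a \<Rightarrow> real^'p) \<Rightarrow> 'p \<Rightarrow> real" where
  "m_gamma N z k = (\<integral>\<omega>. z \<omega> $ k ^ 3 \<partial>N)"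

definition m_beta :: "'a measure \<Rightarrow> ('a \<Rightarrow> real^'p) \<Rightarrow> 'p \<Rightarrow> real" where
  "m_beta N z k = (\<integral>\<omega>. z \<omega> $ k ^ 4 \<partial>N)"

definition m_kappa :: "'a measure \<Rightarrow> ('a \<Rightarrow> real^'p) \<Rightarrow> 'p \<Rightarrow> real" where
  "m_kappa N z k = m_beta N z k - 3"

definition m_omega :: "'a measure \<Rightarrow> ('a \<Rightarrow> real^'p) \<Rightarrow> 'p \<Rightarrow> real" where
  "m_omega N z k = (\<integral>\<omega>. z \<omega> $ k ^ 6 \<partial>N) - (\<integral>\<omega>. z \<omega> $ k ^ 3 \<partial>N)\<^sup>2"

definition m_nu :: "'a measure \<Rightarrow> ('a \<Rightarrow> real^'p) \<Rightarrow> 'p \<Rightarrow> real" where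
  "m_nu N z k = (\<integral>\<omega>. z \<omega> $ k ^ 4 \<partial>N) - 1"

definition m_eta :: "'a measure \<Rightarrow> ('a \<Rightarrow> real^'p) \<Rightarrow> 'p \<Rightarrow> real" where
  "m_eta N z k = (\<integral>\<omega>. z \<omega> $ k ^ 5 \<partial>N) - (\<integral>\<omega>. z \<omega> $ k ^ 3 \<partial>N)"

definition zeta11 :: "'a measure \<Rightarrow> ('a \<Rightarrow> real^'p) \<Rightarrow> 'p \<Rightarrow> 'p \<Rightarrow> real" where
  "zeta11 N z k l =
     (m_gamma N z k)\<^sup>2 * (m_nu N z k - (m_gamma N z k)\<^sup>2)
   + (m_gamma N z l)\<^sup>2 * (m_nu N z l - (m_gamma N z l)\<^sup>2)
   + m_gamma N z l ^ 4"

definition zeta22 :: "'a measure \<Rightarrow> ('a \<Rightarrow> real^'p) \<Rightarrow> 'p \<Rightarrow> 'p \<Rightarrow> real" where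
  "zeta22 N z k l =
     (m_kappa N z k)\<^sup>2 * (m_omega N z k - (m_beta N z k)\<^sup>2)
   + (m_kappa N z l)\<^sup>2 * (m_omega N z l - (m_beta N z l)\<^sup>2)
   + m_kappa N z l ^ 4"

definition zeta12 :: "'a measure \<Rightarrow> ('a \<Rightarrow> real^'p) \<Rightarrow> 'p \<Rightarrow> 'p \<Rightarrow> real" where
  "zeta12 N z k l =
     m_gamma N z k * m_kappa N z k * (m_eta N z k - m_gamma N z k * m_beta N z k)
   + m_gamma N z l * m_kappa N z l * (m_eta N z l - m_gamma N z l * m_beta N z l)
   + (m_gamma N z l)\<^sup>2 * (m_kappa N z l)\<^sup>2"

text \<open>Entries of the cumulant matrices of a mean-zero random vector; for instance
  \<open>E(x\<^sub>i x) E(x\<^sub>j x\<^sup>T)\<close> has \<open>(a, b)\<close> entry \<open>E(x\<^sub>i x\<^sub>a) E(x\<^sub>j x\<^sub>b)\<close>.\<close>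

definition cumulant3 :: "'a measure \<Rightarrow> ('a \<Rightarrow> real^'p) \<Rightarrow> 'p \<Rightarrow> real^'p^'p" where
  "cumulant3 N x i = (\<chi> a b. \<integral>\<omega>. x \<omega> $ i * (x \<omega> $ a * x \<omega> $ b) \<partial>N)"

definition cumulant4 :: "'a measure \<Rightarrow> ('a \<Rightarrow> real^'p) \<Rightarrow> 'p \<Rightarrow> 'p \<Rightarrow> real^'p^'p" where
  "cumulant4 N x i j = (\<chi> a b.
     (\<integral>\<omega>. x \<omega> $ i * x \<omega> $ j * (x \<omega> $ a * x \<omega> $ b) \<partial>N)
   - (\<integral>\<omega>. x \<omega> $ i * x \<omega> $ j \<partial>N) * (\<integral>\<omega>. x \<omega> $ a * x \<omega> $ b \<partial>N)
   - (\<integral>\<omega>. x \<omega> $ i * x \<omega> $ a \<partial>N) * (\<integral>\<omega>. x \<omega> $ j * x \<omega> $ b \<partial>N)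
   - (\<integral>\<omega>. x \<omega> $ j * x \<omega> $ a \<partial>N) * (\<integral>\<omega>. x \<omega> $ i * x \<omega> $ b \<partial>N))"

text \<open>A sample of size \<open>n\<close> is a function whose values at \<open>0, \<dots>, n - 1\<close> are the observations.\<close>

definition sample_mean :: "nat \<Rightarrow> (nat \<Rightarrow> real^'p) \<Rightarrow> real^'p" where
  "sample_mean n x = (1 / real n) *\<^sub>R (\<Sum>i<n. x i)"

definition sample_cov :: "nat \<Rightarrow> (nat \<Rightarrow> real^'p) \<Rightarrow> real^'p^'p" where
  "sample_cov n x = (\<chi> a b. (1 / real n) *
     (\<Sum>i<n. (x i - sample_mean n x) $ a * (x i - sample_mean n x) $ b))"

definition pos_def_matrix :: "real^'p^'p \<Rightarrow> bool" where
  "pos_def_matrix A \<longleftrightarrow> (\<forall>v. v \<noteq> 0 \<longrightarrow> v \<bullet> (A *v v) > 0)"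

definition inv_sqrt_matrix :: "real^'p^'p \<Rightarrow> real^'p^'p" where
  "inv_sqrt_matrix A =
     (THE R. transpose R = R \<and> pos_def_matrix R \<and> R ** R = matrix_inv A)"

definition standardized :: "nat \<Rightarrow> (nat \<Rightarrow> real^'p) \<Rightarrow> nat \<Rightarrow> real^'p" where
  "standardized n x i = inv_sqrt_matrix (sample_cov n x) *v (x i - sample_mean n x)"

text \<open>Under the uniform distribution on the indices, \<open>standardized n x\<close> has the empirical
  distribution of the standardized observations.\<close>

definition sample_cumulant3 :: "nat \<Rightarrow> (nat \<Rightarrow> real^'p) \<Rightarrow> 'p \<Rightarrow> real^'p^'p" where
  "sample_cumulant3 n x = cumulant3 (measure_pmf (pmf_of_set {..<n})) (standardized n x)"

definition sample_cumulant4 :: "nat \<Rightarrow> (nat \<Rightarrow> real^'p) \<Rightarrow> 'p \<Rightarrow> 'p \<Rightarrow> real^'p^'p" where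
  "sample_cumulant4 n x = cumulant4 (measure_pmf (pmf_of_set {..<n})) (standardized n x)"

definition diag_matrix :: "real^'p^'p \<Rightarrow> real^'p^'p" where
  "diag_matrix A = (\<chi> i j. if i = j then A $ i $ j else 0)"

text \<open>On \<^typ>\<open>real^'p^'p\<close> the function \<^const>\<open>norm\<close> is the Frobenius norm.\<close>

definition cumulant_objective ::
  "real \<Rightarrow> nat \<Rightarrow> (nat \<Rightarrow> real^'p) \<Rightarrow> real^'p^'p \<Rightarrow> real" where
  "cumulant_objective \<alpha> n x U =
     \<alpha> * (\<Sum>i\<in>UNIV. (norm (diag_matrix (U ** sample_cumulant3 n x i ** transpose U)))\<^sup>2)
   + (1 - \<alpha>) * (\<Sum>i\<in>UNIV. \<Sum>j\<in>UNIV.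
       (norm (diag_matrix (U ** sample_cumulant4 n x i j ** transpose U)))\<^sup>2)"

definition all_cumulant_solution ::
  "real \<Rightarrow> nat \<Rightarrow> (nat \<Rightarrow> real^'p) \<Rightarrow> real^'p^'p \<Rightarrow> bool" where
  "all_cumulant_solution \<alpha> n x W \<longleftrightarrow>
     (\<exists>U. is_arg_max (cumulant_objective \<alpha> n x) orthogonal_matrix U \<and>
          W = U ** inv_sqrt_matrix (sample_cov n x))"

text \<open>A measurable statistic of the sample that is a solution whenever the sample covariance
  matrix is nonsingular; its values at the remaining samples are arbitrary, as there the estimate
  is undefined.\<close>

definition all_cumulant_estimate ::
  "real \<Rightarrow> nat \<Rightarrow> ((nat \<Rightarrow> real^'p) \<Rightarrow> real^'p^'p) \<Rightarrow> bool" where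
  "all_cumulant_estimate \<alpha> n T \<longleftrightarrow>
     T \<in> borel_measurable (Pi\<^sub>M {..<n} (\<lambda>_. borel)) \<and>
     (\<forall>x \<in> space (Pi\<^sub>M {..<n} (\<lambda>_. borel)).
        invertible (sample_cov n x) \<longrightarrow> all_cumulant_solution \<alpha> n x (T x))"

text \<open>Vectorization, with the pair (row, column) as index of the resulting vector.\<close>

definition vec_matrix :: "real^'p^'q \<Rightarrow> real^('q \<times> 'p)" where
  "vec_matrix A = (\<chi> kl. A $ fst kl $ snd kl)"

text \<open>There is a sequence of solutions, evaluated at the samples \<open>Z 0, \<dots>, Z (n - 1)\<close>, that is
  consistent and asymptotically normal with mean zero, \<open>asv k l\<close> being the variance of the
  \<open>(k, l)\<close> coordinate of the limiting distribution.\<close>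

definition has_asymptotically_normal_solutions ::
  "'a measure \<Rightarrow> (nat \<Rightarrow> 'a \<Rightarrow> real^'p) \<Rightarrow> real \<Rightarrow> ('p \<Rightarrow> 'p \<Rightarrow> real) \<Rightarrow> bool" where
  "has_asymptotically_normal_solutions M Z \<alpha> asv \<longleftrightarrow>
     (\<exists>T W.
        (\<forall>n. all_cumulant_estimate \<alpha> n (T n)) \<and>
        (\<forall>n \<omega>. W n \<omega> = T n (\<lambda>i\<in>{..<n}. Z i \<omega>)) \<and>
        tendsto_in_probability M W (mat 1) \<and>
        (\<exists>L. converges_in_distribution M (\<lambda>n \<omega>. sqrt (real n) *\<^sub>R vec_matrix (W n \<omega> - mat 1)) L \<and>
             multivariate_normal L \<and>
             (\<integral>x. x \<partial>L) = 0 \<and>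
             (\<forall>k l. prob_space.variance L (\<lambda>x. x $ (k, l)) = asv k l)))"

end

theory Submission
  imports Defs
begin

text \<open>The estimate depends on the sample only through its moments of order at most four. Since the
  free indices of the cumulant matrices may be rotated along with the others, the objective is a
  function of the cumulant tensors of the unmixed data \<open>W z\<close>. At the population moments its
  maximisers are exactly the signed permutations, so by compactness the maximiser nearest to the
  identity is consistent. Stationarity along plane rotations and \<open>W \<Sigma> W\<^sup>T = I\<close> are
  polynomial equations for \<open>W\<close> whose linearisation at the population is uniquely solvable; this
  makes the estimate a functional that is differentiable at the population moments, and the
  multivariate central limit theorem with the delta method gives the limit law. Its variances are
  the second moments of the influence functions, computed from independence.\<close>


section \<open>Convergence in distribution in Euclidean spaces\<close>

text \<open>A maximiser is never unique: permuting the rows of \<open>U\<close> or changing their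
  signs leaves the objective unchanged. Hence the tie-break by distance to the identity, and hence
  the measurable selection, since a solution has to be a statistic of the sample. Differentiability
  is wanted at the population only, and only along symmetric moment vectors, where all sample
  moments lie. Consistency provides continuity there, so the derivative can be read off from linear
  equations. Treating \<open>W Sigma W^T = I\<close> as one of these equations asks of the inverse
  square root no more than continuity. For distinct k, l the perturbation D of \<open>W\<close>
  satisfies D_kl + D_lk = -h_kl, with h the covariance perturbation, and w_k D_lk - w_l D_kl = -s,
  where w_k = alpha gamma_k^2 + (1 - alpha) kappa_k^2 and s collects the perturbed cumulants. The
  determinant is w_k + w_l up to sign: the conditions on vanishing cumulants make it nonzero, and
  its square is the denominator of the variances. The central limit theorem needs square integrable
  moments, of order eight if fourth moments take part; for alpha = 1 a factor \<open>c = 0\<close>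
  deletes these.\<close>

inductive trig_sum :: "('v::euclidean_space \<Rightarrow> real) \<Rightarrow> bool" where
  cosine: "trig_sum (\<lambda>x. c * cos (t \<bullet> x + d))"
| add: "trig_sum f \<Longrightarrow> trig_sum g \<Longrightarrow> trig_sum (\<lambda>x. f x + g x)"

text \<open>The product-to-sum formula turns a product of two cosines into a sum of two cosines.
  Closure under products is what makes the trigonometric sums an algebra for
  Stone-Weierstrass.\<close>

lemma trig_sum_cosine_mult:
  assumes "trig_sum g"
  shows "trig_sum (\<lambda>x. c * cos (t \<bullet> x + d) * g x)"
  using assms
proof induction
  case (cosine c' t' d')
  have "(\<lambda>x. c * cos (t \<bullet> x + d) * (c' * cos (t' \<bullet> x + d')))
      = (\<lambda>x. (c * c' / 2) * cos ((t - t') \<bullet> x + (d - d')) + (c * c' / 2) * cos ((t + t') \<bullet> x + (d + d')))"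
  proof
    fix x
    have "cos (t \<bullet> x + d) * cos (t' \<bullet> x + d')
        = (cos ((t - t') \<bullet> x + (d - d')) + cos ((t + t') \<bullet> x + (d + d'))) / 2"
      unfolding cos_times_cos by (simp add: inner_diff_left inner_add_left algebra_simps)
    then show "c * cos (t \<bullet> x + d) * (c' * cos (t' \<bullet> x + d'))
        = (c * c' / 2) * cos ((t - t') \<bullet> x + (d - d')) + (c * c' / 2) * cos ((t + t') \<bullet> x + (d + d'))"
      by (simp add: field_simps)
  qed
  then show ?case
    by (simp only: trig_sum.add trig_sum.cosine)
next
  case (add f g)
  then show ?case
    using trig_sum.add[OF add.IH] by (simp add: algebra_simps)
qed

lemma trig_sum_mult:
  assumes "trig_sum f" "trig_sum g"
  shows "trig_sum (\<lambda>x. f x * g x)"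
  using assms(1)
proof induction
  case (cosine c t d)
  then show ?case
    using trig_sum_cosine_mult[OF assms(2)] by simp
next
  case (add f1 f2)
  then show ?case
    using trig_sum.add[OF add.IH] by (simp add: algebra_simps)
qed

lemma trig_sum_const: "trig_sum (\<lambda>x. c)"
  using trig_sum.cosine[of c 0 0] by simp

lemma trig_sum_continuous: "trig_sum f \<Longrightarrow> continuous_on A f"
  by (induction rule: trig_sum.induct) (auto intro!: continuous_intros)

text \<open>The periodic extension of a cut-off of \<open>f\<close> lives on a torus, where the Stone--Weierstrass
  theorem provides trigonometric sums; periodicity keeps the sup norm under control everywhere.\<close>

lemma trig_sum_approx:
  fixes f :: "'v::euclidean_space \<Rightarrow> real"
  assumes cont: "continuous_on UNIV f" and bd: "\<And>x. \<bar>f x\<bar> \<le> B" and K: "K > 0" and e: "e > 0"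
  obtains g where "trig_sum g" "\<And>x. \<bar>g x\<bar> \<le> B + e" "\<And>x. norm x \<le> K \<Longrightarrow> \<bar>f x - g x\<bar> \<le> e"
proof -
  \<comment> \<open>Half the period. The cut-off function vanishes from norm K + 1 on, hence on the
    faces of the cube of half side K + 2, where opposite points are going to be identified.\<close>
  define L where "L = K + 2"
  define w where "w = pi / L"
  have L: "L > 0" using K by (simp add: L_def)
  have wL: "w * L = pi" using L by (simp add: w_def)
  have w: "w > 0" using L by (simp add: w_def)
  define C :: "'v set" where "C = cbox (- L *\<^sub>R One) (L *\<^sub>R One)"
  have C_iff: "x \<in> C \<longleftrightarrow> (\<forall>b\<in>Basis. \<bar>x \<bullet> b\<bar> \<le> L)" for x
    by (auto simp: C_def mem_box abs_le_iff inner_diff_left minus_le_iff)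
  \<comment> \<open>Coordinatewise wrapping onto the torus. Within the cube it identifies points
    only if they differ in coordinates equal to L in absolute value, and there the cut-off function
    is zero.\<close>
  define \<Phi> :: "'v \<Rightarrow> 'v \<times> 'v" where
    "\<Phi> x = (\<Sum>b\<in>Basis. cos (w * (x \<bullet> b)) *\<^sub>R b, \<Sum>b\<in>Basis. sin (w * (x \<bullet> b)) *\<^sub>R b)" for x
  have \<Phi>_fst: "fst (\<Phi> x) \<bullet> b = cos (w * (x \<bullet> b))" and \<Phi>_snd: "snd (\<Phi> x) \<bullet> b = sin (w * (x \<bullet> b))"
    if "b \<in> Basis" for x b
    using that by (simp_all add: \<Phi>_def inner_sum_left_Basis)
  have \<Phi>_eqI: "\<Phi> x = \<Phi> y"
    if "\<And>b. b \<in> Basis \<Longrightarrow> cos (w * (x \<bullet> b)) = cos (w * (y \<bullet> b)) \<and> sin (w * (x \<bullet> b)) = sin (w * (y \<bullet> b))" for x y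
    using that by (simp add: \<Phi>_def)
  have \<Phi>_cont: "continuous_on A \<Phi>" for A
    unfolding \<Phi>_def by (intro continuous_intros)
  define f' where "f' x = f x * max 0 (min 1 (K + 1 - norm x))" for x
  have f'_cont: "continuous_on A f'" for A
    unfolding f'_def by (intro continuous_intros continuous_on_subset[OF cont]) auto
  have B0: "0 \<le> B" using bd[of 0] by (meson abs_ge_zero order_trans)
  have f'_bd: "\<bar>f' x\<bar> \<le> B" for x
  proof -
    have "\<bar>f x\<bar> * max 0 (min 1 (K + 1 - norm x)) \<le> B * 1"
      using bd[of x] by (intro mult_mono) auto
    then show ?thesis by (simp add: f'_def abs_mult)
  qed
  have f'_0: "f' x = 0" if "b \<in> Basis" "\<bar>x \<bullet> b\<bar> = L" for x b
  proof -
    have "norm x \<ge> L" using Basis_le_norm[OF that(1), of x] that(2) by simp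
    then show ?thesis by (simp add: f'_def L_def)
  qed
  have key: "f' x = f' y" if "x \<in> C" "y \<in> C" "\<Phi> x = \<Phi> y" for x y
  proof (cases "x = y")
    case False
    then obtain b where b: "b \<in> Basis" "x \<bullet> b \<noteq> y \<bullet> b" by (metis euclidean_eqI)
    have "cos (w * (x \<bullet> b)) = cos (w * (y \<bullet> b))" "sin (w * (x \<bullet> b)) = sin (w * (y \<bullet> b))"
      using that(3) \<Phi>_fst[OF b(1)] \<Phi>_snd[OF b(1)] by metis+
    then obtain n :: int where n: "w * (x \<bullet> b) = w * (y \<bullet> b) + 2 * pi * n"
      using sin_cos_eq_iff by metis
    have xy: "\<bar>x \<bullet> b\<bar> \<le> L" "\<bar>y \<bullet> b\<bar> \<le> L" using that(1,2) b(1) C_iff by auto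
    have "w * (x \<bullet> b - y \<bullet> b) = w * (2 * L * n)" using n wL by (simp add: algebra_simps)
    then have n': "x \<bullet> b - y \<bullet> b = 2 * L * n" using w by simp
    have "n \<noteq> 0" using n' b(2) by auto
    have "\<bar>2 * L * real_of_int n\<bar> \<le> 2 * L * 1" using n' xy by linarith
    then have "\<bar>real_of_int n\<bar> \<le> 1" using L by (simp add: abs_mult)
    then have "n = 1 \<or> n = -1" using \<open>n \<noteq> 0\<close> by linarith
    then have "\<bar>x \<bullet> b\<bar> = L \<and> \<bar>y \<bullet> b\<bar> = L" using n' xy by auto
    then show ?thesis using f'_0 b(1) by metis
  qed simp
  define S where "S = \<Phi> ` C"
  have compC: "compact C" by (simp add: C_def)
  have compS: "compact S" unfolding S_def by (intro compact_continuous_image \<Phi>_cont compC)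
  \<comment> \<open>The cut-off function read on the torus; by \<open>key\<close> the choice of the
    preimage does not matter.\<close>
  define F where "F y = f' (SOME x. x \<in> C \<and> \<Phi> x = y)" for y
  have F: "F (\<Phi> x) = f' x" if "x \<in> C" for x
  proof -
    have "(SOME x'. x' \<in> C \<and> \<Phi> x' = \<Phi> x) \<in> C \<and> \<Phi> (SOME x'. x' \<in> C \<and> \<Phi> x' = \<Phi> x) = \<Phi> x"
      by (rule someI) (use that in simp)
    then show ?thesis unfolding F_def using key that by blast
  qed
  have F_cont: "continuous_on S F"
    unfolding continuous_on_closed_invariant
  proof safe
    fix D :: "real set" assume D: "closed D"
    \<comment> \<open>Preimages of closed sets under \<open>F\<close> are images of compact subsets
      of the cube, hence closed: \<open>\<Phi>\<close> is a quotient map by compactness.\<close>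
    have cl: "compact (C \<inter> f' -` D)"
      using continuous_closed_preimage[OF f'_cont _ D, of C] compC compact_imp_closed
        compact_Int_closed[OF compC, of "C \<inter> f' -` D"] by (metis Int_assoc Int_absorb)
    show "\<exists>A. closed A \<and> A \<inter> S = F -` D \<inter> S"
    proof (intro exI conjI)
      show "closed (\<Phi> ` (C \<inter> f' -` D))"
        by (intro compact_imp_closed compact_continuous_image \<Phi>_cont cl)
      show "\<Phi> ` (C \<inter> f' -` D) \<inter> S = F -` D \<inter> S"
        unfolding S_def using F by auto
    qed
  qed
  have "\<exists>g. (continuous_on S g \<and> trig_sum (g \<circ> \<Phi>)) \<and> (\<forall>y\<in>S. \<bar>F y - g y\<bar> < e)"
  proof (rule Stone_Weierstrass_HOL[OF compS _ _ _ _ _ F_cont e])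
    show "continuous_on S (\<lambda>x. c) \<and> trig_sum ((\<lambda>x. c) \<circ> \<Phi>)" for c :: real
      by (simp add: o_def trig_sum_const)
    fix g h :: "'v \<times> 'v \<Rightarrow> real"
    assume gh: "(continuous_on S g \<and> trig_sum (g \<circ> \<Phi>)) \<and> continuous_on S h \<and> trig_sum (h \<circ> \<Phi>)"
    then show "continuous_on S (\<lambda>x. g x + h x) \<and> trig_sum ((\<lambda>x. g x + h x) \<circ> \<Phi>)"
      using trig_sum.add[of "g \<circ> \<Phi>" "h \<circ> \<Phi>"] by (auto simp: o_def intro!: continuous_intros)
    from gh show "continuous_on S (\<lambda>x. g x * h x) \<and> trig_sum ((\<lambda>x. g x * h x) \<circ> \<Phi>)"
      using trig_sum_mult[of "g \<circ> \<Phi>" "h \<circ> \<Phi>"] by (auto simp: o_def intro!: continuous_intros)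
  next
    fix y y' assume yy: "y \<in> S \<and> y' \<in> S \<and> y \<noteq> y'"
    then consider b where "b \<in> Basis" "fst y \<bullet> b \<noteq> fst y' \<bullet> b" | b where "b \<in> Basis" "snd y \<bullet> b \<noteq> snd y' \<bullet> b"
      by (metis euclidean_eqI prod_eq_iff)
    then show "\<exists>g. (continuous_on S g \<and> trig_sum (g \<circ> \<Phi>)) \<and> g y \<noteq> g y'"
    proof cases
      case 1
      have "(\<lambda>y. fst y \<bullet> b) \<circ> \<Phi> = (\<lambda>x. 1 * cos ((w *\<^sub>R b) \<bullet> x + 0))"
        using \<Phi>_fst[OF 1(1)] by (simp add: fun_eq_iff inner_commute[of b])
      then have "trig_sum ((\<lambda>y. fst y \<bullet> b) \<circ> \<Phi>)" by (simp only: trig_sum.cosine)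
      then show ?thesis using 1
        by (intro exI[of _ "\<lambda>y. fst y \<bullet> b"]) (auto intro!: continuous_intros)
    next
      case 2
      have "(\<lambda>y. snd y \<bullet> b) \<circ> \<Phi> = (\<lambda>x. 1 * cos ((w *\<^sub>R b) \<bullet> x + - (pi / 2)))"
        using \<Phi>_snd[OF 2(1)] by (simp add: fun_eq_iff inner_commute[of b] cos_diff)
      then have "trig_sum ((\<lambda>y. snd y \<bullet> b) \<circ> \<Phi>)" by (simp only: trig_sum.cosine)
      then show ?thesis using 2
        by (intro exI[of _ "\<lambda>y. snd y \<bullet> b"]) (auto intro!: continuous_intros)
    qed
  qed blast
  then obtain g where g: "trig_sum (g \<circ> \<Phi>)" "\<And>y. y \<in> S \<Longrightarrow> \<bar>F y - g y\<bar> < e" by blast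
  \<comment> \<open>Subtracting multiples of the period moves every point into the cube, so the
    bound valid on the torus extends to the whole space.\<close>
  have reduce: "\<exists>x'\<in>C. \<Phi> x' = \<Phi> x" for x
  proof -
    define n where "n b = \<lfloor>(x \<bullet> b + L) / (2 * L)\<rfloor>" for b
    define x' where "x' = (\<Sum>b\<in>Basis. (x \<bullet> b - 2 * L * n b) *\<^sub>R b)"
    have x': "x' \<bullet> b = x \<bullet> b - 2 * L * n b" if "b \<in> Basis" for b
      using that by (simp add: x'_def inner_sum_left_Basis)
    have "\<bar>x' \<bullet> b\<bar> \<le> L" if "b \<in> Basis" for b
    proof -
      have "real_of_int (n b) \<le> (x \<bullet> b + L) / (2 * L)" "(x \<bullet> b + L) / (2 * L) \<le> real_of_int (n b) + 1"
        unfolding n_def by linarith+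
      then have "real_of_int (n b) * (2 * L) \<le> x \<bullet> b + L" "x \<bullet> b + L \<le> (real_of_int (n b) + 1) * (2 * L)"
        using L by (simp_all add: pos_le_divide_eq pos_divide_le_eq)
      then show ?thesis using x'[OF that] by (simp add: algebra_simps abs_le_iff)
    qed
    moreover have "\<Phi> x' = \<Phi> x"
    proof (rule \<Phi>_eqI)
      fix b :: 'v assume b: "b \<in> Basis"
      have "w * (x \<bullet> b) = w * (x' \<bullet> b) + 2 * pi * n b"
        unfolding x'[OF b] wL[symmetric] by (simp add: algebra_simps)
      then show "cos (w * (x' \<bullet> b)) = cos (w * (x \<bullet> b)) \<and> sin (w * (x' \<bullet> b)) = sin (w * (x \<bullet> b))"
        using sin_cos_eq_iff by metis
    qed
    ultimately show ?thesis using C_iff by blast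
  qed
  show thesis
  proof (rule that[OF g(1)])
    fix x
    obtain x' where x': "x' \<in> C" "\<Phi> x' = \<Phi> x" using reduce by blast
    have "\<bar>f' x' - g (\<Phi> x)\<bar> < e" using g(2)[of "\<Phi> x'"] F[OF x'(1)] x' imageI[OF x'(1), of \<Phi>] by (auto simp: S_def)
    then show "\<bar>(g \<circ> \<Phi>) x\<bar> \<le> B + e" using f'_bd[of x'] by simp
  next
    fix x :: 'v assume x: "norm x \<le> K"
    have "\<bar>x \<bullet> b\<bar> \<le> L" if "b \<in> Basis" for b
      using Basis_le_norm[OF that, of x] x by (simp add: L_def)
    then have xC: "x \<in> C" using C_iff by blast
    have "f' x = f x" using x by (simp add: f'_def)
    then show "\<bar>f x - (g \<circ> \<Phi>) x\<bar> \<le> e" using g(2)[of "\<Phi> x"] F[OF xC] xC by (auto simp: S_def)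
  qed
qed

section \<open>Tightness, the Cramer-Wold device and Slutsky's theorem\<close>

lemma bounded_continuous_integrable:
  fixes f :: "'v::euclidean_space \<Rightarrow> real"
  assumes "prob_space M" "X \<in> borel_measurable M" "continuous_on UNIV f" "\<And>x. \<bar>f x\<bar> \<le> B"
  shows "integrable M (\<lambda>\<omega>. f (X \<omega>))"
proof -
  interpret prob_space M by fact
  have "(\<lambda>\<omega>. f (X \<omega>)) \<in> borel_measurable M"
    using assms(2,3) borel_measurable_continuous_on by blast
  then show ?thesis by (intro integrable_const_bound[of _ B]) (use assms(4) in auto)
qed

text \<open>The continuous ramp \<open>\<psi>\<close> lies between the indicators of norm > k + 1
  and of norm > k, so a small tail of the limit law forces eventually small tails along the
  sequence.\<close>

lemma converges_in_distribution_tight: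
  fixes X :: "nat \<Rightarrow> 'a \<Rightarrow> 'v::euclidean_space"
  assumes M: "prob_space M" and X: "\<And>n. X n \<in> borel_measurable M"
    and L: "prob_space L" "sets L = sets borel"
    and conv: "converges_in_distribution M X L" and e: "e > 0"
  obtains K where "K > 0" "eventually (\<lambda>n. measure M {\<omega>\<in>space M. norm (X n \<omega>) > K} < e) sequentially"
    "measure L {x. norm x > K} < e"
proof -
  interpret M: prob_space M by fact
  interpret L: prob_space L by fact
  have [measurable]: "X n \<in> borel_measurable M" for n by fact
  have sp: "space L = UNIV" using sets_eq_imp_space_eq[OF L(2)] by simp
  have ms: "{x::'v. norm x > c} \<in> sets L" for c
    unfolding L(2) by (intro borel_open open_Collect_less continuous_intros)
  have "(\<lambda>k. measure L {x. norm x > real k}) \<longlonglongrightarrow> measure L (\<Inter>k. {x. norm x > real k})"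
    using ms by (intro L.finite_Lim_measure_decseq) (auto simp: decseq_def)
  moreover have "(\<Inter>k. {x::'v. norm x > real k}) = {}"
    by (auto simp: not_less set_eq_iff intro: real_arch_simple)
  ultimately have "(\<lambda>k. measure L {x. norm x > real k}) \<longlonglongrightarrow> 0" by simp
  from order_tendstoD(2)[OF this e] obtain k :: nat where k: "measure L {x. norm x > real k} < e"
    by (meson eventually_sequentially order_refl)
  define \<psi> :: "'v \<Rightarrow> real" where "\<psi> x = max 0 (min 1 (norm x - k))" for x
  have \<psi>_cont: "continuous_on UNIV \<psi>" unfolding \<psi>_def by (intro continuous_intros)
  have \<psi>_bd: "\<bar>\<psi> x\<bar> \<le> 1" for x by (auto simp: \<psi>_def)
  have "bounded (range \<psi>)" using \<psi>_bd by (auto simp: bounded_iff)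
  then have lim: "(\<lambda>n. \<integral>\<omega>. \<psi> (X n \<omega>) \<partial>M) \<longlonglongrightarrow> (\<integral>x. \<psi> x \<partial>L)"
    using conv \<psi>_cont by (auto simp: converges_in_distribution_def)
  have idL: "(\<lambda>x. x) \<in> borel_measurable L"
    using measurable_ident_sets[OF L(2)] by (simp add: id_def)
  have "(\<integral>x. \<psi> x \<partial>L) \<le> (\<integral>x. indicator {x. norm x > real k} x \<partial>L)"
  proof (rule integral_mono)
    show "integrable L (indicator {x. norm x > real k} :: 'v \<Rightarrow> real)"
      using ms by (auto simp: L.emeasure_eq_measure)
  qed (use bounded_continuous_integrable[OF L(1) idL \<psi>_cont \<psi>_bd] in \<open>auto simp: \<psi>_def indicator_def\<close>)
  also have "\<dots> = measure L {x. norm x > real k}" using sp by simp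
  finally have "(\<integral>x. \<psi> x \<partial>L) < e" using k by simp
  from order_tendstoD(2)[OF lim this]
  have ev: "eventually (\<lambda>n. (\<integral>\<omega>. \<psi> (X n \<omega>) \<partial>M) < e) sequentially" .
  have le: "measure M {\<omega>\<in>space M. norm (X n \<omega>) > real k + 1} \<le> (\<integral>\<omega>. \<psi> (X n \<omega>) \<partial>M)" for n
  proof -
    have ms': "{\<omega>\<in>space M. norm (X n \<omega>) > real k + 1} \<in> sets M" by measurable
    have "measure M {\<omega>\<in>space M. norm (X n \<omega>) > real k + 1} = (\<integral>\<omega>. indicator {\<omega>\<in>space M. norm (X n \<omega>) > real k + 1} \<omega> \<partial>M)"
      using ms' by simp
    also have "\<dots> \<le> (\<integral>\<omega>. \<psi> (X n \<omega>) \<partial>M)"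
    proof (rule integral_mono)
      show "integrable M (indicator {\<omega>\<in>space M. norm (X n \<omega>) > real k + 1} :: 'a \<Rightarrow> real)"
        using ms' by (auto simp: M.emeasure_eq_measure)
    qed (use bounded_continuous_integrable[OF M X \<psi>_cont \<psi>_bd] in \<open>auto simp: \<psi>_def indicator_def\<close>)
    finally show ?thesis .
  qed
  show thesis
  proof
    show "real k + 1 > 0" by simp
    show "\<forall>\<^sub>F n in sequentially. measure M {\<omega>\<in>space M. norm (X n \<omega>) > real k + 1} < e"
      using ev by eventually_elim (use le in \<open>metis order_le_less_trans\<close>)
    have "measure L {x. norm x > real k + 1} \<le> measure L {x. norm x > real k}"
      using ms by (intro L.finite_measure_mono) auto
    then show "measure L {x. norm x > real k + 1} < e" using k by simp
  qed
qed

lemma integral_diff_le_truncated: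
  fixes f g :: "'v::euclidean_space \<Rightarrow> real"
  assumes M: "prob_space M" and X: "X \<in> borel_measurable M"
    and f: "continuous_on UNIV f" "\<And>x. \<bar>f x\<bar> \<le> B" and g: "continuous_on UNIV g" "\<And>x. \<bar>g x\<bar> \<le> B'"
    and close: "\<And>x. norm x \<le> K \<Longrightarrow> \<bar>f x - g x\<bar> \<le> e" and e: "e \<ge> 0"
  shows "\<bar>(\<integral>\<omega>. f (X \<omega>) \<partial>M) - (\<integral>\<omega>. g (X \<omega>) \<partial>M)\<bar> \<le> e + (B + B') * measure M {\<omega>\<in>space M. norm (X \<omega>) > K}"
proof -
  interpret M: prob_space M by fact
  have [measurable]: "X \<in> borel_measurable M" by fact
  have ms: "{\<omega>\<in>space M. norm (X \<omega>) > K} \<in> sets M" by measurable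
  have fi: "integrable M (\<lambda>\<omega>. f (X \<omega>))" and gi: "integrable M (\<lambda>\<omega>. g (X \<omega>))"
    using bounded_continuous_integrable[OF M X] f g by blast+
  have "\<bar>(\<integral>\<omega>. f (X \<omega>) \<partial>M) - (\<integral>\<omega>. g (X \<omega>) \<partial>M)\<bar> = \<bar>\<integral>\<omega>. f (X \<omega>) - g (X \<omega>) \<partial>M\<bar>"
    using fi gi by simp
  also have "\<dots> \<le> (\<integral>\<omega>. \<bar>f (X \<omega>) - g (X \<omega>)\<bar> \<partial>M)" by (rule integral_abs_bound)
  also have "\<dots> \<le> (\<integral>\<omega>. e + (B + B') * indicator {\<omega>\<in>space M. norm (X \<omega>) > K} \<omega> \<partial>M)"
  proof (rule integral_mono)
    show "integrable M (\<lambda>\<omega>. e + (B + B') * indicator {\<omega>\<in>space M. norm (X \<omega>) > K} \<omega>)"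
      using ms by (auto simp: M.emeasure_eq_measure)
    fix \<omega> assume "\<omega> \<in> space M"
    moreover have "\<bar>f (X \<omega>) - g (X \<omega>)\<bar> \<le> B + B'" using f(2)[of "X \<omega>"] g(2)[of "X \<omega>"] by linarith
    ultimately show "\<bar>f (X \<omega>) - g (X \<omega>)\<bar> \<le> e + (B + B') * indicator {\<omega>\<in>space M. norm (X \<omega>) > K} \<omega>"
      using close[of "X \<omega>"] e by (cases "norm (X \<omega>) > K") auto
  qed (use fi gi in auto)
  also have "\<dots> = e + (B + B') * measure M {\<omega>\<in>space M. norm (X \<omega>) > K}"
    using ms by (simp add: M.prob_space M.emeasure_eq_measure)
  finally show ?thesis .
qed

text \<open>A cosine of t . x + d only sees the projection on t, so integrals of trigonometric sums
  converge. Coordinate projections give tightness, and on a large ball any test function is close to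
  a trigonometric sum that stays bounded outside.\<close>

theorem cramer_wold:
  fixes X :: "nat \<Rightarrow> 'a \<Rightarrow> 'v::euclidean_space"
  assumes M: "prob_space M" and X: "\<And>n. X n \<in> borel_measurable M"
    and L: "prob_space L" "sets L = sets borel"
    and proj: "\<And>t. converges_in_distribution M (\<lambda>n \<omega>. t \<bullet> X n \<omega>) (distr L borel (\<lambda>x. t \<bullet> x))"
  shows "converges_in_distribution M X L"
proof -
  interpret M: prob_space M by fact
  interpret L: prob_space L by fact
  have [measurable]: "X n \<in> borel_measurable M" for n by fact
  have sp: "space L = UNIV" using sets_eq_imp_space_eq[OF L(2)] by simp
  have idL: "(\<lambda>x. x) \<in> borel_measurable L"
    using measurable_ident_sets[OF L(2)] by (simp add: id_def)
  then have meas_inner: "(\<lambda>x. t \<bullet> x) \<in> borel_measurable L" for t by measurable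
  have ms: "{x::'v. norm x > c} \<in> sets L" for c
    unfolding L(2) by (intro borel_open open_Collect_less continuous_intros)
  have trig: "trig_sum g \<Longrightarrow> (\<lambda>n. \<integral>\<omega>. g (X n \<omega>) \<partial>M) \<longlonglongrightarrow> (\<integral>x. g x \<partial>L) \<and> (\<exists>B. \<forall>x. \<bar>g x\<bar> \<le> B)" for g
  proof (induction rule: trig_sum.induct)
    case (cosine c t d)
    have b: "\<bar>c * cos r\<bar> \<le> \<bar>c\<bar>" for r by (simp add: abs_mult mult_left_le)
    have "bounded (range (\<lambda>r. c * cos (r + d)))" using b by (auto simp: bounded_iff)
    moreover have "continuous_on UNIV (\<lambda>r. c * cos (r + d))" by (intro continuous_intros)
    ultimately have "(\<lambda>n. \<integral>\<omega>. c * cos (t \<bullet> X n \<omega> + d) \<partial>M) \<longlonglongrightarrow> (\<integral>r. c * cos (r + d) \<partial>distr L borel (\<lambda>x. t \<bullet> x))"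
      using proj[of t] unfolding converges_in_distribution_def by blast
    also have "(\<integral>r. c * cos (r + d) \<partial>distr L borel (\<lambda>x. t \<bullet> x)) = (\<integral>x. c * cos (t \<bullet> x + d) \<partial>L)"
      by (rule integral_distr[OF meas_inner]) measurable
    finally show ?case using b by blast
  next
    case (add f g)
    then obtain Bf Bg where b: "\<And>x. \<bar>f x\<bar> \<le> Bf" "\<And>x. \<bar>g x\<bar> \<le> Bg" by blast
    have i: "integrable M (\<lambda>\<omega>. f (X n \<omega>))" "integrable M (\<lambda>\<omega>. g (X n \<omega>))" for n
      using bounded_continuous_integrable[OF M X] trig_sum_continuous add.hyps b by blast+
    have j: "integrable L f" "integrable L g"
      using bounded_continuous_integrable[OF L(1) idL] trig_sum_continuous add.hyps b by blast+
    have "(\<lambda>n. (\<integral>\<omega>. f (X n \<omega>) \<partial>M) + (\<integral>\<omega>. g (X n \<omega>) \<partial>M)) \<longlonglongrightarrow> (\<integral>x. f x \<partial>L) + (\<integral>x. g x \<partial>L)"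
      using add.IH by (intro tendsto_add) auto
    moreover have "\<bar>f x + g x\<bar> \<le> Bf + Bg" for x using b[of x] by linarith
    ultimately show ?case using i j by auto
  qed
  have tight: "\<exists>K>0. eventually (\<lambda>n. measure M {\<omega>\<in>space M. norm (X n \<omega>) > K} < e) sequentially \<and> measure L {x. norm x > K} < e"
    if e: "e > 0" for e
  proof -
    define D where "D = real DIM('v)"
    have D: "D > 0" by (simp add: D_def)
    have "\<exists>K. K > 0 \<and> eventually (\<lambda>n. measure M {\<omega>\<in>space M. norm (b \<bullet> X n \<omega>) > K} < e / D) sequentially
          \<and> measure (distr L borel (\<lambda>x. b \<bullet> x)) {x. norm x > K} < e / D" for b
    proof -
      have meas: "(\<lambda>\<omega>. b \<bullet> X n \<omega>) \<in> borel_measurable M" for n by measurable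
      have "e / D > 0" using e D by simp
      obtain K where "K > 0" "eventually (\<lambda>n. measure M {\<omega>\<in>space M. norm (b \<bullet> X n \<omega>) > K} < e / D) sequentially"
          "measure (distr L borel (\<lambda>x. b \<bullet> x)) {x. norm x > K} < e / D"
        by (rule converges_in_distribution_tight[OF M meas L.prob_space_distr[OF meas_inner] sets_distr proj[of b] \<open>e / D > 0\<close>])
      then show ?thesis by blast
    qed
    then obtain K where K: "\<And>b. K b > 0"
      "\<And>b. eventually (\<lambda>n. measure M {\<omega>\<in>space M. norm (b \<bullet> X n \<omega>) > K b} < e / D) sequentially"
      "\<And>b. measure (distr L borel (\<lambda>x. b \<bullet> x)) {x. norm x > K b} < e / D"
      using choice[of "\<lambda>b K. K > 0 \<and> eventually (\<lambda>n. measure M {\<omega>\<in>space M. norm (b \<bullet> X n \<omega>) > K} < e / D) sequentially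
          \<and> measure (distr L borel (\<lambda>x. b \<bullet> x)) {x. norm x > K} < e / D"] by blast
    \<comment> \<open>A vector of norm above the sum of the coordinate thresholds exceeds one of
      them, because the norm is at most the sum of the absolute coordinates; a union bound over the
      basis follows.\<close>
    define K' where "K' = (\<Sum>b\<in>Basis. K b)"
    have K'_pos: "K' > 0" unfolding K'_def using K(1) by (intro sum_pos) auto
    have ex: "\<exists>b\<in>Basis. norm (b \<bullet> x) > K b" if "norm x > K'" for x :: 'v
    proof (rule ccontr)
      assume "\<not> ?thesis"
      then have "(\<Sum>b\<in>Basis. \<bar>x \<bullet> b\<bar>) \<le> K'"
        unfolding K'_def by (intro sum_mono) (auto simp: not_less inner_commute)
      then show False using norm_le_l1[of x] that by linarith
    qed
    have sumD: "(\<Sum>b\<in>(Basis::'v set). e / D) = e" using D by (simp add: D_def)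
    have union: "measure P {\<omega>\<in>space P. norm (Y \<omega>) > K'} \<le> (\<Sum>b\<in>Basis. measure P {\<omega>\<in>space P. norm (b \<bullet> Y \<omega>) > K b})"
      if "prob_space P" and [measurable]: "Y \<in> borel_measurable P" for P :: "'c measure" and Y :: "'c \<Rightarrow> 'v"
    proof -
      interpret P: prob_space P by fact
      have "measure P {\<omega>\<in>space P. norm (Y \<omega>) > K'} \<le> measure P (\<Union>b\<in>Basis. {\<omega>\<in>space P. norm (b \<bullet> Y \<omega>) > K b})"
        using ex by (intro P.finite_measure_mono) auto
      also have "\<dots> \<le> (\<Sum>b\<in>Basis. measure P {\<omega>\<in>space P. norm (b \<bullet> Y \<omega>) > K b})"
        by (rule P.finite_measure_subadditive_finite) auto
      finally show ?thesis .
    qed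
    have "eventually (\<lambda>n. \<forall>b\<in>Basis. measure M {\<omega>\<in>space M. norm (b \<bullet> X n \<omega>) > K b} < e / D) sequentially"
      using K(2) by (intro eventually_ball_finite) auto
    then have "eventually (\<lambda>n. measure M {\<omega>\<in>space M. norm (X n \<omega>) > K'} < e) sequentially"
    proof eventually_elim
      case (elim n)
      have "(\<Sum>b\<in>Basis. measure M {\<omega>\<in>space M. norm (b \<bullet> X n \<omega>) > K b}) < (\<Sum>b\<in>(Basis::'v set). e / D)"
        using elim by (intro sum_strict_mono) auto
      then show ?case using union[OF M X[of n]] sumD by linarith
    qed
    moreover have "measure L {x. norm x > K'} < e"
    proof -
      have "measure L {x. norm (b \<bullet> x) > K b} < e / D" for b
      proof -
        have "measure (distr L borel (\<lambda>x. b \<bullet> x)) {x. norm x > K b} = measure L {x. norm (b \<bullet> x) > K b}"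
          using measure_distr[OF meas_inner[of b], of "{x. norm x > K b}"] sp
          by (simp add: vimage_def)
        then show ?thesis using K(3)[of b] by simp
      qed
      then have "(\<Sum>b\<in>Basis. measure L {x. norm (b \<bullet> x) > K b}) < (\<Sum>b\<in>(Basis::'v set). e / D)"
        by (intro sum_strict_mono) auto
      then show ?thesis using union[OF L(1) idL] sumD sp by simp
    qed
    ultimately show ?thesis using K'_pos by blast
  qed
  show ?thesis
    unfolding converges_in_distribution_def
  proof (intro allI impI)
    fix f :: "'v \<Rightarrow> real" assume f: "continuous_on UNIV f" "bounded (range f)"
    then obtain B0 where "\<And>x. \<bar>f x\<bar> \<le> B0" by (auto simp: bounded_iff)
    then have "\<And>x. \<bar>f x\<bar> \<le> max B0 0" by (meson max.coboundedI1)
    then obtain B where B: "\<And>x. \<bar>f x\<bar> \<le> B" "B \<ge> 0" by (meson max.cobounded2)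
    show "(\<lambda>n. \<integral>\<omega>. f (X n \<omega>) \<partial>M) \<longlonglongrightarrow> (\<integral>x. f x \<partial>L)"
      unfolding tendsto_iff
    proof (intro allI impI)
      fix r :: real assume r: "r > 0"
      \<comment> \<open>Replacing f by g costs at most e + (2 B + 1) e under the limit and under the
        n-th law, and convergence for g costs another e; the denominator makes the total less than
        r. The bound e <= 1 keeps g below B + 1.\<close>
      define e where "e = min 1 (r / (4 * (2 * B + 4)))"
      have e: "e > 0" "e \<le> 1" using r B(2) by (auto simp: e_def)
      have "e * (4 * (2 * B + 4)) \<le> r"
      proof -
        have "e \<le> r / (4 * (2 * B + 4))" by (simp add: e_def)
        then show ?thesis using B(2) by (simp add: pos_le_divide_eq)
      qed
      moreover have "e * B \<ge> 0" using e B(2) by simp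
      ultimately have er: "3 * (e + (2 * B + 1) * e) < r" using e by (simp add: algebra_simps)
      obtain K where K: "K > 0" "eventually (\<lambda>n. measure M {\<omega>\<in>space M. norm (X n \<omega>) > K} < e) sequentially"
        "measure L {x. norm x > K} < e" using tight[OF e(1)] by blast
      obtain g where g: "trig_sum g" "\<And>x. \<bar>g x\<bar> \<le> B + e" "\<And>x. norm x \<le> K \<Longrightarrow> \<bar>f x - g x\<bar> \<le> e"
        using trig_sum_approx[OF f(1) B(1) K(1) e(1)] by blast
      have gB: "\<bar>g x\<bar> \<le> B + 1" for x using g(2)[of x] e(2) by linarith
      have gc: "continuous_on UNIV g" using g(1) trig_sum_continuous by blast
      have "\<bar>(\<integral>x. f x \<partial>L) - (\<integral>x. g x \<partial>L)\<bar> \<le> e + (B + (B + 1)) * measure L {x\<in>space L. norm x > K}"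
        using integral_diff_le_truncated[OF L(1) idL f(1) B(1) gc gB g(3)] e by simp
      also have "\<dots> \<le> e + (2 * B + 1) * e"
        using mult_mono[of "B + (B + 1)" "2 * B + 1" "measure L {x\<in>space L. norm x > K}" e] K(3) sp B(2) by simp
      finally have 1: "\<bar>(\<integral>x. f x \<partial>L) - (\<integral>x. g x \<partial>L)\<bar> \<le> e + (2 * B + 1) * e" .
      have "eventually (\<lambda>n. \<bar>(\<integral>\<omega>. g (X n \<omega>) \<partial>M) - (\<integral>x. g x \<partial>L)\<bar> < e) sequentially"
        using trig[OF g(1)] e(1) by (auto simp: tendsto_iff dist_real_def)
      then show "\<forall>\<^sub>F n in sequentially. dist (\<integral>\<omega>. f (X n \<omega>) \<partial>M) (\<integral>x. f x \<partial>L) < r"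
        using K(2)
      proof eventually_elim
        case (elim n)
        have "\<bar>(\<integral>\<omega>. f (X n \<omega>) \<partial>M) - (\<integral>\<omega>. g (X n \<omega>) \<partial>M)\<bar> \<le> e + (B + (B + 1)) * measure M {\<omega>\<in>space M. norm (X n \<omega>) > K}"
          using integral_diff_le_truncated[OF M X f(1) B(1) gc gB g(3)] e by simp
        also have "\<dots> \<le> e + (2 * B + 1) * e"
          using mult_mono[of "B + (B + 1)" "2 * B + 1" "measure M {\<omega>\<in>space M. norm (X n \<omega>) > K}" e] elim(2) B(2) by simp
        finally have 2: "\<bar>(\<integral>\<omega>. f (X n \<omega>) \<partial>M) - (\<integral>\<omega>. g (X n \<omega>) \<partial>M)\<bar> \<le> e + (2 * B + 1) * e" .
        have "e \<le> e + (2 * B + 1) * e" using B(2) e by simp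
        moreover have "\<bar>a - d\<bar> < r" if "\<bar>a - b\<bar> \<le> s" "\<bar>b - c\<bar> < e" "\<bar>d - c\<bar> \<le> s" "3 * s < r" "e \<le> s" for a b c d s :: real
          using that by linarith
        ultimately show ?case using 1 2 elim(1) er unfolding dist_real_def by blast
      qed
    qed
  qed
qed

text \<open>A bounded continuous test function is uniformly continuous only on compact sets.
  Tightness of \<open>Y\<close> confines attention to a ball; outside it, and where \<open>X\<close>
  and \<open>Y\<close> are far apart, the integrand is at most 2 B on events of small
  probability.\<close>

lemma converges_in_distribution_slutsky:
  fixes X Y :: "nat \<Rightarrow> 'a \<Rightarrow> 'v::euclidean_space"
  assumes M: "prob_space M" and X: "\<And>n. X n \<in> borel_measurable M" and Y: "\<And>n. Y n \<in> borel_measurable M"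
    and L: "prob_space L" "sets L = sets borel"
    and conv: "converges_in_distribution M Y L"
    and diff: "tendsto_in_probability M (\<lambda>n \<omega>. X n \<omega> - Y n \<omega>) 0"
  shows "converges_in_distribution M X L"
  unfolding converges_in_distribution_def
proof (intro allI impI)
  interpret M: prob_space M by fact
  have [measurable]: "X n \<in> borel_measurable M" "Y n \<in> borel_measurable M" for n by fact+
  fix f :: "'v \<Rightarrow> real" assume f: "continuous_on UNIV f" "bounded (range f)"
  then obtain B0 where "\<And>x. \<bar>f x\<bar> \<le> B0" by (auto simp: bounded_iff)
  then have "\<And>x. \<bar>f x\<bar> \<le> max B0 0" by (meson max.coboundedI1)
  then obtain B where B: "\<And>x. \<bar>f x\<bar> \<le> B" "B \<ge> 0" by (meson max.cobounded2)
  have fX: "integrable M (\<lambda>\<omega>. f (X n \<omega>))" and fY: "integrable M (\<lambda>\<omega>. f (Y n \<omega>))" for n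
    using bounded_continuous_integrable[OF M] f(1) B(1) X Y by blast+
  have "(\<lambda>n. (\<integral>\<omega>. f (X n \<omega>) \<partial>M) - (\<integral>\<omega>. f (Y n \<omega>) \<partial>M)) \<longlonglongrightarrow> 0"
    unfolding tendsto_iff
  proof (intro allI impI)
    fix r :: real assume r: "r > 0"
    define e where "e = r / (2 * (4 * B + 1))"
    have e: "e > 0" using r B(2) by (simp add: e_def)
    have "4 * B + 1 \<noteq> 0" using B(2) by simp
    moreover have "r / (2 * D) * D = r / 2" if "D \<noteq> 0" for D :: real using that by simp
    ultimately have "e * (4 * B + 1) = r / 2" unfolding e_def by blast
    then have er: "e * (4 * B + 1) < r" using r by simp
    obtain K where K: "K > 0" "eventually (\<lambda>n. measure M {\<omega>\<in>space M. norm (Y n \<omega>) > K} < e) sequentially"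
      by (rule converges_in_distribution_tight[OF M Y L conv e]) blast
    have "uniformly_continuous_on (cball 0 (K + 1)) f"
      by (intro compact_uniformly_continuous continuous_on_subset[OF f(1)]) auto
    then obtain d where d: "d > 0" "\<And>x x'. x \<in> cball 0 (K + 1) \<Longrightarrow> x' \<in> cball 0 (K + 1) \<Longrightarrow> dist x' x < d \<Longrightarrow> dist (f x') (f x) < e"
      using e unfolding uniformly_continuous_on_def by metis
    \<comment> \<open>The bound 1 keeps \<open>X n\<close> in the ball of radius K + 1 when
      \<open>Y n\<close> is in that of radius K; half of d makes the distance strictly smaller than
      d.\<close>
    define d' where "d' = min 1 (d / 2)"
    have d': "d' > 0" "d' \<le> 1" "d' < d" using d(1) by (auto simp: d'_def)
    have "(\<lambda>n. measure M {\<omega>\<in>space M. dist (X n \<omega> - Y n \<omega>) 0 > d'}) \<longlonglongrightarrow> 0"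
      using diff d'(1) unfolding tendsto_in_probability_def by blast
    then have "eventually (\<lambda>n. measure M {\<omega>\<in>space M. dist (X n \<omega> - Y n \<omega>) 0 > d'} < e) sequentially"
      using e order_tendstoD(2) by blast
    then show "\<forall>\<^sub>F n in sequentially. dist ((\<integral>\<omega>. f (X n \<omega>) \<partial>M) - (\<integral>\<omega>. f (Y n \<omega>) \<partial>M)) 0 < r"
      using K(2)
    proof eventually_elim
      case (elim n)
      define U where "U = {\<omega>\<in>space M. norm (Y n \<omega>) > K}"
      define V where "V = {\<omega>\<in>space M. dist (X n \<omega> - Y n \<omega>) 0 > d'}"
      have [measurable]: "U \<in> sets M" "V \<in> sets M" unfolding U_def V_def by measurable
      have "\<bar>(\<integral>\<omega>. f (X n \<omega>) \<partial>M) - (\<integral>\<omega>. f (Y n \<omega>) \<partial>M)\<bar> = \<bar>\<integral>\<omega>. f (X n \<omega>) - f (Y n \<omega>) \<partial>M\<bar>"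
        using fX fY by simp
      also have "\<dots> \<le> (\<integral>\<omega>. \<bar>f (X n \<omega>) - f (Y n \<omega>)\<bar> \<partial>M)" by (rule integral_abs_bound)
      also have "\<dots> \<le> (\<integral>\<omega>. e + 2 * B * indicator U \<omega> + 2 * B * indicator V \<omega> \<partial>M)"
      proof (rule integral_mono)
        show "integrable M (\<lambda>\<omega>. e + 2 * B * indicator U \<omega> + 2 * B * indicator V \<omega>)"
          by (auto simp: M.emeasure_eq_measure)
        fix \<omega> assume \<omega>: "\<omega> \<in> space M"
        have b: "\<bar>f (X n \<omega>) - f (Y n \<omega>)\<bar> \<le> 2 * B"
          using B(1)[of "X n \<omega>"] B(1)[of "Y n \<omega>"] by linarith
        show "\<bar>f (X n \<omega>) - f (Y n \<omega>)\<bar> \<le> e + 2 * B * indicator U \<omega> + 2 * B * indicator V \<omega>"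
        proof (cases "\<omega> \<in> U \<or> \<omega> \<in> V")
          case True
          then show ?thesis using b e B(2) by (auto simp: indicator_def)
        next
          case False
          then have "norm (Y n \<omega>) \<le> K" "norm (X n \<omega> - Y n \<omega>) \<le> d'"
            using \<omega> by (auto simp: U_def V_def)
          moreover then have "norm (X n \<omega>) \<le> K + 1"
            using norm_triangle_sub[of "X n \<omega>" "Y n \<omega>"] d'(2) by linarith
          ultimately have "dist (f (X n \<omega>)) (f (Y n \<omega>)) < e"
            using d'(3) by (intro d(2)) (auto simp: dist_norm)
          then show ?thesis using False by (simp add: dist_real_def)
        qed
      qed (use fX fY in auto)
      also have "\<dots> = e + 2 * B * measure M U + 2 * B * measure M V"
        by (simp add: M.prob_space M.emeasure_eq_measure)
      also have "\<dots> \<le> e + 2 * B * e + 2 * B * e"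
        using elim B(2) unfolding U_def V_def by (intro add_mono mult_left_mono) auto
      also have "\<dots> < r" using er by (simp add: algebra_simps)
      finally show ?case by simp
    qed
  qed
  moreover have "(\<lambda>n. \<integral>\<omega>. f (Y n \<omega>) \<partial>M) \<longlonglongrightarrow> (\<integral>x. f x \<partial>L)"
    using conv f by (auto simp: converges_in_distribution_def)
  ultimately show "(\<lambda>n. \<integral>\<omega>. f (X n \<omega>) \<partial>M) \<longlonglongrightarrow> (\<integral>x. f x \<partial>L)"
    using tendsto_add by fastforce
qed

section \<open>Square roots of positive definite matrices\<close>

lemma quadratic_nonneg_imp_linear_zero:
  fixes c d :: real
  assumes "\<And>t. 2 * t * c + t\<^sup>2 * d \<ge> 0"
  shows "c = 0"
proof (rule ccontr)
  assume c: "c \<noteq> 0"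
  \<comment> \<open>Evaluating at t = - c / s gives (c^2 / s) (d / s - 2), which is negative once s
    exceeds d.\<close>
  define s where "s = 1 + \<bar>d\<bar>"
  have s: "s > 0" "d < s" by (auto simp: s_def)
  have "0 \<le> 2 * (- c / s) * c + (- c / s)\<^sup>2 * d" by (rule assms)
  also have "\<dots> = c\<^sup>2 / s * (d / s - 2)"
    using s by (simp add: field_simps power2_eq_square)
  also have "\<dots> < 0"
  proof (rule mult_pos_neg)
    show "c\<^sup>2 / s > 0" using c s by simp
    have "d / s < 1" using s by (simp add: divide_less_eq)
    then show "d / s - 2 < 0" by simp
  qed
  finally show False by simp
qed

text \<open>The maximiser v of the Rayleigh quotient on the unit sphere of S is an eigenvector: the
  first variation in a direction y of S is the inner product of y with l v - f v, it has to vanish,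
  and l v - f v itself lies in S.\<close>

lemma self_adjoint_eigenvector:
  fixes f :: "'v::euclidean_space \<Rightarrow> 'v"
  assumes lin: "linear f" and sa: "\<And>x y. x \<bullet> f y = f x \<bullet> y"
    and S: "subspace S" "S \<noteq> {0}" "f ` S \<subseteq> S"
  obtains v l where "v \<in> S" "norm v = 1" "f v = l *\<^sub>R v"
proof -
  let ?K = "S \<inter> sphere 0 1"
  obtain w where w: "w \<in> S" "w \<noteq> 0" using S(1,2) subspace_0 by blast
  have "(1 / norm w) *\<^sub>R w \<in> ?K" using w S(1) by (auto simp: subspace_scale)
  then have ne: "?K \<noteq> {}" by blast
  have "compact ?K" using closed_subspace[OF S(1)] by (simp add: closed_Int_compact)
  moreover have "continuous_on ?K (\<lambda>x. x \<bullet> f x)"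
    using lin by (intro continuous_intros linear_continuous_on) (simp add: linear_conv_bounded_linear)
  ultimately obtain v where v: "v \<in> ?K" "\<And>x. x \<in> ?K \<Longrightarrow> x \<bullet> f x \<le> v \<bullet> f v"
    using continuous_attains_sup[OF _ ne] by blast
  define l where "l = v \<bullet> f v"
  have nv: "norm v = 1" "v \<in> S" using v(1) by auto
  have vv: "v \<bullet> v = 1" using nv(1) by (simp add: norm_eq_1)
  have le: "x \<bullet> f x \<le> l * (x \<bullet> x)" if "x \<in> S" for x
  proof (cases "x = 0")
    case False
    have "(1 / norm x) *\<^sub>R x \<in> ?K" using that False S(1) by (auto simp: subspace_scale)
    from v(2)[OF this] have "(x \<bullet> f x) / (norm x)\<^sup>2 \<le> l"
      by (simp add: l_def linear_scale[OF lin] power2_eq_square)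
    then show ?thesis using False by (simp add: divide_le_eq dot_square_norm)
  qed (simp add: linear_0[OF lin])
  have orth: "y \<bullet> (l *\<^sub>R v - f v) = 0" if y: "y \<in> S" for y
  proof (rule quadratic_nonneg_imp_linear_zero)
    fix t :: real
    have "v + t *\<^sub>R y \<in> S" using nv(2) y S(1) by (simp add: subspace_add subspace_scale)
    from le[OF this]
    have "v \<bullet> f v + 2 * t * (y \<bullet> f v) + t\<^sup>2 * (y \<bullet> f y) \<le> l * (v \<bullet> v) + 2 * t * (l * (y \<bullet> v)) + t\<^sup>2 * (l * (y \<bullet> y))"
      using sa[of v y]
      by (simp add: linear_add[OF lin] linear_scale[OF lin] inner_add_left inner_add_right inner_commute algebra_simps power2_eq_square)
    then show "2 * t * (y \<bullet> (l *\<^sub>R v - f v)) + t\<^sup>2 * (l * (y \<bullet> y) - y \<bullet> f y) \<ge> 0"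
      using vv by (simp add: l_def inner_diff_right algebra_simps)
  qed
  have "f v \<in> S" using S(3) nv(2) by blast
  then have "l *\<^sub>R v - f v \<in> S" using nv(2) S(1) by (simp add: subspace_diff subspace_scale)
  from orth[OF this] have "f v = l *\<^sub>R v" by simp
  then show thesis using that nv by blast
qed

text \<open>Induction on the dimension: self-adjointness makes the orthogonal complement of an
  eigenvector within S invariant again.\<close>

lemma self_adjoint_diagonalisable_on:
  fixes f :: "'v::euclidean_space \<Rightarrow> 'v"
  assumes lin: "linear f" and sa: "\<And>x y. x \<bullet> f y = f x \<bullet> y"
    and S: "subspace S" "f ` S \<subseteq> S"
  shows "\<exists>B \<subseteq> S. finite B \<and> pairwise orthogonal B \<and> (\<forall>b\<in>B. norm b = 1) \<and> S \<subseteq> span B \<and> (\<forall>b\<in>B. \<exists>l. f b = l *\<^sub>R b)"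
  using S
proof (induction "dim S" arbitrary: S rule: less_induct)
  case less
  show ?case
  proof (cases "S = {0}")
    case True
    then show ?thesis by (intro exI[of _ "{}"]) (auto simp: pairwise_def)
  next
    case False
    obtain v l where v: "v \<in> S" "norm v = 1" "f v = l *\<^sub>R v"
      using self_adjoint_eigenvector[OF lin sa less.prems(1) False less.prems(2)] by metis
    have vv: "v \<bullet> v = 1" using v(2) by (simp add: norm_eq_1)
    define S' where "S' = {x \<in> S. v \<bullet> x = 0}"
    have sub: "subspace S'"
      using less.prems(1) unfolding S'_def subspace_def by (auto simp: inner_add_right)
    have inv: "f ` S' \<subseteq> S'"
      using less.prems(2) sa[of v] v(3) by (auto simp: S'_def)
    have "v \<notin> S'" using vv by (simp add: S'_def)
    moreover have "S' \<subseteq> S" unfolding S'_def by blast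
    ultimately have "S' \<subset> S" using v(1) by blast
    then have "dim S' < dim S"
      using dim_psubset[of S' S] sub less.prems(1) by (metis span_eq_iff)
    from less.hyps[OF this sub inv] obtain B where B: "B \<subseteq> S'" "finite B" "pairwise orthogonal B"
      "\<forall>b\<in>B. norm b = 1" "S' \<subseteq> span B" "\<forall>b\<in>B. \<exists>l. f b = l *\<^sub>R b" by blast
    show ?thesis
    proof (intro exI[of _ "insert v B"] conjI)
      show "insert v B \<subseteq> S" using v(1) B(1) by (auto simp: S'_def)
      show "finite (insert v B)" using B(2) by simp
      show "pairwise orthogonal (insert v B)"
        using B(1,3) by (auto simp: pairwise_insert orthogonal_def S'_def inner_commute)
      show "\<forall>b\<in>insert v B. norm b = 1" using B(4) v(2) by simp
      show "\<forall>b\<in>insert v B. \<exists>l. f b = l *\<^sub>R b" using B(6) v(3) by auto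
      show "S \<subseteq> span (insert v B)"
      proof
        fix x assume x: "x \<in> S"
        have "x - (v \<bullet> x) *\<^sub>R v \<in> S'"
          using x v(1) less.prems(1) vv by (simp add: S'_def subspace_diff subspace_scale inner_diff_right)
        then have "x - (v \<bullet> x) *\<^sub>R v \<in> span B" using B(5) by blast
        then show "x \<in> span (insert v B)" by (auto simp: span_insert)
      qed
    qed
  qed
qed

theorem self_adjoint_diagonalisable:
  fixes f :: "'v::euclidean_space \<Rightarrow> 'v"
  assumes lin: "linear f" and sa: "\<And>x y. x \<bullet> f y = f x \<bullet> y"
  obtains B l where "finite B" "pairwise orthogonal B" "\<And>b. b \<in> B \<Longrightarrow> norm b = 1"
    "\<And>x. (\<Sum>b\<in>B. (x \<bullet> b) *\<^sub>R b) = x" "\<And>b. b \<in> B \<Longrightarrow> f b = l b *\<^sub>R b"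
    "\<And>x. f x = (\<Sum>b\<in>B. (l b * (x \<bullet> b)) *\<^sub>R b)"
proof -
  obtain B where B: "finite B" "pairwise orthogonal B" "\<forall>b\<in>B. norm b = 1" "UNIV \<subseteq> span B"
    "\<forall>b\<in>B. \<exists>l. f b = l *\<^sub>R b"
    using self_adjoint_diagonalisable_on[OF lin sa, of UNIV] by auto
  then obtain l where l: "\<And>b. b \<in> B \<Longrightarrow> f b = l b *\<^sub>R b" by metis
  have exp: "(\<Sum>b\<in>B. (x \<bullet> b) *\<^sub>R b) = x" for x
    using orthonormal_basis_expand[of B x] B by blast
  have "f x = (\<Sum>b\<in>B. (l b * (x \<bullet> b)) *\<^sub>R b)" for x
  proof -
    have "f x = f (\<Sum>b\<in>B. (x \<bullet> b) *\<^sub>R b)" by (simp add: exp)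
    also have "\<dots> = (\<Sum>b\<in>B. (x \<bullet> b) *\<^sub>R f b)" by (simp add: linear_sum[OF lin] linear_scale[OF lin])
    also have "\<dots> = (\<Sum>b\<in>B. (l b * (x \<bullet> b)) *\<^sub>R b)" by (intro sum.cong) (auto simp: l mult.commute)
    finally show ?thesis .
  qed
  then show thesis using that B exp l by blast
qed

section \<open>Existence and uniqueness of positive definite square roots\<close>

definition sym_pos_def :: "real^'n^'n \<Rightarrow> bool" where
  "sym_pos_def A \<longleftrightarrow> transpose A = A \<and> pos_def_matrix A"

lemma symmetric_matrix_iff:
  fixes A :: "real^'n^'n"
  shows "transpose A = A \<longleftrightarrow> (\<forall>x y. x \<bullet> (A *v y) = (A *v x) \<bullet> y)"
proof
  assume A: "transpose A = A"
  show "\<forall>x y. x \<bullet> (A *v y) = (A *v x) \<bullet> y"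
    by (metis A dot_lmul_matrix transpose_matrix_vector)
next
  assume "\<forall>x y. x \<bullet> (A *v y) = (A *v x) \<bullet> y"
  then have "(transpose A *v x) \<bullet> y = (A *v x) \<bullet> y" for x y
    by (metis dot_lmul_matrix transpose_matrix_vector)
  then show "transpose A = A" by (metis matrix_eq vector_eq_rdot)
qed

lemma pos_def_invertible:
  fixes A :: "real^'n^'n"
  assumes "pos_def_matrix A"
  shows "invertible A"
proof -
  have "\<forall>x. A *v x = 0 \<longrightarrow> x = 0"
    using assms unfolding pos_def_matrix_def by (metis inner_zero_right less_irrefl)
  then show ?thesis by (simp add: invertible_left_inverse matrix_left_invertible_ker)
qed

lemma matrix_inv_inverse:
  fixes A :: "real^'n^'n"
  assumes "invertible A"
  shows "A ** matrix_inv A = mat 1" "matrix_inv A ** A = mat 1"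
proof -
  have "A ** matrix_inv A = mat 1 \<and> matrix_inv A ** A = mat 1"
    unfolding matrix_inv_def using assms unfolding invertible_def by (rule someI_ex)
  then show "A ** matrix_inv A = mat 1" "matrix_inv A ** A = mat 1" by auto
qed

lemma sym_pos_def_matrix_inv:
  fixes A :: "real^'n^'n"
  assumes "sym_pos_def A"
  shows "sym_pos_def (matrix_inv A)"
proof -
  have A: "transpose A = A" "pos_def_matrix A" using assms by (auto simp: sym_pos_def_def)
  note inv = matrix_inv_inverse[OF pos_def_invertible[OF A(2)]]
  have AB: "A *v (matrix_inv A *v x) = x" for x by (simp add: matrix_vector_mul_assoc inv)
  have sa: "x \<bullet> (A *v y) = (A *v x) \<bullet> y" for x y using A(1) symmetric_matrix_iff by blast
  have "transpose (matrix_inv A) = matrix_inv A"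
    unfolding symmetric_matrix_iff by (metis AB sa)
  moreover have "pos_def_matrix (matrix_inv A)"
    unfolding pos_def_matrix_def
  proof (intro allI impI)
    fix v :: "real^'n" assume "v \<noteq> 0"
    then have "matrix_inv A *v v \<noteq> 0" using AB[of v] by auto
    then have "(matrix_inv A *v v) \<bullet> (A *v (matrix_inv A *v v)) > 0"
      using A(2) by (simp add: pos_def_matrix_def)
    then show "v \<bullet> (matrix_inv A *v v) > 0" by (simp add: AB inner_commute)
  qed
  ultimately show ?thesis by (simp add: sym_pos_def_def)
qed

text \<open>In an orthonormal eigenbasis the root takes the square roots of the eigenvalues, which
  are positive.\<close>

lemma sym_pos_def_sqrt_exists:
  fixes A :: "real^'n^'n"
  assumes "sym_pos_def A"
  obtains R where "sym_pos_def R" "R ** R = A"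
proof -
  have A: "transpose A = A" "pos_def_matrix A" using assms by (auto simp: sym_pos_def_def)
  have sa: "\<And>x y. x \<bullet> (A *v y) = (A *v x) \<bullet> y" using A(1) symmetric_matrix_iff by blast
  obtain B l where B: "finite B" "pairwise orthogonal B" "\<And>b. b \<in> B \<Longrightarrow> norm b = 1"
    "\<And>x. (\<Sum>b\<in>B. (x \<bullet> b) *\<^sub>R b) = x" "\<And>b. b \<in> B \<Longrightarrow> A *v b = l b *\<^sub>R b"
    "\<And>x. A *v x = (\<Sum>b\<in>B. (l b * (x \<bullet> b)) *\<^sub>R b)"
    by (rule self_adjoint_diagonalisable[OF matrix_vector_mul_linear[of A] sa]) (rule that; assumption)
  have bb: "b \<bullet> b' = (if b = b' then 1 else 0)" if "b \<in> B" "b' \<in> B" for b b'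
    using that B(2,3) by (auto simp: pairwise_def orthogonal_def norm_eq_1)
  have l: "l b > 0" if "b \<in> B" for b
  proof -
    have "b \<noteq> 0" using B(3)[OF that] by auto
    then have "b \<bullet> (A *v b) > 0" using A(2) by (simp add: pos_def_matrix_def)
    then show ?thesis using B(5)[OF that] bb[OF that that] by simp
  qed
  define r where "r x = (\<Sum>b\<in>B. (sqrt (l b) * (x \<bullet> b)) *\<^sub>R b)" for x :: "real^'n"
  have lin: "linear r"
    unfolding r_def by (intro linearI) (simp_all add: inner_add_left algebra_simps sum.distrib scaleR_sum_right)
  define R where "R = matrix r"
  have R: "R *v x = r x" for x by (simp add: R_def matrix_works lin linear_matrix_vector_mul_eq)
  have rb: "r x \<bullet> b = sqrt (l b) * (x \<bullet> b)" if "b \<in> B" for x b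
  proof -
    have "r x \<bullet> b = (\<Sum>b'\<in>B. if b' = b then sqrt (l b') * (x \<bullet> b') else 0)"
      unfolding r_def inner_sum_left by (intro sum.cong) (auto simp: bb that)
    then show ?thesis using that B(1) by simp
  qed
  have xr: "x \<bullet> r y = (\<Sum>b\<in>B. sqrt (l b) * (y \<bullet> b) * (x \<bullet> b))" for x y
    by (simp add: r_def inner_sum_right)
  have "R ** R = A"
    unfolding matrix_eq
  proof
    fix x
    have "(R ** R) *v x = r (r x)" by (simp add: matrix_vector_mul_assoc[symmetric] R)
    also have "\<dots> = (\<Sum>b\<in>B. (l b * (x \<bullet> b)) *\<^sub>R b)"
      unfolding r_def[of "r x"] using l by (intro sum.cong) (auto simp: rb mult.assoc[symmetric] less_imp_le)
    finally show "(R ** R) *v x = A *v x" by (simp add: B(6))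
  qed
  moreover have "transpose R = R"
    unfolding symmetric_matrix_iff R
    by (auto simp: xr inner_commute[of "r _"] mult_ac intro!: sum.cong)
  moreover have "pos_def_matrix R"
    unfolding pos_def_matrix_def R
  proof (intro allI impI)
    fix v :: "real^'n" assume v: "v \<noteq> 0"
    have "\<exists>b\<in>B. v \<bullet> b \<noteq> 0"
    proof (rule ccontr)
      assume "\<not> ?thesis"
      then have "(\<Sum>b\<in>B. (v \<bullet> b) *\<^sub>R b) = 0" by simp
      then show False using B(4)[of v] v by simp
    qed
    then obtain b where b: "b \<in> B" "v \<bullet> b \<noteq> 0" by blast
    have "sqrt (l b) * (v \<bullet> b) * (v \<bullet> b) > 0"
      using b l[OF b(1)] by (metis mult.assoc mult_pos_pos not_real_square_gt_zero real_sqrt_gt_zero)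
    moreover have "sqrt (l b') * (v \<bullet> b') * (v \<bullet> b') \<ge> 0" if "b' \<in> B" for b'
      using l[OF that] by (simp add: mult.assoc less_imp_le)
    ultimately show "v \<bullet> r v > 0"
      unfolding xr by (intro sum_pos2[OF B(1) b(1)]) auto
  qed
  ultimately show thesis using that by (simp add: sym_pos_def_def)
qed

text \<open>The constant is the minimum of the quadratic form on the compact unit sphere. It serves
  as the modulus in the Lipschitz estimate for square roots.\<close>

lemma pos_def_lower_bound:
  fixes A :: "real^'n^'n"
  assumes "pos_def_matrix A"
  obtains c where "c > 0" "\<And>v. v \<bullet> (A *v v) \<ge> c * (v \<bullet> v)"
proof -
  have "continuous_on (sphere 0 1) (\<lambda>v. v \<bullet> (A *v v))"
    by (intro continuous_intros linear_continuous_on matrix_vector_mul_bounded_linear)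
  moreover have "sphere (0::real^'n) 1 \<noteq> {}" by simp
  ultimately obtain w where w: "w \<in> sphere 0 1" "\<And>v. v \<in> sphere 0 1 \<Longrightarrow> w \<bullet> (A *v w) \<le> v \<bullet> (A *v v)"
    using continuous_attains_inf[of "sphere (0::real^'n) 1" "\<lambda>v. v \<bullet> (A *v v)"] compact_sphere by blast
  have "w \<noteq> 0" using w(1) by auto
  then have "w \<bullet> (A *v w) > 0" using assms by (simp add: pos_def_matrix_def)
  moreover have "v \<bullet> (A *v v) \<ge> (w \<bullet> (A *v w)) * (v \<bullet> v)" for v
  proof (cases "v = 0")
    case False
    have "w \<bullet> (A *v w) \<le> ((1 / norm v) *\<^sub>R v) \<bullet> (A *v ((1 / norm v) *\<^sub>R v))"
      using False by (intro w(2)) simp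
    also have "\<dots> = (v \<bullet> (A *v v)) / (norm v)\<^sup>2"
      by (simp add: matrix_vector_mult_scaleR power2_eq_square)
    finally show ?thesis using False by (simp add: le_divide_eq dot_square_norm)
  qed simp
  ultimately show thesis using that by blast
qed

text \<open>With \<open>D = R - S\<close> and \<open>P = R + S\<close> one has \<open>2 (R\<^sup>2 - S\<^sup>2) = D P + P D\<close>; testing against
  \<open>D\<close> gives uniqueness and continuity of the square root at once.\<close>

lemma sqrt_matrix_lipschitz:
  fixes R S :: "real^'n^'n"
  assumes R: "sym_pos_def R" and S: "sym_pos_def S" and c: "\<And>v. v \<bullet> (S *v v) \<ge> c * (v \<bullet> v)"
  shows "c * norm (R - S) \<le> norm (R ** R - S ** S)"
proof -
  define D where "D = R - S"
  define P where "P = R + S"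
  have sym: "transpose R = R" "transpose S = S" using R S by (auto simp: sym_pos_def_def)
  have tD: "transpose D = D" and tP: "transpose P = P"
    using sym by (simp_all add: D_def P_def transpose_def vec_eq_iff)
  have P: "v \<bullet> (P *v v) \<ge> c * (v \<bullet> v)" for v
  proof -
    have "v \<bullet> (R *v v) \<ge> 0"
      using R by (cases "v = 0") (auto simp: sym_pos_def_def pos_def_matrix_def less_imp_le)
    then show ?thesis using c[of v] by (simp add: P_def matrix_vector_mult_add_rdistrib inner_add_right)
  qed
  have inner_transpose: "transpose A \<bullet> transpose B = A \<bullet> B" for A B :: "real^'n^'n"
    unfolding inner_vec_def transpose_def by (simp add: inner_vec_def) (rule sum.swap)
  \<comment> \<open>The Frobenius inner product is the sum of the inner products of rows. As P is
    symmetric, the rows of D P are P applied to the rows of D, so the lower bound for P can be used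
    row by row.\<close>
  have row: "(D ** P) $ i = P *v (D $ i)" for i
  proof -
    have "(D ** P) $ i = D $ i v* P"
      by (simp add: vec_eq_iff matrix_matrix_mult_def vector_matrix_mult_def mult.commute)
    also have "\<dots> = transpose P *v D $ i" by simp
    finally show ?thesis by (simp only: tP)
  qed
  have "c * (D \<bullet> D) = (\<Sum>i\<in>UNIV. c * (D $ i \<bullet> D $ i))" by (simp add: inner_vec_def sum_distrib_left)
  also have "\<dots> \<le> (\<Sum>i\<in>UNIV. D $ i \<bullet> (P *v (D $ i)))" by (intro sum_mono P)
  also have "\<dots> = D \<bullet> (D ** P)" unfolding inner_vec_def[of D] row ..
  finally have 1: "c * (D \<bullet> D) \<le> D \<bullet> (D ** P)" .
  have "D \<bullet> (P ** D) = D \<bullet> (D ** P)"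
    using inner_transpose[of D "P ** D"] by (simp only: matrix_transpose_mul tD tP)
  moreover have "D ** P + P ** D = 2 *\<^sub>R (R ** R - S ** S)"
    unfolding D_def P_def
    by (simp add: vec_eq_iff matrix_matrix_mult_def algebra_simps sum.distrib sum_subtractf)
  ultimately have "2 * (D \<bullet> (D ** P)) = D \<bullet> (2 *\<^sub>R (R ** R - S ** S))"
    by (metis inner_add_right mult_2)
  then have "c * (norm D * norm D) \<le> D \<bullet> (R ** R - S ** S)"
    using 1 by (simp add: dot_square_norm power2_eq_square)
  also have "\<dots> \<le> norm D * norm (R ** R - S ** S)" by (rule norm_cauchy_schwarz)
  finally have "norm D * (c * norm D) \<le> norm D * norm (R ** R - S ** S)" by (simp add: mult_ac)
  then show ?thesis
    unfolding D_def[symmetric] by (cases "norm D = 0") (auto simp: mult_le_cancel_left)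
qed

lemma sym_pos_def_sqrt_unique:
  fixes R S :: "real^'n^'n"
  assumes "sym_pos_def R" "sym_pos_def S" "R ** R = S ** S"
  shows "R = S"
proof -
  obtain c where c: "c > 0" "\<And>v. v \<bullet> (S *v v) \<ge> c * (v \<bullet> v)"
    using assms(2) pos_def_lower_bound[of S] unfolding sym_pos_def_def by metis
  have "c * norm (R - S) \<le> 0" using sqrt_matrix_lipschitz[OF assms(1,2) c(2)] assms(3) by simp
  then show ?thesis using c(1) by (simp add: mult_le_0_iff)
qed

lemma inv_sqrt_matrix:
  fixes A :: "real^'n^'n"
  assumes "sym_pos_def A"
  shows "sym_pos_def (inv_sqrt_matrix A)" "inv_sqrt_matrix A ** inv_sqrt_matrix A = matrix_inv A"
proof -
  have "\<exists>!R. transpose R = R \<and> pos_def_matrix R \<and> R ** R = matrix_inv A"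
  proof -
    obtain R where "sym_pos_def R" "R ** R = matrix_inv A"
      using sym_pos_def_sqrt_exists[OF sym_pos_def_matrix_inv[OF assms]] by blast
    then show ?thesis
      using sym_pos_def_sqrt_unique unfolding sym_pos_def_def by metis
  qed
  from theI'[OF this]
  show "sym_pos_def (inv_sqrt_matrix A)" "inv_sqrt_matrix A ** inv_sqrt_matrix A = matrix_inv A"
    unfolding inv_sqrt_matrix_def sym_pos_def_def by auto
qed

lemma inv_sqrt_matrix_whitens:
  fixes A :: "real^'n^'n"
  assumes "sym_pos_def A"
  shows "inv_sqrt_matrix A ** A ** inv_sqrt_matrix A = mat 1"
proof -
  let ?S = "inv_sqrt_matrix A"
  have A: "pos_def_matrix A" using assms by (simp add: sym_pos_def_def)
  have "?S ** (?S ** A) = mat 1"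
    using inv_sqrt_matrix(2)[OF assms] matrix_inv_inverse[OF pos_def_invertible[OF A]]
    by (simp add: matrix_mul_assoc)
  then show ?thesis by (simp add: matrix_left_right_inverse)
qed

lemma inv_sqrt_matrix_mat_1: "inv_sqrt_matrix (mat 1) = (mat 1 :: real^'n^'n)"
proof -
  have 1: "sym_pos_def (mat 1 :: real^'n^'n)"
    by (auto simp: sym_pos_def_def pos_def_matrix_def)
  have "matrix_inv (mat 1) = (mat 1 :: real^'n^'n)"
    using matrix_inv_inverse(2)[OF pos_def_invertible, of "mat 1"] 1 by (simp add: sym_pos_def_def)
  then show ?thesis using sym_pos_def_sqrt_unique[OF inv_sqrt_matrix(1)[OF 1] 1] inv_sqrt_matrix(2)[OF 1] by simp
qed

section \<open>Continuity and measurability of the inverse square root\<close>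

lemma continuous_on_det:
  fixes f :: "'a::topological_space \<Rightarrow> real^'n^'n"
  assumes "\<And>i j. continuous_on A (\<lambda>x. f x $ i $ j)"
  shows "continuous_on A (\<lambda>x. det (f x))"
  unfolding det_def by (intro continuous_intros assms)

lemma continuous_on_matrix_entries:
  fixes f :: "'a::topological_space \<Rightarrow> real^'n^'m"
  assumes "\<And>i j. continuous_on A (\<lambda>x. f x $ i $ j)"
  shows "continuous_on A f"
proof -
  have "continuous_on A (\<lambda>x. \<chi> i. \<chi> j. f x $ i $ j)"
    by (intro continuous_on_vec_lambda assms)
  then show ?thesis by simp
qed

text \<open>Cramer's rule writes each entry of the inverse as a quotient of determinants.\<close>

lemma continuous_on_matrix_inv: "continuous_on {A::real^'n^'n. det A \<noteq> 0} matrix_inv"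
proof (rule continuous_on_matrix_entries)
  fix i j :: 'n
  have eq: "matrix_inv A $ i $ j = det (\<chi> k l. if l = i then (axis j 1 :: real^'n) $ k else A $ k $ l) / det A"
    if "det A \<noteq> 0" for A :: "real^'n^'n"
  proof -
    have "invertible A" using that by (simp add: invertible_det_nz)
    then have "A *v (matrix_inv A *v axis j 1) = axis j 1"
      using matrix_inv_inverse(1)[of A] by (simp only: matrix_vector_mul_assoc matrix_vector_mul_lid)
    then have "matrix_inv A *v axis j 1 = (\<chi> i. det (\<chi> k l. if l = i then (axis j 1 :: real^'n) $ k else A $ k $ l) / det A)"
      using cramer[OF that] by blast
    then have "(matrix_inv A *v axis j 1) $ i = det (\<chi> k l. if l = i then (axis j 1 :: real^'n) $ k else A $ k $ l) / det A"
      by simp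
    then show ?thesis by (simp add: matrix_vector_mult_basis column_def)
  qed
  have entries: "continuous_on {A::real^'n^'n. det A \<noteq> 0}
      (\<lambda>A. (\<chi> k l. if l = i then (axis j 1 :: real^'n) $ k else A $ k $ l) $ k $ l)" for k l
    by (cases "l = i") (auto intro!: continuous_intros)
  have "continuous_on {A::real^'n^'n. det A \<noteq> 0}
      (\<lambda>A. det (\<chi> k l. if l = i then (axis j 1 :: real^'n) $ k else A $ k $ l) / det A)"
    by (intro continuous_on_divide continuous_on_det entries) (auto intro!: continuous_intros)
  then show "continuous_on {A::real^'n^'n. det A \<noteq> 0} (\<lambda>A. matrix_inv A $ i $ j)"
    by (rule continuous_on_cong[THEN iffD1, rotated 2]) (auto simp: eq)
qed

text \<open>The Lipschitz estimate requires a lower bound for one of the two roots only. Taking it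
  at the limit point A gives a constant that does not vary with the approaching matrices.\<close>

lemma continuous_on_inv_sqrt_matrix: "continuous_on {A::real^'n^'n. sym_pos_def A} inv_sqrt_matrix"
  unfolding continuous_on_def
proof
  fix A :: "real^'n^'n" assume "A \<in> {A. sym_pos_def A}"
  then have A: "sym_pos_def A" by simp
  let ?F = "at A within {A. sym_pos_def A}"
  obtain c where c: "c > 0" "\<And>v. v \<bullet> (inv_sqrt_matrix A *v v) \<ge> c * (v \<bullet> v)"
    using inv_sqrt_matrix(1)[OF A] pos_def_lower_bound unfolding sym_pos_def_def by metis
  have sub: "{A::real^'n^'n. sym_pos_def A} \<subseteq> {A. det A \<noteq> 0}"
    using pos_def_invertible by (auto simp: sym_pos_def_def invertible_det_nz)
  have "(matrix_inv \<longlongrightarrow> matrix_inv A) ?F"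
    using continuous_on_subset[OF continuous_on_matrix_inv sub] A by (auto simp: continuous_on_def)
  then have lim: "((\<lambda>B. norm (matrix_inv B - matrix_inv A) / c) \<longlongrightarrow> 0) ?F"
    using tendsto_divide[OF tendsto_norm_zero[OF LIM_zero] tendsto_const[of c]] c(1) by fastforce
  have "\<forall>\<^sub>F B in ?F. norm (inv_sqrt_matrix B - inv_sqrt_matrix A) \<le> norm (matrix_inv B - matrix_inv A) / c"
    unfolding eventually_at_filter
  proof (rule always_eventually, intro allI impI)
    fix B :: "real^'n^'n" assume "B \<in> {A. sym_pos_def A}"
    then have B: "sym_pos_def B" by simp
    show "norm (inv_sqrt_matrix B - inv_sqrt_matrix A) \<le> norm (matrix_inv B - matrix_inv A) / c"
      using sqrt_matrix_lipschitz[OF inv_sqrt_matrix(1)[OF B] inv_sqrt_matrix(1)[OF A] c(2)] c(1)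
      by (simp add: inv_sqrt_matrix(2) A B le_divide_eq mult.commute)
  qed
  then have "((\<lambda>B. inv_sqrt_matrix B - inv_sqrt_matrix A) \<longlongrightarrow> 0) ?F"
    by (rule Lim_null_comparison[OF _ lim])
  then show "(inv_sqrt_matrix \<longlongrightarrow> inv_sqrt_matrix A) ?F" by (simp add: LIM_zero_iff)
qed

lemma continuous_on_matrix_vector_quadratic: "continuous_on A (\<lambda>B::real^'n^'n. v \<bullet> (B *v v))"
  unfolding matrix_vector_mult_def inner_vec_def by (auto intro!: continuous_intros)

text \<open>Strict positivity is a uniform lower bound 1 / (k + 1) for some k, and each such bound
  defines a closed set. The set is the domain on which the whitening matrix is defined by
  cases.\<close>

lemma borel_sym_pos_def: "{A::real^'n^'n. sym_pos_def A} \<in> sets borel"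
proof -
  have eq: "{A::real^'n^'n. sym_pos_def A} = (\<Union>k::nat. {A. transpose A = A \<and> (\<forall>v. v \<bullet> (A *v v) \<ge> (1 / Suc k) * (v \<bullet> v))})"
  proof safe
    fix A :: "real^'n^'n" assume "sym_pos_def A"
    then have A: "transpose A = A" "pos_def_matrix A" by (auto simp: sym_pos_def_def)
    obtain c where c: "c > 0" "\<And>v. v \<bullet> (A *v v) \<ge> c * (v \<bullet> v)" using pos_def_lower_bound[OF A(2)] by blast
    obtain k where k: "1 / Suc k < c" using c(1) nat_approx_posE by metis
    have "v \<bullet> (A *v v) \<ge> (1 / Suc k) * (v \<bullet> v)" for v
    proof -
      have "(1 / Suc k) * (v \<bullet> v) \<le> c * (v \<bullet> v)" using k by (intro mult_right_mono) auto
      then show ?thesis using c(2)[of v] by linarith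
    qed
    then show "A \<in> (\<Union>k::nat. {A. transpose A = A \<and> (\<forall>v. v \<bullet> (A *v v) \<ge> (1 / Suc k) * (v \<bullet> v))})"
      using A(1) by blast
  next
    fix A :: "real^'n^'n" and k :: nat
    assume A: "transpose A = A" "\<forall>v. v \<bullet> (A *v v) \<ge> (1 / Suc k) * (v \<bullet> v)"
    have "v \<bullet> (A *v v) > 0" if "v \<noteq> 0" for v
    proof -
      have "0 < (1 / Suc k) * (v \<bullet> v)" using that by simp
      then show ?thesis using A(2) by (meson less_le_trans)
    qed
    then show "sym_pos_def A" using A(1) by (simp add: sym_pos_def_def pos_def_matrix_def)
  qed
  have cl: "closed {A::real^'n^'n. transpose A = A \<and> (\<forall>v. v \<bullet> (A *v v) \<ge> c * (v \<bullet> v))}" for c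
  proof -
    have "{A::real^'n^'n. transpose A = A} = (\<Inter>i. \<Inter>j. {A. A $ j $ i = A $ i $ j})"
      by (auto simp: transpose_def vec_eq_iff)
    moreover have "closed (\<Inter>i. \<Inter>j. {A::real^'n^'n. A $ j $ i = A $ i $ j})"
      by (intro closed_INT ballI closed_Collect_eq continuous_intros)
    ultimately have "closed {A::real^'n^'n. transpose A = A}" by simp
    moreover have "closed {A::real^'n^'n. \<forall>v. v \<bullet> (A *v v) \<ge> c * (v \<bullet> v)}"
      by (intro closed_Collect_all closed_Collect_le continuous_on_matrix_vector_quadratic continuous_intros)
    ultimately show ?thesis by (simp add: Collect_conj_eq closed_Int)
  qed
  show ?thesis unfolding eq by (intro sets.countable_UN image_subsetI borel_closed cl)
qed

section \<open>Central limit theorem and delta method\<close>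

definition centred_normal :: "real \<Rightarrow> real measure" where
  "centred_normal s = (if s = 0 then return borel 0 else density lborel (normal_density 0 s))"

lemma centred_normal_moments:
  assumes "s \<ge> 0"
  shows "(\<integral>x. x \<partial>centred_normal s) = 0" "(\<integral>x. x\<^sup>2 \<partial>centred_normal s) = s\<^sup>2"
proof -
  have "(\<integral>x. x \<partial>centred_normal s) = 0 \<and> (\<integral>x. x\<^sup>2 \<partial>centred_normal s) = s\<^sup>2"
  proof (cases "s = 0")
    case True
    then show ?thesis by (simp add: centred_normal_def integral_return)
  next
    case False
    then have s: "s > 0" using assms by simp
    interpret P: prob_space "density lborel (normal_density 0 s)" by (rule prob_space_normal_density[OF s])
    have D: "distributed (density lborel (normal_density 0 s)) lborel (\<lambda>x. x) (normal_density 0 s)"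
      by (auto simp: distributed_def distr_id2)
    have "P.expectation (\<lambda>x. x) = 0" by (rule P.normal_distributed_expectation[OF s D])
    moreover have "P.variance (\<lambda>x. x) = s\<^sup>2" by (rule P.normal_distributed_variance[OF s D])
    ultimately show ?thesis using False by (simp add: centred_normal_def)
  qed
  then show "(\<integral>x. x \<partial>centred_normal s) = 0" "(\<integral>x. x\<^sup>2 \<partial>centred_normal s) = s\<^sup>2" by auto
qed

text \<open>Independent standard normal coordinates along an orthonormal eigenbasis of
  \<open>q\<close>, scaled by the roots of its eigenvalues. Zero eigenvalues are allowed, so the law
  may be degenerate.\<close>

lemma gaussian_exists:
  fixes q :: "'v::euclidean_space \<Rightarrow> 'v"
  assumes lin: "linear q" and sa: "\<And>x y. x \<bullet> q y = q x \<bullet> y" and psd: "\<And>x. x \<bullet> q x \<ge> 0"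
  obtains L :: "'v measure" where "prob_space L" "sets L = sets borel"
    "\<And>t. distr L borel (\<lambda>x. t \<bullet> x) = centred_normal (sqrt (t \<bullet> q t))"
proof -
  obtain B l where B: "finite B" "pairwise orthogonal B" "\<And>b. b \<in> B \<Longrightarrow> norm b = 1"
    "\<And>x. (\<Sum>b\<in>B. (x \<bullet> b) *\<^sub>R b) = x" "\<And>b. b \<in> B \<Longrightarrow> q b = l b *\<^sub>R b"
    "\<And>x. q x = (\<Sum>b\<in>B. (l b * (x \<bullet> b)) *\<^sub>R b)"
    by (rule self_adjoint_diagonalisable[OF lin sa]) (rule that; assumption)
  have l: "l b \<ge> 0" if "b \<in> B" for b
    using psd[of b] B(5)[OF that] B(3)[OF that] by (simp add: dot_square_norm)
  define P where "P = (\<Pi>\<^sub>M b\<in>B. std_normal_distribution)"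
  interpret std: prob_space std_normal_distribution by (rule prob_space_normal_density) simp
  interpret PP: product_prob_space "\<lambda>b::'v. std_normal_distribution" B
    by unfold_locales
  interpret P: prob_space P unfolding P_def by (rule prob_space_PiM) (rule std.prob_space_axioms)
  have comp: "(\<lambda>g. g b) \<in> borel_measurable P" if "b \<in> B" for b
    using measurable_component_singleton[OF that, of "\<lambda>b. std_normal_distribution"] unfolding P_def by simp
  have distr_comp: "distr P borel (\<lambda>g. g b) = std_normal_distribution" if "b \<in> B" for b
  proof -
    have "distr P borel (\<lambda>g. g b) = distr P std_normal_distribution (\<lambda>g. g b)"
      by (rule distr_cong) auto
    then show ?thesis using PP.PiM_component[OF that] by (simp add: P_def)
  qed
  have indep: "P.indep_vars (\<lambda>_. borel) (\<lambda>b g. g b) B" if "B \<noteq> {}"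
  proof -
    have "distr P (Pi\<^sub>M B (\<lambda>_. borel)) (\<lambda>x. \<lambda>i\<in>B. x i) = distr P P (\<lambda>x. x)"
    proof (rule distr_cong)
      show "sets (Pi\<^sub>M B (\<lambda>_. borel)) = sets P" unfolding P_def by (rule sets_PiM_cong) auto
      fix x assume "x \<in> space P"
      then show "(\<lambda>i\<in>B. x i) = x" by (auto simp: P_def space_PiM)
    qed simp
    also have "\<dots> = P" by (rule distr_id2) simp
    also have "\<dots> = Pi\<^sub>M B (\<lambda>i. distr P borel (\<lambda>g. g i))"
      unfolding P_def[symmetric] by (subst P_def, rule PiM_cong) (auto simp: distr_comp)
    finally show ?thesis
      using P.indep_vars_iff_distr_eq_PiM'[OF that, where M' = "\<lambda>_. borel" and X = "\<lambda>b g. g b"] comp by blast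
  qed
  define F where "F g = (\<Sum>b\<in>B. (sqrt (l b) * g b) *\<^sub>R b)" for g :: "'v \<Rightarrow> real"
  have F[measurable]: "F \<in> borel_measurable P"
    unfolding F_def by (intro borel_measurable_sum borel_measurable_scaleR borel_measurable_times comp) auto
  define L where "L = distr P borel F"
  have "distr L borel (\<lambda>x. t \<bullet> x) = centred_normal (sqrt (t \<bullet> q t))" for t
  proof -
    define c where "c b = sqrt (l b) * (t \<bullet> b)" for b
    \<comment> \<open>Only directions with a nonzero coefficient are kept: the addition theorem for
      independent normal variables is applied with positive standard deviations and a nonempty index
      set. An empty \<open>I\<close> yields the point mass at 0.\<close>
    define I where "I = {b\<in>B. c b \<noteq> 0}"
    have I: "finite I" "I \<subseteq> B" using B(1) by (auto simp: I_def)
    have tF: "t \<bullet> F g = (\<Sum>b\<in>I. c b * g b)" for g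
    proof -
      have "t \<bullet> F g = (\<Sum>b\<in>B. c b * g b)"
        unfolding F_def inner_sum_right by (intro sum.cong) (auto simp: c_def)
      also have "\<dots> = (\<Sum>b\<in>I. c b * g b)"
        by (rule sum.mono_neutral_right) (auto simp: I_def B(1))
      finally show ?thesis .
    qed
    have "t \<bullet> q t = (\<Sum>b\<in>B. (c b)\<^sup>2)"
      unfolding B(6) inner_sum_right using l
      by (intro sum.cong) (auto simp: c_def power_mult_distrib power2_eq_square)
    also have "\<dots> = (\<Sum>b\<in>I. (c b)\<^sup>2)"
      by (rule sum.mono_neutral_right) (auto simp: I_def B(1))
    finally have tq: "t \<bullet> q t = (\<Sum>b\<in>I. (c b)\<^sup>2)" .
    have "distr L borel (\<lambda>x. t \<bullet> x) = distr P borel (\<lambda>g. t \<bullet> F g)"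
      unfolding L_def by (subst distr_distr) (auto simp: comp_def)
    also have "\<dots> = centred_normal (sqrt (t \<bullet> q t))"
    proof (cases "I = {}")
      case True
      have "distr P borel (\<lambda>g. 0::real) = return borel 0"
        by (intro measure_eqI) (auto simp: emeasure_distr P.emeasure_space_1 split: split_indicator)
      then show ?thesis using True by (simp add: tF tq centred_normal_def)
    next
      case False
      then have "B \<noteq> {}" using I(2) by auto
      from P.indep_vars_subset[OF indep[OF this] I(2)]
      have ind: "P.indep_vars (\<lambda>_. borel) (\<lambda>b g. c b * g b) I"
        by (rule P.indep_vars_compose2) auto
      have nd: "distributed P lborel (\<lambda>g. c b * g b) (normal_density 0 \<bar>c b\<bar>)" if "b \<in> I" for b
      proof -
        have bB: "b \<in> B" using that I(2) by auto
        have "distr P lborel (\<lambda>g. g b) = distr P borel (\<lambda>g. g b)" by (rule distr_cong) auto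
        then have "distributed P lborel (\<lambda>g. g b) std_normal_density"
          using distr_comp[OF bB] comp[OF bB] by (auto simp: distributed_def)
        from P.normal_density_affine[OF this, of "c b" 0] that show ?thesis by (auto simp: I_def)
      qed
      have D: "distributed P lborel (\<lambda>g. \<Sum>b\<in>I. c b * g b) (normal_density (\<Sum>b\<in>I. 0) (sqrt (\<Sum>b\<in>I. \<bar>c b\<bar>\<^sup>2)))"
        by (rule P.sum_indep_normal[OF I(1) False ind _ nd]) (auto simp: I_def)
      have pos: "(\<Sum>b\<in>I. (c b)\<^sup>2) > 0" using False I(1) by (intro sum_pos) (auto simp: I_def)
      have "distr P borel (\<lambda>g. t \<bullet> F g) = distr P lborel (\<lambda>g. \<Sum>b\<in>I. c b * g b)"
        by (rule distr_cong) (auto simp: tF)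
      also have "\<dots> = density lborel (normal_density 0 (sqrt (\<Sum>b\<in>I. (c b)\<^sup>2)))"
        using distributed_distr_eq_density[OF D] by simp
      finally show ?thesis using pos by (simp add: tq centred_normal_def)
    qed
    finally show ?thesis .
  qed
  moreover have "prob_space L" unfolding L_def by (rule P.prob_space_distr) simp
  moreover have "sets L = sets borel" by (simp add: L_def)
  ultimately show thesis using that by blast
qed

lemma multivariate_normal_centred:
  fixes L :: "'v::euclidean_space measure"
  assumes L: "prob_space L" "sets L = sets borel"
    and proj: "\<And>t. distr L borel (\<lambda>x. t \<bullet> x) = centred_normal (sqrt (v t))" and v: "\<And>t. v t \<ge> 0"
  shows "multivariate_normal L" "(\<integral>x. x \<partial>L) = 0" "\<And>t. prob_space.variance L (\<lambda>x. t \<bullet> x) = v t"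
proof -
  interpret L: prob_space L by fact
  have meas: "(\<lambda>x. t \<bullet> x) \<in> borel_measurable L" for t
    using measurable_ident_sets[OF L(2)] by (auto simp: id_def)
  have E: "(\<integral>x. t \<bullet> x \<partial>L) = 0" for t
  proof -
    have "(\<integral>x. t \<bullet> x \<partial>L) = (\<integral>x. x \<partial>distr L borel (\<lambda>x. t \<bullet> x))"
      by (rule integral_distr[OF meas, symmetric]) simp
    then show ?thesis using proj centred_normal_moments(1) v by simp
  qed
  show "multivariate_normal L"
    unfolding multivariate_normal_def
  proof (intro conjI allI)
    fix t
    show "\<exists>m s. s \<ge> 0 \<and> distr L borel (\<lambda>x. t \<bullet> x) = (if s = 0 then return borel m else density lborel (normal_density m s))"
      using proj[of t] v[of t] by (intro exI[of _ 0] exI[of _ "sqrt (v t)"]) (simp add: centred_normal_def)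
  qed (use L in auto)
  show "(\<integral>x. x \<partial>L) = 0"
  \<comment> \<open>Without integrability the Bochner integral is 0 by convention, so both cases
    give the claimed mean.\<close>
  proof (cases "integrable L (\<lambda>x. x)")
    case True
    have "(\<integral>x. x \<partial>L) \<bullet> t = 0" for t
      using E[of t] integral_inner_left[of t L "\<lambda>x. x"] True by (simp add: inner_commute)
    from this[of "\<integral>x. x \<partial>L"] show ?thesis by simp
  qed (rule not_integrable_integral_eq)
  show "L.variance (\<lambda>x. t \<bullet> x) = v t" for t
  proof -
    have "L.variance (\<lambda>x. t \<bullet> x) = (\<integral>x. (t \<bullet> x)\<^sup>2 \<partial>L)" by (simp add: E)
    also have "\<dots> = (\<integral>x. x\<^sup>2 \<partial>distr L borel (\<lambda>x. t \<bullet> x))"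
      by (rule integral_distr[OF meas, symmetric]) simp
    finally show ?thesis using proj centred_normal_moments(2)[of "sqrt (v t)"] v by simp
  qed
qed

text \<open>Normalising by the standard deviation presupposes that it is positive. In the degenerate
  case all variables vanish almost surely; otherwise the standard normal limit is rescaled by
  s.\<close>

lemma univariate_clt:
  fixes X :: "nat \<Rightarrow> 'a \<Rightarrow> real"
  assumes M: "prob_space M" and indep: "prob_space.indep_vars M (\<lambda>_. borel) X UNIV"
    and D: "\<And>i. distr M borel (X i) = D"
    and sq: "integrable D (\<lambda>x. x\<^sup>2)" and mean: "(\<integral>x. x \<partial>D) = 0"
  shows "converges_in_distribution M (\<lambda>n \<omega>. (\<Sum>i<n. X i \<omega>) / sqrt n) (centred_normal (sqrt (\<integral>x. x\<^sup>2 \<partial>D)))"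
  unfolding converges_in_distribution_def
proof (intro allI impI)
  interpret M: prob_space M by fact
  have X[measurable]: "X i \<in> borel_measurable M" for i
    using indep unfolding M.indep_vars_def by simp
  have sqX: "integrable M (\<lambda>\<omega>. (X i \<omega>)\<^sup>2)" for i
    using sq by (subst integrable_distr_eq[OF X, of "\<lambda>x. x\<^sup>2" i, symmetric]) (simp_all add: D)
  have EX: "M.expectation (X i) = 0" for i
    using mean by (subst integral_distr[OF X, of "\<lambda>x. x" i, symmetric]) (simp_all add: D)
  have VX: "M.expectation (\<lambda>\<omega>. (X i \<omega>)\<^sup>2) = (\<integral>x. x\<^sup>2 \<partial>D)" for i
    by (subst integral_distr[OF X, of "\<lambda>x. x\<^sup>2" i, symmetric]) (simp_all add: D)
  define v where "v = (\<integral>x. x\<^sup>2 \<partial>D)"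
  have v: "v \<ge> 0" unfolding v_def by (rule integral_nonneg_AE) simp
  fix f :: "real \<Rightarrow> real" assume f: "continuous_on UNIV f" "bounded (range f)"
  have fm[measurable]: "f \<in> borel_measurable borel" using f(1) by (rule borel_measurable_continuous_onI)
  show "(\<lambda>n. \<integral>\<omega>. f ((\<Sum>i<n. X i \<omega>) / sqrt n) \<partial>M) \<longlonglongrightarrow> (\<integral>x. f x \<partial>centred_normal (sqrt (\<integral>x. x\<^sup>2 \<partial>D)))"
  proof (cases "v = 0")
    case True
    have "AE \<omega> in M. X i \<omega> = 0" for i
    proof -
      have "AE \<omega> in M. (X i \<omega>)\<^sup>2 = 0"
        using integral_nonneg_eq_0_iff_AE[OF sqX[of i]] VX[of i] True by (simp add: v_def)
      then show ?thesis by simp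
    qed
    then have "AE \<omega> in M. \<forall>i. X i \<omega> = 0" by (simp add: AE_all_countable)
    then have "(\<integral>\<omega>. f ((\<Sum>i<n. X i \<omega>) / sqrt n) \<partial>M) = (\<integral>\<omega>. f 0 \<partial>M)" for n :: nat
      by (intro integral_cong_AE) auto
    then have "(\<integral>\<omega>. f ((\<Sum>i<n. X i \<omega>) / sqrt n) \<partial>M) = f 0" for n :: nat by (simp add: M.prob_space)
    then show ?thesis using True by (simp add: v_def centred_normal_def integral_return)
  next
    case False
    then have v: "v > 0" using v by simp
    define s where "s = sqrt v"
    have s: "s > 0" "s\<^sup>2 = v" using v by (auto simp: s_def)
    have "weak_conv_m (\<lambda>n. distr M borel (\<lambda>x. (\<Sum>i<n. X i x) / sqrt (n * s\<^sup>2))) std_normal_distribution"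
      by (rule M.central_limit_theorem_zero_mean[OF indep EX s(1) sqX _ D]) (simp add: EX VX s(2) v_def)
    then have wc: "weak_conv_m (\<lambda>n. distr M borel (\<lambda>x. (\<Sum>i<n. X i x) / (s * sqrt n))) std_normal_distribution"
      using s(1) by (simp add: real_sqrt_mult mult.commute)
    obtain B where B: "\<And>x. norm (f x) \<le> B" using f(2) by (auto simp: bounded_iff)
    have "isCont f x" for x using f(1) by (simp add: continuous_on_eq_continuous_at)
    then have cont: "isCont (\<lambda>x. f (s * x)) x" for x
      by (intro isCont_o2[of x "\<lambda>x. s * x" f] continuous_intros)
    have rd: "real_distribution (distr M borel (\<lambda>x. (\<Sum>i<n. X i x) / (s * sqrt n)))" for n :: nat
      by (rule M.real_distribution_distr) simp
    have "(\<lambda>n. \<integral>x. f (s * x) \<partial>distr M borel (\<lambda>x. (\<Sum>i<n. X i x) / (s * sqrt n))) \<longlonglongrightarrow> (\<integral>x. f (s * x) \<partial>std_normal_distribution)"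
      by (rule weak_conv_imp_integral_bdd_continuous_conv[OF rd real_dist_normal_dist wc cont B])
    also have "(\<lambda>n::nat. \<integral>x. f (s * x) \<partial>distr M borel (\<lambda>x. (\<Sum>i<n. X i x) / (s * sqrt n))) = (\<lambda>n. \<integral>\<omega>. f ((\<Sum>i<n. X i \<omega>) / sqrt n) \<partial>M)"
      using s by (subst integral_distr) (auto simp: fun_eq_iff)
    also have "(\<integral>x. f (s * x) \<partial>std_normal_distribution) = (\<integral>x. f x \<partial>centred_normal s)"
    proof -
      interpret std: prob_space std_normal_distribution by (rule prob_space_normal_density) simp
      have "distributed std_normal_distribution lborel (\<lambda>x. x) std_normal_density"
        by (auto simp: distributed_def distr_id2)
      from std.normal_density_affine[OF this, of s 0] s(1)
      have "distributed std_normal_distribution lborel (\<lambda>x. s * x) (normal_density 0 s)" by simp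
      then have "distr std_normal_distribution lborel (\<lambda>x. s * x) = density lborel (normal_density 0 s)"
        by (rule distributed_distr_eq_density)
      then have "(\<integral>x. f x \<partial>centred_normal s) = (\<integral>x. f x \<partial>distr std_normal_distribution lborel (\<lambda>x. s * x))"
        using s(1) by (simp add: centred_normal_def)
      also have "\<dots> = (\<integral>x. f (s * x) \<partial>std_normal_distribution)" by (rule integral_distr) auto
      finally show ?thesis by simp
    qed
    finally show ?thesis by (simp add: s_def v_def)
  qed
qed

text \<open>Every projection on t obeys the one-dimensional theorem with variance t . q t, where
  \<open>q\<close> is the covariance operator. The Gaussian law built from \<open>q\<close> has
  exactly these projections, so Cramer-Wold applies.\<close>

theorem multivariate_clt:
  fixes X :: "nat \<Rightarrow> 'a \<Rightarrow> 'v::euclidean_space"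
  assumes M: "prob_space M" and indep: "prob_space.indep_vars M (\<lambda>_. borel) X UNIV"
    and D: "\<And>i. distr M borel (X i) = D"
    and sq: "integrable D (\<lambda>x. (norm x)\<^sup>2)" and mean: "(\<integral>x. x \<partial>D) = \<mu>"
  obtains L where "prob_space L" "sets L = sets borel"
    "\<And>t. distr L borel (\<lambda>x. t \<bullet> x) = centred_normal (sqrt (\<integral>x. (t \<bullet> (x - \<mu>))\<^sup>2 \<partial>D))"
    "converges_in_distribution M (\<lambda>n \<omega>. sqrt n *\<^sub>R ((1 / real n) *\<^sub>R (\<Sum>i<n. X i \<omega>) - \<mu>)) L"
proof -
  interpret M: prob_space M by fact
  have X[measurable]: "X i \<in> borel_measurable M" for i
    using indep unfolding M.indep_vars_def by simp
  interpret D: prob_space D using M.prob_space_distr[OF X, of 0] D by simp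
  have setsD[measurable_cong]: "sets D = sets borel" using D[of 0] by (metis sets_distr)
  have int: "integrable D (\<lambda>x. x)"
  proof (rule Bochner_Integration.integrable_bound[where f = "\<lambda>x. 1 + (norm x)\<^sup>2"])
    show "AE x in D. norm x \<le> norm (1 + (norm x)\<^sup>2)"
    proof (rule AE_I2)
      fix x :: 'v
      have "0 \<le> (norm x - 1)\<^sup>2" by simp
      then have "2 * norm x \<le> 1 + (norm x)\<^sup>2" unfolding power2_diff by simp
      then have "norm x \<le> 1 + (norm x)\<^sup>2" using norm_ge_zero[of x] by linarith
      then show "norm x \<le> norm (1 + (norm x)\<^sup>2)" by simp
    qed
  qed (use sq in auto)
  have sq': "integrable D (\<lambda>x. (norm (x - \<mu>))\<^sup>2)"
  proof (rule Bochner_Integration.integrable_bound[where f = "\<lambda>x. 2 * (norm x)\<^sup>2 + 2 * (norm \<mu>)\<^sup>2"])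
    show "AE x in D. norm ((norm (x - \<mu>))\<^sup>2) \<le> norm (2 * (norm x)\<^sup>2 + 2 * (norm \<mu>)\<^sup>2)"
    proof (rule AE_I2)
      fix x :: 'v
      have "(norm (x - \<mu>))\<^sup>2 \<le> (norm x + norm \<mu>)\<^sup>2" by (intro power_mono norm_triangle_ineq4) simp
      also have "\<dots> \<le> 2 * (norm x)\<^sup>2 + 2 * (norm \<mu>)\<^sup>2"
        using zero_le_power2[of "norm x - norm \<mu>"] unfolding power2_diff power2_sum by simp
      finally show "norm ((norm (x - \<mu>))\<^sup>2) \<le> norm (2 * (norm x)\<^sup>2 + 2 * (norm \<mu>)\<^sup>2)" by simp
    qed
  qed (use sq in auto)
  define q where "q t = (\<integral>x. (t \<bullet> (x - \<mu>)) *\<^sub>R (x - \<mu>) \<partial>D)" for t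
  have intq: "integrable D (\<lambda>x. (t \<bullet> (x - \<mu>)) *\<^sub>R (x - \<mu>))" for t
  proof (rule Bochner_Integration.integrable_bound[where f = "\<lambda>x. norm t * (norm (x - \<mu>))\<^sup>2"])
    show "AE x in D. norm ((t \<bullet> (x - \<mu>)) *\<^sub>R (x - \<mu>)) \<le> norm (norm t * (norm (x - \<mu>))\<^sup>2)"
    proof (rule AE_I2)
      fix x :: 'v
      have "\<bar>t \<bullet> (x - \<mu>)\<bar> * norm (x - \<mu>) \<le> (norm t * norm (x - \<mu>)) * norm (x - \<mu>)"
        by (intro mult_right_mono Cauchy_Schwarz_ineq2) auto
      then show "norm ((t \<bullet> (x - \<mu>)) *\<^sub>R (x - \<mu>)) \<le> norm (norm t * (norm (x - \<mu>))\<^sup>2)"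
        by (simp add: power2_eq_square mult.assoc abs_mult)
    qed
  qed (use sq' in auto)
  have qq: "s \<bullet> q t = (\<integral>x. (t \<bullet> (x - \<mu>)) * (s \<bullet> (x - \<mu>)) \<partial>D)" for s t
    unfolding q_def using integral_inner_right[of s D "\<lambda>x. (t \<bullet> (x - \<mu>)) *\<^sub>R (x - \<mu>)"] intq by simp
  have lin: "linear q"
    unfolding q_def using intq
    by (intro linearI) (simp_all add: inner_add_left scaleR_add_left mult.assoc scaleR_scaleR[symmetric] del: scaleR_scaleR)
  have sa: "s \<bullet> q t = q s \<bullet> t" for s t
    using qq[of s t] qq[of t s] by (simp add: inner_commute mult.commute)
  have qt: "t \<bullet> q t = (\<integral>x. (t \<bullet> (x - \<mu>))\<^sup>2 \<partial>D)" for t by (simp add: qq power2_eq_square)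
  have psd: "t \<bullet> q t \<ge> 0" for t unfolding qt by (rule integral_nonneg_AE) simp
  obtain L :: "'v measure" where L: "prob_space L" "sets L = sets borel"
    "\<And>t. distr L borel (\<lambda>x. t \<bullet> x) = centred_normal (sqrt (t \<bullet> q t))"
    by (rule gaussian_exists[OF lin sa psd]) (rule that; assumption)
  define Y where "Y n \<omega> = sqrt n *\<^sub>R ((1 / real n) *\<^sub>R (\<Sum>i<n. X i \<omega>) - \<mu>)" for n :: nat and \<omega>
  have "converges_in_distribution M Y L"
  proof (rule cramer_wold[OF M _ L(1,2)])
    show "Y n \<in> borel_measurable M" for n unfolding Y_def by measurable
    fix t
    define U where "U i \<omega> = t \<bullet> (X i \<omega> - \<mu>)" for i \<omega>
    define D' where "D' = distr D borel (\<lambda>x. t \<bullet> (x - \<mu>))"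
    have "M.indep_vars (\<lambda>_. borel) U UNIV"
      unfolding U_def using indep by (rule M.indep_vars_compose2) auto
    moreover have "distr M borel (U i) = D'" for i
      unfolding D'_def D[of i, symmetric] U_def by (subst distr_distr) (auto simp: comp_def)
    moreover have "integrable D' (\<lambda>x. x\<^sup>2)"
      unfolding D'_def using integrable_inner_right[OF intq, of t t]
      by (subst integrable_distr_eq) (auto simp: power2_eq_square)
    moreover have "(\<integral>x. x \<partial>D') = 0"
    proof -
      have "(\<integral>x. x \<partial>D') = (\<integral>x. t \<bullet> (x - \<mu>) \<partial>D)"
        unfolding D'_def by (rule integral_distr) auto
      also have "\<dots> = t \<bullet> (\<integral>x. x - \<mu> \<partial>D)" using int by (intro integral_inner_right) auto
      finally show ?thesis using int mean by (simp add: D.prob_space)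
    qed
    moreover have "(\<integral>x. x\<^sup>2 \<partial>D') = t \<bullet> q t"
      unfolding D'_def qt by (rule integral_distr) auto
    ultimately have "converges_in_distribution M (\<lambda>n \<omega>. (\<Sum>i<n. U i \<omega>) / sqrt n) (centred_normal (sqrt (t \<bullet> q t)))"
      using univariate_clt[OF M, of U D'] by simp
    moreover have "(\<Sum>i<n. U i \<omega>) / sqrt n = t \<bullet> Y n \<omega>" for n :: nat and \<omega>
    proof (cases "n = 0")
      case False
      have "(\<Sum>i<n. U i \<omega>) = t \<bullet> (\<Sum>i<n. X i \<omega>) - n * (t \<bullet> \<mu>)"
        by (simp add: U_def inner_diff_right sum_subtractf inner_sum_right)
      moreover have "(S - (r * r) * u) / r = r * (1 / (r * r) * S - u)" if "r > 0" for S u r :: real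
        using that by (simp add: field_simps)
      from this[of "sqrt n" "t \<bullet> (\<Sum>i<n. X i \<omega>)" "t \<bullet> \<mu>"] False
      have "(t \<bullet> (\<Sum>i<n. X i \<omega>) - n * (t \<bullet> \<mu>)) / sqrt n = sqrt n * (1 / real n * (t \<bullet> (\<Sum>i<n. X i \<omega>)) - t \<bullet> \<mu>)"
        by simp
      ultimately show ?thesis
        unfolding Y_def by (simp only: inner_diff_right inner_scaleR_right)
    qed (simp add: Y_def)
    ultimately show "converges_in_distribution M (\<lambda>n \<omega>. t \<bullet> Y n \<omega>) (distr L borel (\<lambda>x. t \<bullet> x))"
      by (simp add: L(3))
  qed
  then show thesis using that L unfolding Y_def qt by blast
qed

text \<open>The derivative is taken within a set A containing all values of the statistic, because
  the functional of interest is understood along symmetric moment vectors only. Tightness of the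
  normalised errors puts \<open>m n\<close> close to \<open>\<mu>\<close> with high probability,
  where the linear approximation holds.\<close>

theorem delta_method:
  fixes m :: "nat \<Rightarrow> 'a \<Rightarrow> 'v::euclidean_space" and \<tau> :: "'v \<Rightarrow> 'w::euclidean_space"
  assumes M: "prob_space M" and m: "\<And>n. m n \<in> borel_measurable M"
    and L: "prob_space L" "sets L = sets borel"
    and conv: "converges_in_distribution M (\<lambda>n \<omega>. sqrt n *\<^sub>R (m n \<omega> - \<mu>)) L"
    and \<tau>: "\<And>n. (\<lambda>\<omega>. \<tau> (m n \<omega>)) \<in> borel_measurable M"
    and deriv: "(\<tau> has_derivative T) (at \<mu> within A)"
    and A: "\<And>n \<omega>. n > 0 \<Longrightarrow> \<omega> \<in> space M \<Longrightarrow> m n \<omega> \<in> A" "\<mu> \<in> A"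
  shows "tendsto_in_probability M (\<lambda>n \<omega>. \<tau> (m n \<omega>)) (\<tau> \<mu>)"
    and "converges_in_distribution M (\<lambda>n \<omega>. sqrt n *\<^sub>R (\<tau> (m n \<omega>) - \<tau> \<mu>)) (distr L borel T)"
proof -
  interpret M: prob_space M by fact
  interpret L: prob_space L by fact
  have [measurable]: "m n \<in> borel_measurable M" "(\<lambda>\<omega>. \<tau> (m n \<omega>)) \<in> borel_measurable M" for n by fact+
  have [measurable_cong]: "sets L = sets borel" by fact
  have T: "bounded_linear T" using deriv by (rule has_derivative_bounded_linear)
  have [measurable]: "T \<in> borel_measurable borel"
    using T by (intro borel_measurable_continuous_onI linear_continuous_on)
  define Y where "Y n \<omega> = sqrt n *\<^sub>R (m n \<omega> - \<mu>)" for n :: nat and \<omega>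
  have Y[measurable]: "Y n \<in> borel_measurable M" for n unfolding Y_def by measurable
  have convY: "converges_in_distribution M Y L" using conv by (simp add: Y_def[abs_def])
  text \<open>An error event is eventually contained in a tail event of the tight sequence \<open>Y\<close>.\<close>
  have in_prob: "(\<lambda>n. measure M {\<omega>\<in>space M. Q n \<omega>}) \<longlonglongrightarrow> 0"
    if Q: "\<And>K. K > 0 \<Longrightarrow> eventually (\<lambda>n. \<forall>\<omega>\<in>space M. norm (Y n \<omega>) \<le> K \<longrightarrow> \<not> Q n \<omega>) sequentially" for Q
    unfolding tendsto_iff
  proof (intro allI impI)
    fix e :: real assume e: "e > 0"
    obtain K where K: "K > 0" "eventually (\<lambda>n. measure M {\<omega>\<in>space M. norm (Y n \<omega>) > K} < e) sequentially"
      by (rule converges_in_distribution_tight[OF M Y L convY e]) blast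
    show "\<forall>\<^sub>F n in sequentially. dist (measure M {\<omega>\<in>space M. Q n \<omega>}) 0 < e"
      using K(2) Q[OF K(1)]
    proof eventually_elim
      case (elim n)
      have "measure M {\<omega>\<in>space M. Q n \<omega>} \<le> measure M {\<omega>\<in>space M. norm (Y n \<omega>) > K}"
        using elim(2) by (intro M.finite_measure_mono) (force simp: not_le[symmetric], measurable)
      then show ?case using elim(1) by simp
    qed
  qed
  have small: "eventually (\<lambda>n. n > 0 \<and> (\<forall>\<omega>. norm (Y n \<omega>) \<le> K \<longrightarrow> norm (m n \<omega> - \<mu>) < d)) sequentially"
    if "d > 0" for K d
  proof -
    have "(\<lambda>n. K / sqrt (real n)) \<longlonglongrightarrow> 0" by real_asymp
    then have "eventually (\<lambda>n. K / sqrt (real n) < d) sequentially"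
      using that by (rule order_tendstoD(2))
    then show ?thesis
      using eventually_gt_at_top[of 0]
    proof eventually_elim
      case (elim n)
      have "norm (m n \<omega> - \<mu>) < d" if "norm (Y n \<omega>) \<le> K" for \<omega>
      proof -
        have "norm (m n \<omega> - \<mu>) = norm (Y n \<omega>) / sqrt n" using elim(2) by (simp add: Y_def)
        also have "\<dots> \<le> K / sqrt n" using that by (intro divide_right_mono) auto
        finally show ?thesis using elim(1) by simp
      qed
      then show ?case using elim(2) by simp
    qed
  qed
  note der = deriv[unfolded has_derivative_within_alt, THEN conjunct2, rule_format]
  show "tendsto_in_probability M (\<lambda>n \<omega>. \<tau> (m n \<omega>)) (\<tau> \<mu>)"
    unfolding tendsto_in_probability_def
  proof (intro allI impI in_prob)
    fix e K :: real assume e: "e > 0"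
    have "continuous (at \<mu> within A) \<tau>" using deriv by (rule has_derivative_continuous)
    then obtain d where d: "d > 0" "\<And>y. y \<in> A \<Longrightarrow> dist y \<mu> < d \<Longrightarrow> dist (\<tau> y) (\<tau> \<mu>) < e"
      using e unfolding continuous_within_eps_delta by metis
    show "\<forall>\<^sub>F n in sequentially. \<forall>\<omega>\<in>space M. norm (Y n \<omega>) \<le> K \<longrightarrow> \<not> dist (\<tau> (m n \<omega>)) (\<tau> \<mu>) > e"
      using small[OF d(1), of K]
    proof eventually_elim
      case (elim n)
      show ?case
      proof (intro ballI impI)
        fix \<omega> assume "\<omega> \<in> space M" "norm (Y n \<omega>) \<le> K"
        then have "dist (\<tau> (m n \<omega>)) (\<tau> \<mu>) < e" using elim A(1) by (intro d(2)) (auto simp: dist_norm)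
        then show "\<not> dist (\<tau> (m n \<omega>)) (\<tau> \<mu>) > e" by simp
      qed
    qed
  qed
  have diff: "tendsto_in_probability M (\<lambda>n \<omega>. sqrt n *\<^sub>R (\<tau> (m n \<omega>) - \<tau> \<mu>) - T (Y n \<omega>)) 0"
    unfolding tendsto_in_probability_def
  proof (intro allI impI in_prob)
    fix e K :: real assume e: "e > 0" and K: "K > 0"
    \<comment> \<open>The slope e / K is chosen so that the remainder, multiplied by sqrt n, is at
      most e / K times the norm of \<open>Y n\<close>, hence at most e as long as this norm is at
      most K.\<close>
    obtain d where d: "d > 0" "\<And>y. y \<in> A \<Longrightarrow> norm (y - \<mu>) < d \<Longrightarrow> norm (\<tau> y - \<tau> \<mu> - T (y - \<mu>)) \<le> e / K * norm (y - \<mu>)"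
      using der[of "e / K"] e K by auto
    show "\<forall>\<^sub>F n in sequentially. \<forall>\<omega>\<in>space M. norm (Y n \<omega>) \<le> K \<longrightarrow>
        \<not> dist (sqrt n *\<^sub>R (\<tau> (m n \<omega>) - \<tau> \<mu>) - T (Y n \<omega>)) 0 > e"
      using small[OF d(1), of K]
    proof eventually_elim
      case (elim n)
      show ?case
      proof (intro ballI impI)
        fix \<omega> assume \<omega>: "\<omega> \<in> space M" "norm (Y n \<omega>) \<le> K"
        have "T (Y n \<omega>) = sqrt n *\<^sub>R T (m n \<omega> - \<mu>)"
          unfolding Y_def using T by (simp add: linear_simps)
        then have "norm (sqrt n *\<^sub>R (\<tau> (m n \<omega>) - \<tau> \<mu>) - T (Y n \<omega>)) = sqrt n * norm (\<tau> (m n \<omega>) - \<tau> \<mu> - T (m n \<omega> - \<mu>))"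
          by (simp add: scaleR_diff_right[symmetric])
        also have "\<dots> \<le> sqrt n * (e / K * norm (m n \<omega> - \<mu>))"
          using elim A(1) \<omega> by (intro mult_left_mono d(2)) auto
        also have "\<dots> = e / K * norm (Y n \<omega>)" by (simp add: Y_def)
        also have "\<dots> \<le> e / K * K" using \<omega>(2) e K by (intro mult_left_mono) auto
        finally show "\<not> dist (sqrt n *\<^sub>R (\<tau> (m n \<omega>) - \<tau> \<mu>) - T (Y n \<omega>)) 0 > e" using K by simp
      qed
    qed
  qed
  have "converges_in_distribution M (\<lambda>n \<omega>. T (Y n \<omega>)) (distr L borel T)"
    unfolding converges_in_distribution_def
  proof (intro allI impI)
    fix f :: "'w \<Rightarrow> real" assume f: "continuous_on UNIV f" "bounded (range f)"
    have [measurable]: "f \<in> borel_measurable borel" using f(1) by (rule borel_measurable_continuous_onI)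
    have "continuous_on UNIV (\<lambda>x. f (T x))"
      by (rule continuous_on_compose2[OF f(1) linear_continuous_on[OF T]]) auto
    moreover have "bounded (range (\<lambda>x. f (T x)))" using f(2) by (rule bounded_subset) auto
    ultimately have "(\<lambda>n. \<integral>\<omega>. f (T (Y n \<omega>)) \<partial>M) \<longlonglongrightarrow> (\<integral>x. f (T x) \<partial>L)"
      using convY unfolding converges_in_distribution_def by blast
    also have "(\<integral>x. f (T x) \<partial>L) = (\<integral>x. f x \<partial>distr L borel T)" by (rule integral_distr[symmetric]) auto
    finally show "(\<lambda>n. \<integral>\<omega>. f (T (Y n \<omega>)) \<partial>M) \<longlonglongrightarrow> (\<integral>x. f x \<partial>distr L borel T)" .
  qed
  then show "converges_in_distribution M (\<lambda>n \<omega>. sqrt n *\<^sub>R (\<tau> (m n \<omega>) - \<tau> \<mu>)) (distr L borel T)"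
    by (intro converges_in_distribution_slutsky[OF M _ _ L.prob_space_distr _ _ diff]) auto
qed

section \<open>Measurable selection of maximisers\<close>

text \<open>Measurability of a set-valued map, tested on closed sets. For a map with singleton
  values this is ordinary Borel measurability of the selected point.\<close>

definition hit_measurable :: "'a measure \<Rightarrow> ('a \<Rightarrow> 'u::topological_space set) \<Rightarrow> bool" where
  "hit_measurable M R \<longleftrightarrow> (\<forall>C. closed C \<longrightarrow> {m \<in> space M. R m \<inter> C \<noteq> {}} \<in> sets M)"

text \<open>By compactness some maximiser lies in C precisely when the supremum over K and C reaches
  the supremum over K. Countable dense subsets of both sets and the slacks 1 / (j + 1) express this
  by countably many measurable conditions.\<close>

lemma hit_measurable_argmax:
  fixes f :: "'a \<Rightarrow> 'u::euclidean_space \<Rightarrow> real"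
  assumes K: "compact K"
    and meas: "\<And>u. u \<in> K \<Longrightarrow> (\<lambda>m. f m u) \<in> borel_measurable M"
    and cont: "\<And>m. m \<in> space M \<Longrightarrow> continuous_on K (f m)"
  shows "hit_measurable M (\<lambda>m. {u \<in> K. \<forall>v\<in>K. f m v \<le> f m u})"
  unfolding hit_measurable_def
proof (intro allI impI)
  fix C :: "'u set" assume C: "closed C"
  obtain D where D: "countable D" "D \<subseteq> K" "K \<subseteq> closure D" by (rule separable)
  obtain E where E: "countable E" "E \<subseteq> K \<inter> C" "K \<inter> C \<subseteq> closure E" by (rule separable)
  have KC: "compact (K \<inter> C)" using K C by (rule compact_Int_closed)
  have eq: "{u \<in> K. \<forall>v\<in>K. f m v \<le> f m u} \<inter> C \<noteq> {} \<longleftrightarrow>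
      E \<noteq> {} \<and> (\<forall>u\<in>D. \<forall>j::nat. \<exists>v\<in>E. f m v > f m u - 1 / Suc j)" if m: "m \<in> space M" for m
  proof
    assume "{u \<in> K. \<forall>v\<in>K. f m v \<le> f m u} \<inter> C \<noteq> {}"
    then obtain u where u: "u \<in> K \<inter> C" "\<And>v. v \<in> K \<Longrightarrow> f m v \<le> f m u" by blast
    have ne: "E \<noteq> {}" using E(3) u(1) by auto
    moreover have "\<exists>v\<in>E. f m v > f m w - 1 / Suc j" if w: "w \<in> D" for w and j :: nat
    proof -
      have "f m w - 1 / Suc j < f m u"
      proof -
        have "f m w \<le> f m u" using u(2) w D(2) by blast
        moreover have "1 / real (Suc j) > 0" by simp
        ultimately show ?thesis by linarith
      qed
      moreover have "continuous (at u within K) (f m)"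
        using cont[OF m] u(1) by (simp add: continuous_on_eq_continuous_within)
      ultimately have "\<forall>\<^sub>F v in at u within K. f m w - 1 / Suc j < f m v"
        unfolding continuous_within by (rule order_tendstoD(1)[rotated])
      then obtain d where d: "d > 0" "\<And>v. v \<in> K \<Longrightarrow> v \<noteq> u \<Longrightarrow> dist v u < d \<Longrightarrow> f m w - 1 / Suc j < f m v"
        unfolding eventually_at by blast
      obtain v where v: "v \<in> E" "dist v u < d"
        using E(3) u(1) d(1) closure_approachable by blast
      have "f m w - 1 / Suc j < f m v"
        using d(2)[of v] v E(2) \<open>f m w - 1 / Suc j < f m u\<close> by (cases "v = u") auto
      then show ?thesis using v(1) by blast
    qed
    ultimately show "E \<noteq> {} \<and> (\<forall>u\<in>D. \<forall>j::nat. \<exists>v\<in>E. f m v > f m u - 1 / Suc j)" by blast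
  next
    assume R: "E \<noteq> {} \<and> (\<forall>u\<in>D. \<forall>j::nat. \<exists>v\<in>E. f m v > f m u - 1 / Suc j)"
    have "K \<inter> C \<noteq> {}" using R E(2) by auto
    then obtain u where u: "u \<in> K \<inter> C" "\<And>v. v \<in> K \<inter> C \<Longrightarrow> f m v \<le> f m u"
      using continuous_attains_sup[OF KC, of "f m"] continuous_on_subset[OF cont[OF m]] by blast
    have "f m w \<le> f m u" if w: "w \<in> D" for w
    proof (rule ccontr)
      assume "\<not> f m w \<le> f m u"
      then obtain j :: nat where j: "1 / Suc j < f m w - f m u" using nat_approx_posE[of "f m w - f m u"] by auto
      obtain v where "v \<in> E" "f m v > f m w - 1 / Suc j" using R w by blast
      then show False using u(2)[of v] E(2) j by fastforce
    qed
    moreover have "f m w \<le> f m u" if w: "w \<in> K" "\<And>w. w \<in> D \<Longrightarrow> f m w \<le> f m u" for w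
    proof (rule ccontr)
      assume n: "\<not> f m w \<le> f m u"
      have "continuous (at w within K) (f m)"
        using cont[OF m] w(1) by (simp add: continuous_on_eq_continuous_within)
      then have "\<forall>\<^sub>F v in at w within K. f m u < f m v"
        unfolding continuous_within using n by (intro order_tendstoD(1)) auto
      then obtain d where d: "d > 0" "\<And>v. v \<in> K \<Longrightarrow> v \<noteq> w \<Longrightarrow> dist v w < d \<Longrightarrow> f m u < f m v"
        unfolding eventually_at by blast
      obtain v where v: "v \<in> D" "dist v w < d"
        using D(3) w(1) d(1) closure_approachable by blast
      have "f m u < f m v" using d(2)[of v] v D(2) n by (cases "v = w") auto
      then show False using w(2)[OF v(1)] by simp
    qed
    ultimately show "{u \<in> K. \<forall>v\<in>K. f m v \<le> f m u} \<inter> C \<noteq> {}" using u(1) by blast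
  qed
  have [measurable]: "(\<lambda>m. f m u) \<in> borel_measurable M" if "u \<in> D \<or> u \<in> E" for u
    using that D(2) E(2) meas by blast
  have "{m \<in> space M. E \<noteq> {} \<and> (\<forall>u\<in>D. \<forall>j::nat. \<exists>v\<in>E. f m v > f m u - 1 / Suc j)} \<in> sets M"
    using D(1) E(1) by measurable
  also have "{m \<in> space M. E \<noteq> {} \<and> (\<forall>u\<in>D. \<forall>j::nat. \<exists>v\<in>E. f m v > f m u - 1 / Suc j)}
      = {m \<in> space M. {u \<in> K. \<forall>v\<in>K. f m v \<le> f m u} \<inter> C \<noteq> {}}"
    using eq by blast
  finally show "{m \<in> space M. {u \<in> K. \<forall>v\<in>K. f m v \<le> f m u} \<inter> C \<noteq> {}} \<in> sets M" .
qed

text \<open>The minimisers of g meet C iff \<open>R m\<close> meets C and, for every rational q, C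
  contains a point of \<open>R m\<close> with g <= q whenever \<open>R m\<close> has such a point at
  all. These are countably many hit conditions for closed sets.\<close>

lemma hit_measurable_refine:
  fixes g :: "'u::euclidean_space \<Rightarrow> real"
  assumes R: "hit_measurable M R" and comp: "\<And>m. m \<in> space M \<Longrightarrow> compact (R m) \<and> R m \<noteq> {}"
    and g: "continuous_on UNIV g"
  shows "hit_measurable M (\<lambda>m. {u \<in> R m. \<forall>v\<in>R m. g u \<le> g v})"
    and "\<And>m. m \<in> space M \<Longrightarrow> compact {u \<in> R m. \<forall>v\<in>R m. g u \<le> g v} \<and> {u \<in> R m. \<forall>v\<in>R m. g u \<le> g v} \<noteq> {}"
proof -
  have cl: "closed {u. g u \<le> c}" for c
    by (intro closed_Collect_le g continuous_on_const)
  have attain: "\<exists>u\<in>R m \<inter> C. \<forall>v\<in>R m \<inter> C. g u \<le> g v" if "m \<in> space M" "closed C" "R m \<inter> C \<noteq> {}" for m C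
    using continuous_attains_inf[of "R m \<inter> C" g] comp[OF that(1)] that(2,3) continuous_on_subset[OF g]
    by (meson compact_Int_closed subset_UNIV)
  show "hit_measurable M (\<lambda>m. {u \<in> R m. \<forall>v\<in>R m. g u \<le> g v})"
    unfolding hit_measurable_def
  proof (intro allI impI)
    fix C :: "'u set" assume C: "closed C"
    have eq: "{u \<in> R m. \<forall>v\<in>R m. g u \<le> g v} \<inter> C \<noteq> {} \<longleftrightarrow>
       R m \<inter> C \<noteq> {} \<and> (\<forall>q::rat. R m \<inter> {u. g u \<le> of_rat q} \<noteq> {} \<longrightarrow> R m \<inter> (C \<inter> {u. g u \<le> of_rat q}) \<noteq> {})"
      if m: "m \<in> space M" for m
    proof
      assume "{u \<in> R m. \<forall>v\<in>R m. g u \<le> g v} \<inter> C \<noteq> {}"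
      then obtain u where "u \<in> R m" "u \<in> C" "\<forall>v\<in>R m. g u \<le> g v" by blast
      then show "R m \<inter> C \<noteq> {} \<and> (\<forall>q::rat. R m \<inter> {u. g u \<le> of_rat q} \<noteq> {} \<longrightarrow> R m \<inter> (C \<inter> {u. g u \<le> of_rat q}) \<noteq> {})"
        by fastforce
    next
      assume H: "R m \<inter> C \<noteq> {} \<and> (\<forall>q::rat. R m \<inter> {u. g u \<le> of_rat q} \<noteq> {} \<longrightarrow> R m \<inter> (C \<inter> {u. g u \<le> of_rat q}) \<noteq> {})"
      then obtain u where u: "u \<in> R m \<inter> C" "\<And>v. v \<in> R m \<inter> C \<Longrightarrow> g u \<le> g v"
        using attain[OF m C] by blast
      have "g u \<le> g v" if v: "v \<in> R m" for v
      proof (rule ccontr)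
        assume "\<not> g u \<le> g v"
        then obtain q where q: "g v < of_rat q" "of_rat q < g u" using of_rat_dense[of "g v" "g u"] by auto
        have "R m \<inter> {u. g u \<le> of_rat q} \<noteq> {}" using v q(1) by (auto intro: less_imp_le)
        then obtain w where "w \<in> R m" "w \<in> C" "g w \<le> of_rat q" using H by blast
        then show False using u(2)[of w] q(2) by auto
      qed
      then show "{u \<in> R m. \<forall>v\<in>R m. g u \<le> g v} \<inter> C \<noteq> {}" using u(1) by blast
    qed
    have [measurable]: "{m \<in> space M. R m \<inter> C' \<noteq> {}} \<in> sets M" if "closed C'" for C'
      using R that unfolding hit_measurable_def by blast
    have [measurable]: "Measurable.pred M (\<lambda>m. R m \<inter> C \<noteq> {})"
      "Measurable.pred M (\<lambda>m. R m \<inter> {u. g u \<le> of_rat q} \<noteq> {})"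
      "Measurable.pred M (\<lambda>m. R m \<inter> (C \<inter> {u. g u \<le> of_rat q}) \<noteq> {})" for q
      using R C cl[of "of_rat q"] unfolding pred_def hit_measurable_def by blast+
    have "{m \<in> space M. R m \<inter> C \<noteq> {} \<and> (\<forall>q::rat. R m \<inter> {u. g u \<le> of_rat q} \<noteq> {} \<longrightarrow> R m \<inter> (C \<inter> {u. g u \<le> of_rat q}) \<noteq> {})} \<in> sets M"
      by measurable
    also have "{m \<in> space M. R m \<inter> C \<noteq> {} \<and> (\<forall>q::rat. R m \<inter> {u. g u \<le> of_rat q} \<noteq> {} \<longrightarrow> R m \<inter> (C \<inter> {u. g u \<le> of_rat q}) \<noteq> {})}
      = {m \<in> space M. {u \<in> R m. \<forall>v\<in>R m. g u \<le> g v} \<inter> C \<noteq> {}}"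
      using eq by blast
    finally show "{m \<in> space M. {u \<in> R m. \<forall>v\<in>R m. g u \<le> g v} \<inter> C \<noteq> {}} \<in> sets M" .
  qed
  fix m assume m: "m \<in> space M"
  obtain u where u: "u \<in> R m" "\<And>v. v \<in> R m \<Longrightarrow> g u \<le> g v" using attain[OF m, of UNIV] comp[OF m] by auto
  then have "{u \<in> R m. \<forall>v\<in>R m. g u \<le> g v} = R m \<inter> {v. g v \<le> g u}" by (auto intro: order_trans)
  then show "compact {u \<in> R m. \<forall>v\<in>R m. g u \<le> g v} \<and> {u \<in> R m. \<forall>v\<in>R m. g u \<le> g v} \<noteq> {}"
    using compact_Int_closed[of "R m" "{v. g v \<le> g u}"] comp[OF m] cl[of "g u"] u by auto
qed

text \<open>Minimising the coordinates one after the other cuts each value down to a single point.\<close>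

lemma hit_measurable_selection:
  fixes R :: "'a \<Rightarrow> 'u::euclidean_space set"
  assumes R: "hit_measurable M R" and comp: "\<And>m. m \<in> space M \<Longrightarrow> compact (R m) \<and> R m \<noteq> {}"
  obtains s where "s \<in> borel_measurable M" "\<And>m. m \<in> space M \<Longrightarrow> s m \<in> R m"
proof -
  have "finite B \<Longrightarrow> \<exists>R'. hit_measurable M R' \<and> (\<forall>m\<in>space M. compact (R' m) \<and> R' m \<noteq> {} \<and> R' m \<subseteq> R m \<and>
      (\<forall>u\<in>R' m. \<forall>v\<in>R' m. \<forall>b\<in>B. u \<bullet> b = v \<bullet> b))" for B :: "'u set"
  proof (induction rule: finite_induct)
    case empty
    then show ?case using R comp by (intro exI[of _ R]) auto
  next
    case (insert b B)
    then obtain R' where R': "hit_measurable M R'" "\<And>m. m \<in> space M \<Longrightarrow> compact (R' m) \<and> R' m \<noteq> {}"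
      "\<And>m. m \<in> space M \<Longrightarrow> R' m \<subseteq> R m"
      "\<And>m u v c. m \<in> space M \<Longrightarrow> u \<in> R' m \<Longrightarrow> v \<in> R' m \<Longrightarrow> c \<in> B \<Longrightarrow> u \<bullet> c = v \<bullet> c"
      by blast
    have cont_b: "continuous_on UNIV (\<lambda>u. u \<bullet> b)" by (intro continuous_intros)
    show ?case
    proof (intro exI[of _ "\<lambda>m. {u \<in> R' m. \<forall>v\<in>R' m. u \<bullet> b \<le> v \<bullet> b}"] conjI ballI)
      show "hit_measurable M (\<lambda>m. {u \<in> R' m. \<forall>v\<in>R' m. u \<bullet> b \<le> v \<bullet> b})" by (rule hit_measurable_refine(1)[OF R'(1,2) cont_b])
      fix m assume m: "m \<in> space M"
      show "compact {u \<in> R' m. \<forall>v\<in>R' m. u \<bullet> b \<le> v \<bullet> b}" "{u \<in> R' m. \<forall>v\<in>R' m. u \<bullet> b \<le> v \<bullet> b} \<noteq> {}"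
        using hit_measurable_refine(2)[OF R'(1,2) cont_b m] by auto
      show "{u \<in> R' m. \<forall>v\<in>R' m. u \<bullet> b \<le> v \<bullet> b} \<subseteq> R m" using R'(3)[OF m] by blast
      fix u v c
      assume "u \<in> {u \<in> R' m. \<forall>v\<in>R' m. u \<bullet> b \<le> v \<bullet> b}" "v \<in> {u \<in> R' m. \<forall>v\<in>R' m. u \<bullet> b \<le> v \<bullet> b}" "c \<in> insert b B"
      then show "u \<bullet> c = v \<bullet> c" using R'(4)[OF m] by (auto intro: antisym)
    qed
  qed
  from this[OF finite_Basis] obtain R' where R': "hit_measurable M R'" "\<And>m. m \<in> space M \<Longrightarrow> R' m \<noteq> {}"
    "\<And>m. m \<in> space M \<Longrightarrow> R' m \<subseteq> R m"
    "\<And>m u v b. m \<in> space M \<Longrightarrow> u \<in> R' m \<Longrightarrow> v \<in> R' m \<Longrightarrow> b \<in> Basis \<Longrightarrow> u \<bullet> b = v \<bullet> b"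
    by blast
  have "\<exists>u. R' m = {u}" if m: "m \<in> space M" for m
  proof -
    obtain u where u: "u \<in> R' m" using R'(2)[OF m] by blast
    have "v = u" if v: "v \<in> R' m" for v
      by (rule euclidean_eqI) (rule R'(4)[OF m v u])
    then show ?thesis using u by blast
  qed
  then obtain s where s: "\<And>m. m \<in> space M \<Longrightarrow> R' m = {s m}" by metis
  have "s \<in> borel_measurable M"
    unfolding borel_eq_closed
  proof (rule measurable_measure_of)
    fix C :: "'u set" assume "C \<in> Collect closed"
    then have "{m \<in> space M. R' m \<inter> C \<noteq> {}} \<in> sets M" using R'(1) by (auto simp: hit_measurable_def)
    also have "{m \<in> space M. R' m \<inter> C \<noteq> {}} = s -` C \<inter> space M" using s by auto
    finally show "s -` C \<inter> space M \<in> sets M" .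
  qed auto
  then show thesis using that s R'(3) by blast
qed

text \<open>The function g ranks the maximisers of \<open>f m\<close> before a single point is
  singled out; it will be the distance to the identity matrix.\<close>

theorem measurable_argmax_selection:
  fixes f :: "'a \<Rightarrow> 'u::euclidean_space \<Rightarrow> real" and g :: "'u \<Rightarrow> real"
  assumes K: "compact K" "K \<noteq> {}"
    and meas: "\<And>u. u \<in> K \<Longrightarrow> (\<lambda>m. f m u) \<in> borel_measurable M"
    and cont: "\<And>m. m \<in> space M \<Longrightarrow> continuous_on K (f m)" and g: "continuous_on UNIV g"
  shows "\<exists>s\<in>borel_measurable M. \<forall>m\<in>space M. s m \<in> K \<and> (\<forall>u\<in>K. f m u \<le> f m (s m)) \<and>
    (\<forall>u\<in>K. (\<forall>v\<in>K. f m v \<le> f m u) \<longrightarrow> g (s m) \<le> g u)"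
proof -
  define R where "R m = {u \<in> K. \<forall>v\<in>K. f m v \<le> f m u}" for m
  have R: "hit_measurable M R" unfolding R_def by (rule hit_measurable_argmax[OF K(1) meas cont])
  have comp: "compact (R m) \<and> R m \<noteq> {}" if m: "m \<in> space M" for m
  proof -
    obtain u where u: "u \<in> K" "\<And>v. v \<in> K \<Longrightarrow> f m v \<le> f m u"
      using continuous_attains_sup[OF K cont[OF m]] by blast
    have "R m = K \<inter> f m -` {f m u ..}" using u unfolding R_def by (auto intro: order_trans)
    moreover have "closed (K \<inter> f m -` {f m u ..})"
      using continuous_closed_preimage[OF cont[OF m] compact_imp_closed[OF K(1)]] by simp
    ultimately have "compact (R m)" using compact_Int_closed[OF K(1), of "R m"] by (simp add: Int_assoc[symmetric])
    then show ?thesis using u by (auto simp: R_def)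
  qed
  obtain s where s: "s \<in> borel_measurable M" "\<And>m. m \<in> space M \<Longrightarrow> s m \<in> {u \<in> R m. \<forall>v\<in>R m. g u \<le> g v}"
    using hit_measurable_selection[OF hit_measurable_refine(1)[OF R comp g] hit_measurable_refine(2)[OF R comp g]] by blast
  show ?thesis
    by (rule bexI[OF _ s(1)]) (use s(2) in \<open>auto simp: R_def\<close>)
qed

section \<open>Tensors, rotations and the estimating equations\<close>

text \<open>Action of a matrix on one tensor index. Tensors are curried functions, so the remaining
  indices are carried along by abstraction.\<close>

definition contract :: "real^'q^'p \<Rightarrow> ('q \<Rightarrow> real) \<Rightarrow> 'p \<Rightarrow> real" where
  "contract W f i = (\<Sum>a\<in>UNIV. W $ i $ a * f a)"

lemma contract_mat_1 [simp]: "contract (mat 1 :: real^'p^'p) f i = f i"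
  by (simp add: contract_def mat_def if_distrib if_distribR cong: if_cong)

lemma contract_mult: "contract (V ** W) f i = contract V (contract W f) i"
  unfolding contract_def matrix_matrix_mult_def
  by (simp add: sum_distrib_left sum_distrib_right mult.assoc) (rule sum.swap)

lemma contract_commute: "contract V (\<lambda>a. contract W (F a) k) i = contract W (\<lambda>b. contract V (\<lambda>a. F a b) i) k"
proof -
  have "(\<Sum>a\<in>UNIV. \<Sum>b\<in>UNIV. V $ i $ a * (W $ k $ b * F a b)) = (\<Sum>b\<in>UNIV. \<Sum>a\<in>UNIV. W $ k $ b * (V $ i $ a * F a b))"
    by (subst sum.swap) (simp add: mult.left_commute)
  then show ?thesis by (simp add: contract_def sum_distrib_left)
qed

lemma contract_matrix_vector: "contract W f i = (W *v (\<chi> a. f a)) $ i"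
  by (simp add: contract_def matrix_vector_mult_def)

lemma matrix_congruence_contract:
  "(U ** A ** transpose U) $ k $ l = contract U (\<lambda>a. contract U (\<lambda>b. A $ a $ b) l) k"
proof -
  have "(U ** A ** transpose U) $ k $ l = (\<Sum>b\<in>UNIV. U $ l $ b * (\<Sum>a\<in>UNIV. U $ k $ a * A $ a $ b))"
    by (simp add: matrix_matrix_mult_def transpose_def mult.commute)
  also have "\<dots> = contract U (\<lambda>b. contract U (\<lambda>a. A $ a $ b) k) l"
    unfolding contract_def ..
  also have "\<dots> = contract U (\<lambda>a. contract U (\<lambda>b. A $ a $ b) l) k"
    by (rule contract_commute)
  finally show ?thesis .
qed

lemma orthogonal_contract_sum_squares:
  fixes U :: "real^'p^'p"
  assumes "orthogonal_matrix U"
  shows "(\<Sum>i\<in>UNIV. (contract U f i)\<^sup>2) = (\<Sum>i\<in>UNIV. (f i)\<^sup>2)"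
proof -
  let ?x = "\<chi> a. f a"
  have "(U *v ?x) \<bullet> (U *v ?x) = ?x \<bullet> (transpose U *v (U *v ?x))"
    by (metis dot_lmul_matrix transpose_matrix_vector inner_commute)
  also have "transpose U *v (U *v ?x) = ?x"
    using assms by (simp add: matrix_vector_mul_assoc orthogonal_matrix del: transpose_matrix_vector)
  finally show ?thesis
    by (simp add: contract_matrix_vector inner_vec_def power2_eq_square)
qed

text \<open>Multilinear action on all indices: third cumulants of x become those of W x.\<close>

definition transform3 :: "real^'q^'p \<Rightarrow> ('q \<Rightarrow> 'q \<Rightarrow> 'q \<Rightarrow> real) \<Rightarrow> 'p \<Rightarrow> 'p \<Rightarrow> 'p \<Rightarrow> real" where
  "transform3 W c i k l = contract W (\<lambda>a. contract W (\<lambda>b. contract W (c a b) l) k) i"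

definition transform4 :: "real^'q^'p \<Rightarrow> ('q \<Rightarrow> 'q \<Rightarrow> 'q \<Rightarrow> 'q \<Rightarrow> real) \<Rightarrow> 'p \<Rightarrow> 'p \<Rightarrow> 'p \<Rightarrow> 'p \<Rightarrow> real" where
  "transform4 W c i j k l = contract W (\<lambda>a. transform3 W (c a) j k l) i"

lemma transform3_mult: "transform3 (V ** W) c = transform3 V (transform3 W c)"
  by (intro ext) (simp add: transform3_def[abs_def] contract_mult[abs_def] contract_commute[of W V, abs_def])

lemma transform3_contract_commute:
  "contract W (\<lambda>a. transform3 V (F a) j k l) i = transform3 V (\<lambda>b c d. contract W (\<lambda>a. F a b c d) i) j k l"
  by (simp add: transform3_def contract_commute[of W V])

lemma transform4_mult: "transform4 (V ** W) c = transform4 V (transform4 W c)"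
  by (intro ext) (simp add: transform4_def[abs_def] contract_mult[abs_def] transform3_mult
      transform3_contract_commute[of W V, abs_def])

lemma transform3_sym: "(\<And>a b d. c a b d = c a d b) \<Longrightarrow> transform3 W c i k l = transform3 W c i l k"
  unfolding transform3_def by (subst (2) contract_commute) simp

lemma transform4_sym: "(\<And>a b d e. c a b d e = c a b e d) \<Longrightarrow> transform4 W c i j k l = transform4 W c i j l k"
  unfolding transform4_def using transform3_sym[of "c _"] by metis

text \<open>The squared Frobenius norm of the diagonal part of \<open>V C V^T\<close>, for a matrix
  C given by its entries.\<close>

definition diag_form :: "real^'p^'p \<Rightarrow> ('p \<Rightarrow> 'p \<Rightarrow> real) \<Rightarrow> real" where
  "diag_form V C = (\<Sum>k\<in>UNIV. (contract V (\<lambda>a. contract V (C a) k) k)\<^sup>2)"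

definition objective3 :: "('p::finite \<Rightarrow> 'p \<Rightarrow> 'p \<Rightarrow> real) \<Rightarrow> real" where
  "objective3 c = (\<Sum>i\<in>UNIV. \<Sum>k\<in>UNIV. (c i k k)\<^sup>2)"

definition objective4 :: "('p::finite \<Rightarrow> 'p \<Rightarrow> 'p \<Rightarrow> 'p \<Rightarrow> real) \<Rightarrow> real" where
  "objective4 c = (\<Sum>i\<in>UNIV. \<Sum>j\<in>UNIV. \<Sum>k\<in>UNIV. (c i j k k)\<^sup>2)"

text \<open>The free indices of the cumulant matrices may be rotated along without changing the
  objective.\<close>

lemma objective3_transform:
  assumes "orthogonal_matrix U"
  shows "objective3 (transform3 U c) = (\<Sum>i\<in>UNIV. diag_form U (c i))"
  unfolding objective3_def transform3_def diag_form_def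
  by (subst (1 2) sum.swap) (simp add: orthogonal_contract_sum_squares[OF assms])

lemma sum_rotate: "(\<Sum>i\<in>A. \<Sum>j\<in>B. \<Sum>k\<in>C. f i j k) = (\<Sum>j\<in>B. \<Sum>k\<in>C. \<Sum>i\<in>A. f i j k)"
  by (subst sum.swap) (intro sum.cong refl sum.swap)

lemma objective4_transform:
  assumes "orthogonal_matrix U"
  shows "objective4 (transform4 U c) = (\<Sum>i\<in>UNIV. \<Sum>j\<in>UNIV. diag_form U (c i j))"
proof -
  have "objective4 (transform4 U c) = (\<Sum>j\<in>UNIV. \<Sum>k\<in>UNIV. \<Sum>i\<in>UNIV. (contract U (\<lambda>a. transform3 U (c a) j k k) i)\<^sup>2)"
    unfolding objective4_def transform4_def by (rule sum_rotate)
  also have "\<dots> = (\<Sum>i\<in>UNIV. objective3 (transform3 U (c i)))"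
    unfolding orthogonal_contract_sum_squares[OF assms] objective3_def by (rule sum_rotate[symmetric])
  finally show ?thesis by (simp add: objective3_transform[OF assms])
qed

lemma norm_diag_matrix_squared: "(norm (diag_matrix (A :: real^'p^'p)))\<^sup>2 = (\<Sum>k\<in>UNIV. (A $ k $ k)\<^sup>2)"
proof -
  have "(\<Sum>j\<in>UNIV. (if i = j then A $ i $ j else 0) * (if i = j then A $ i $ j else 0)) = A $ i $ i * A $ i $ i" for i
    by (simp add: if_distrib if_distribR cong: if_cong)
  then show ?thesis
    unfolding power2_norm_eq_inner inner_vec_def diag_matrix_def by (simp add: power2_eq_square)
qed

lemma norm_diag_congruence:
  "(norm (diag_matrix (U ** A ** transpose U)))\<^sup>2 = diag_form U (\<lambda>a b. A $ a $ b)"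
  unfolding norm_diag_matrix_squared matrix_congruence_contract diag_form_def ..

section \<open>Plane rotations and stationarity of the objective\<close>

definition plane_rotation :: "'p \<Rightarrow> 'p \<Rightarrow> real \<Rightarrow> real^'p^'p" where
  "plane_rotation k l \<theta> = (\<chi> i a.
     if i = k then (if a = k then cos \<theta> else if a = l then sin \<theta> else 0)
     else if i = l then (if a = k then - sin \<theta> else if a = l then cos \<theta> else 0)
     else if i = a then 1 else 0)"

lemma sum_two_point:
  fixes f :: "'p::finite \<Rightarrow> real"
  assumes "k \<noteq> l"
  shows "(\<Sum>a\<in>UNIV. (if a = k then x else if a = l then y else 0) * f a) = x * f k + y * f l"
proof -
  have "(if a = k then x else if a = l then y else 0) * f a = (if a = k then x * f a else 0) + (if a = l then y * f a else 0)" for a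
    using assms by auto
  then show ?thesis by (simp add: sum.distrib)
qed

lemma contract_plane_rotation:
  fixes k l :: "'p::finite"
  assumes "k \<noteq> l"
  shows "contract (plane_rotation k l \<theta>) f k = cos \<theta> * f k + sin \<theta> * f l"
    "contract (plane_rotation k l \<theta>) f l = - sin \<theta> * f k + cos \<theta> * f l"
    "j \<noteq> k \<Longrightarrow> j \<noteq> l \<Longrightarrow> contract (plane_rotation k l \<theta>) f j = f j"
proof -
  have lk: "(l = k) = False" using assms by simp
  show "contract (plane_rotation k l \<theta>) f k = cos \<theta> * f k + sin \<theta> * f l"
    unfolding contract_def plane_rotation_def vec_lambda_beta sum_two_point[OF assms, symmetric]
    by (simp only: refl if_True)
  show "contract (plane_rotation k l \<theta>) f l = - sin \<theta> * f k + cos \<theta> * f l"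
    unfolding contract_def plane_rotation_def vec_lambda_beta sum_two_point[OF assms, symmetric]
    by (simp only: refl if_True lk if_False)
  show "contract (plane_rotation k l \<theta>) f j = f j" if "j \<noteq> k" "j \<noteq> l"
  proof -
    have "contract (plane_rotation k l \<theta>) f j = contract (mat 1) f j"
      using that by (simp add: contract_def plane_rotation_def mat_def)
    then show ?thesis by simp
  qed
qed

lemma orthogonal_plane_rotation:
  fixes k l :: "'p::finite"
  assumes kl: "k \<noteq> l"
  shows "orthogonal_matrix (plane_rotation k l \<theta>)"
proof -
  let ?R = "plane_rotation k l \<theta>"
  have "?R ** transpose ?R = mat 1"
    unfolding vec_eq_iff
  proof (intro allI)
    fix i j
    have "(?R ** transpose ?R) $ i $ j = contract ?R (\<lambda>a. ?R $ j $ a) i"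
      by (simp add: matrix_matrix_mult_def transpose_def contract_def)
    also have "\<dots> = mat 1 $ i $ j"
    proof (cases "i = k \<or> i = l")
      case True
      have "cos \<theta> * cos \<theta> + sin \<theta> * sin \<theta> = 1" "sin \<theta> * sin \<theta> + cos \<theta> * cos \<theta> = 1"
        using sin_cos_squared_add[of \<theta>] by (simp_all add: power2_eq_square add.commute)
      then show ?thesis
        using True kl contract_plane_rotation[OF kl, where \<theta> = \<theta> and f = "\<lambda>a. ?R $ j $ a"]
        by (auto simp: plane_rotation_def mat_def)
    next
      case False
      then show ?thesis
        using kl contract_plane_rotation(3)[OF kl, where j = i and \<theta> = \<theta> and f = "\<lambda>a. ?R $ j $ a"]
        by (auto simp: plane_rotation_def mat_def)
    qed
    finally show "(?R ** transpose ?R) $ i $ j = mat 1 $ i $ j" .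
  qed
  then show ?thesis by (simp add: orthogonal_matrix matrix_left_right_inverse)
qed

text \<open>Only the diagonal entries k and l of the rotated matrix move. Their derivatives at angle
  0 are 2 C k l and -2 C k l, and differentiating the squares contributes another factor 2.\<close>

lemma diag_form_rotation_derivative:
  fixes k l :: "'p::finite"
  assumes kl: "k \<noteq> l" and sym: "C k l = C l k"
  shows "((\<lambda>\<theta>. diag_form (plane_rotation k l \<theta>) C) has_real_derivative 4 * (C k l * (C k k - C l l))) (at 0)"
proof -
  have eq: "diag_form (plane_rotation k l \<theta>) C =
      ((cos \<theta>)\<^sup>2 * C k k + 2 * sin \<theta> * cos \<theta> * C k l + (sin \<theta>)\<^sup>2 * C l l)\<^sup>2 +
      ((sin \<theta>)\<^sup>2 * C k k - 2 * sin \<theta> * cos \<theta> * C k l + (cos \<theta>)\<^sup>2 * C l l)\<^sup>2 +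
      (\<Sum>j\<in>UNIV - {k, l}. (C j j)\<^sup>2)" for \<theta>
  proof -
    let ?D = "\<lambda>j. contract (plane_rotation k l \<theta>) (\<lambda>a. contract (plane_rotation k l \<theta>) (C a) j) j"
    have "diag_form (plane_rotation k l \<theta>) C = (\<Sum>j\<in>{k, l}. (?D j)\<^sup>2) + (\<Sum>j\<in>UNIV - {k, l}. (?D j)\<^sup>2)"
      unfolding diag_form_def by (rule sum.subset_diff[THEN trans, OF _ _ add.commute]) auto
    also have "(\<Sum>j\<in>UNIV - {k, l}. (?D j)\<^sup>2) = (\<Sum>j\<in>UNIV - {k, l}. (C j j)\<^sup>2)"
      by (intro sum.cong refl) (simp add: contract_plane_rotation(3)[OF kl])
    also have "(\<Sum>j\<in>{k, l}. (?D j)\<^sup>2) = (?D k)\<^sup>2 + (?D l)\<^sup>2" using kl by simp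
    also have "?D k = (cos \<theta>)\<^sup>2 * C k k + 2 * sin \<theta> * cos \<theta> * C k l + (sin \<theta>)\<^sup>2 * C l l"
      using sym by (simp add: contract_plane_rotation(1)[OF kl] algebra_simps power2_eq_square)
    also have "?D l = (sin \<theta>)\<^sup>2 * C k k - 2 * sin \<theta> * cos \<theta> * C k l + (cos \<theta>)\<^sup>2 * C l l"
      using sym by (simp add: contract_plane_rotation(2)[OF kl] algebra_simps power2_eq_square)
    finally show ?thesis .
  qed
  show ?thesis
    unfolding eq by (auto intro!: derivative_eq_intros simp: algebra_simps)
qed

text \<open>Raw moments of orders one to four form a point of a Euclidean space. For a sample this
  point is an average of independent vectors, as the central limit theorem wants, while means,
  covariances and cumulants are polynomials in it.\<close>

type_synonym 'p moments = "(real^'p) \<times> (real^'p^'p) \<times> (real^'p^'p^'p) \<times> (real^'p^'p^'p^'p)"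

definition mom1 :: "'p::finite moments \<Rightarrow> 'p \<Rightarrow> real" where "mom1 m a = fst m $ a"
definition mom2 :: "'p::finite moments \<Rightarrow> 'p \<Rightarrow> 'p \<Rightarrow> real" where "mom2 m a b = fst (snd m) $ a $ b"
definition mom3 :: "'p::finite moments \<Rightarrow> 'p \<Rightarrow> 'p \<Rightarrow> 'p \<Rightarrow> real" where
  "mom3 m a b c = fst (snd (snd m)) $ a $ b $ c"
definition mom4 :: "'p::finite moments \<Rightarrow> 'p \<Rightarrow> 'p \<Rightarrow> 'p \<Rightarrow> 'p \<Rightarrow> real" where
  "mom4 m a b c d = snd (snd (snd m)) $ a $ b $ c $ d"

definition cent2 :: "'p::finite moments \<Rightarrow> 'p \<Rightarrow> 'p \<Rightarrow> real" where
  "cent2 m a b = mom2 m a b - mom1 m a * mom1 m b"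

definition cent3 :: "'p::finite moments \<Rightarrow> 'p \<Rightarrow> 'p \<Rightarrow> 'p \<Rightarrow> real" where
  "cent3 m a b c = mom3 m a b c - mom1 m a * mom2 m b c - mom1 m b * mom2 m a c - mom1 m c * mom2 m a b
     + 2 * (mom1 m a * mom1 m b * mom1 m c)"

text \<open>Expansion of the product of four centred factors. The last coefficient is -4 + 1: four
  terms with three means taken out, each leaving a further mean, and one term with all four taken
  out. The 2 in \<open>cent3\<close> is 3 - 1 likewise.\<close>

definition cent4 :: "'p::finite moments \<Rightarrow> 'p \<Rightarrow> 'p \<Rightarrow> 'p \<Rightarrow> 'p \<Rightarrow> real" where
  "cent4 m a b c d = mom4 m a b c d
     - mom1 m a * mom3 m b c d - mom1 m b * mom3 m a c d - mom1 m c * mom3 m a b d - mom1 m d * mom3 m a b c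
     + mom1 m a * mom1 m b * mom2 m c d + mom1 m a * mom1 m c * mom2 m b d + mom1 m a * mom1 m d * mom2 m b c
     + mom1 m b * mom1 m c * mom2 m a d + mom1 m b * mom1 m d * mom2 m a c + mom1 m c * mom1 m d * mom2 m a b
     - 3 * (mom1 m a * mom1 m b * mom1 m c * mom1 m d)"

definition cum4 :: "'p::finite moments \<Rightarrow> 'p \<Rightarrow> 'p \<Rightarrow> 'p \<Rightarrow> 'p \<Rightarrow> real" where
  "cum4 m a b c d = cent4 m a b c d - cent2 m a b * cent2 m c d - cent2 m a c * cent2 m b d - cent2 m b c * cent2 m a d"

definition cov_matrix :: "'p::finite moments \<Rightarrow> real^'p^'p" where
  "cov_matrix m = (\<chi> a b. cent2 m a b)"

text \<open>Symmetry in the last two indices makes the cumulant matrices symmetric, which the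
  derivative along plane rotations uses. Moments of samples and of the population all have
  it.\<close>

definition symmetric_moments :: "'p::finite moments \<Rightarrow> bool" where
  "symmetric_moments m \<longleftrightarrow> (\<forall>a b. mom2 m a b = mom2 m b a) \<and> (\<forall>a b c. mom3 m a b c = mom3 m a c b)
     \<and> (\<forall>a b c d. mom4 m a b c d = mom4 m a b d c)"

lemma cent3_sym: "symmetric_moments m \<Longrightarrow> cent3 m a b c = cent3 m a c b"
  unfolding cent3_def symmetric_moments_def by (simp add: algebra_simps)

lemma cum4_sym:
  assumes "symmetric_moments m"
  shows "cum4 m a b c d = cum4 m a b d c"
proof -
  have "mom2 m d c = mom2 m c d" "mom3 m a d c = mom3 m a c d" "mom3 m b d c = mom3 m b c d"
    "mom4 m a b d c = mom4 m a b c d"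
    using assms by (auto simp: symmetric_moments_def)
  then show ?thesis unfolding cum4_def cent4_def cent2_def by (simp add: algebra_simps)
qed

definition objective :: "real \<Rightarrow> real \<Rightarrow> real^'p^'p \<Rightarrow> 'p::finite moments \<Rightarrow> real" where
  "objective a b W m = a * objective3 (transform3 W (cent3 m)) + b * objective4 (transform4 W (cum4 m))"

text \<open>One quarter of the derivative, at angle 0, of the third-order objective along the
  rotation in the plane of k and l.\<close>

definition estimating3 :: "'p \<Rightarrow> 'p \<Rightarrow> real^'p^'p \<Rightarrow> 'p::finite moments \<Rightarrow> real" where
  "estimating3 k l W m = (\<Sum>i\<in>UNIV. transform3 W (cent3 m) i k l *
     (transform3 W (cent3 m) i k k - transform3 W (cent3 m) i l l))"

definition estimating4 :: "'p \<Rightarrow> 'p \<Rightarrow> real^'p^'p \<Rightarrow> 'p::finite moments \<Rightarrow> real" where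
  "estimating4 k l W m = (\<Sum>i\<in>UNIV. \<Sum>j\<in>UNIV. transform4 W (cum4 m) i j k l *
     (transform4 W (cum4 m) i j k k - transform4 W (cum4 m) i j l l))"

lemma objective_rotate:
  assumes "orthogonal_matrix V"
  shows "objective a b (V ** W) m = a * (\<Sum>i\<in>UNIV. diag_form V (transform3 W (cent3 m) i))
     + b * (\<Sum>i\<in>UNIV. \<Sum>j\<in>UNIV. diag_form V (transform4 W (cum4 m) i j))"
  unfolding objective_def transform3_mult transform4_mult objective3_transform[OF assms] objective4_transform[OF assms] ..

lemma objective_first_order:
  fixes W :: "real^'p^'p"
  assumes sym: "symmetric_moments m" and kl: "k \<noteq> l"
    and max: "\<And>V. orthogonal_matrix V \<Longrightarrow> objective a b (V ** W) m \<le> objective a b W m"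
  shows "a * estimating3 k l W m + b * estimating4 k l W m = 0"
proof -
  let ?T = "transform3 W (cent3 m)" and ?Q = "transform4 W (cum4 m)"
  define g where "g \<theta> = objective a b (plane_rotation k l \<theta> ** W) m" for \<theta>
  have g: "g \<theta> = a * (\<Sum>i\<in>UNIV. diag_form (plane_rotation k l \<theta>) (?T i))
     + b * (\<Sum>i\<in>UNIV. \<Sum>j\<in>UNIV. diag_form (plane_rotation k l \<theta>) (?Q i j))" for \<theta>
    unfolding g_def by (rule objective_rotate[OF orthogonal_plane_rotation[OF kl]])
  have "(g has_real_derivative a * (\<Sum>i\<in>UNIV. 4 * (?T i k l * (?T i k k - ?T i l l)))
     + b * (\<Sum>i\<in>UNIV. \<Sum>j\<in>UNIV. 4 * (?Q i j k l * (?Q i j k k - ?Q i j l l)))) (at 0)"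
    unfolding g
    by (intro DERIV_add DERIV_cmult DERIV_sum diag_form_rotation_derivative[OF kl]
        transform3_sym transform4_sym cent3_sym cum4_sym sym)
  note der = this
  have "g \<theta> \<le> g 0" for \<theta>
  proof -
    have "plane_rotation k l 0 = mat 1"
      by (auto simp: plane_rotation_def mat_def vec_eq_iff)
    then show ?thesis using max[OF orthogonal_plane_rotation[OF kl]] by (simp add: g_def)
  qed
  then have "a * (\<Sum>i\<in>UNIV. 4 * (?T i k l * (?T i k k - ?T i l l)))
     + b * (\<Sum>i\<in>UNIV. \<Sum>j\<in>UNIV. 4 * (?Q i j k l * (?Q i j k k - ?Q i j l l))) = 0"
    by (intro DERIV_local_max[OF der zero_less_one]) auto
  then have "a * (4 * estimating3 k l W m) + b * (4 * estimating4 k l W m) = 0"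
    unfolding sum_distrib_left[symmetric] estimating3_def estimating4_def .
  then show ?thesis by linarith
qed

text \<open>Orthogonal matrices whose entries are \<open>0\<close>, \<open>1\<close> or \<open>-1\<close> are the signed permutation
  matrices; the objective cannot tell them apart from the identity.\<close>

definition signed_permutation :: "real^'p^'p \<Rightarrow> bool" where
  "signed_permutation P \<longleftrightarrow> orthogonal_matrix P \<and> (\<forall>i j. (P $ i $ j)\<^sup>2 \<in> {0, 1})"

section \<open>Signed permutations and the maximisers at the population\<close>

lemma orthogonal_row_sum:
  fixes P :: "real^'p^'p"
  assumes "orthogonal_matrix P"
  shows "(\<Sum>a\<in>UNIV. (P $ k $ a)\<^sup>2) = 1"
proof -
  have "P ** transpose P = mat 1" using assms by (simp add: orthogonal_matrix_def)
  then have "(P ** transpose P) $ k $ k = (mat 1 :: real^'p^'p) $ k $ k" by simp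
  then show ?thesis by (simp add: matrix_matrix_mult_def transpose_def mat_def power2_eq_square)
qed

lemma orthogonal_column_sum:
  fixes P :: "real^'p^'p"
  assumes "orthogonal_matrix P"
  shows "(\<Sum>k\<in>UNIV. (P $ k $ a)\<^sup>2) = 1"
proof -
  have "orthogonal_matrix (transpose P)" using assms by simp
  from orthogonal_row_sum[OF this, of a] show ?thesis by (simp add: transpose_def)
qed

lemma signed_permutation_transpose: "signed_permutation P \<Longrightarrow> signed_permutation (transpose P)"
  by (auto simp: signed_permutation_def transpose_def orthogonal_matrix_transpose[unfolded transpose_def])

text \<open>Each row has a single nonzero entry, so a congruence by P permutes the diagonal; the
  signs occur twice and cancel.\<close>

lemma signed_permutation_diag_form:
  fixes P :: "real^'p^'p"
  assumes P: "signed_permutation P"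
  shows "diag_form P C = (\<Sum>k\<in>UNIV. (C k k)\<^sup>2)"
proof -
  have orth: "orthogonal_matrix P" and ent: "\<And>i j. (P $ i $ j)\<^sup>2 = 0 \<or> (P $ i $ j)\<^sup>2 = 1"
    using P by (auto simp: signed_permutation_def)
  have zero: "P $ k $ a * P $ k $ b = 0" if "a \<noteq> b" for k a b
  proof (rule ccontr)
    assume "P $ k $ a * P $ k $ b \<noteq> 0"
    then have "(P $ k $ a)\<^sup>2 = 1" "(P $ k $ b)\<^sup>2 = 1" using ent[of k a] ent[of k b] by auto
    moreover have "(\<Sum>c\<in>{a, b}. (P $ k $ c)\<^sup>2) \<le> (\<Sum>c\<in>UNIV. (P $ k $ c)\<^sup>2)" by (rule sum_mono2) auto
    ultimately show False using that orthogonal_row_sum[OF orth, of k] by simp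
  qed
  have row: "(contract P (\<lambda>a. contract P (C a) k) k)\<^sup>2 = (\<Sum>a\<in>UNIV. (P $ k $ a)\<^sup>2 * (C a a)\<^sup>2)" for k
  proof -
    obtain a where a: "P $ k $ a \<noteq> 0"
    proof (rule ccontr)
      assume "\<not> thesis"
      then have "\<forall>a. P $ k $ a = 0" using that by blast
      then show False using orthogonal_row_sum[OF orth, of k] by simp
    qed
    have other: "P $ k $ b = 0" if "b \<noteq> a" for b using zero[OF that, of k] a by simp
    have one: "(P $ k $ a)\<^sup>2 = 1" using ent[of k a] a by auto
    have ct: "contract P f k = P $ k $ a * f a" for f
      unfolding contract_def by (rule sum.remove[THEN trans, of _ a]) (auto simp: other)
    have "(contract P (\<lambda>a. contract P (C a) k) k)\<^sup>2 = ((P $ k $ a)\<^sup>2 * C a a)\<^sup>2"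
      by (simp add: ct power2_eq_square mult_ac)
    also have "\<dots> = (P $ k $ a)\<^sup>2 * (C a a)\<^sup>2" by (simp add: one)
    also have "\<dots> = (\<Sum>a\<in>UNIV. (P $ k $ a)\<^sup>2 * (C a a)\<^sup>2)"
      by (rule sum.remove[THEN trans, of _ a, symmetric]) (auto simp: other)
    finally show ?thesis .
  qed
  have "diag_form P C = (\<Sum>a\<in>UNIV. (\<Sum>k\<in>UNIV. (P $ k $ a)\<^sup>2) * (C a a)\<^sup>2)"
    unfolding diag_form_def row by (subst sum.swap) (simp add: sum_distrib_right)
  then show ?thesis by (simp add: orthogonal_column_sum[OF orth])
qed

lemma objective_signed_permutation:
  assumes P: "signed_permutation P"
  shows "objective a b (P ** W) m = objective a b W m"
proof -
  have orth: "orthogonal_matrix P" using P by (simp add: signed_permutation_def)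
  show ?thesis
    unfolding objective_rotate[OF orth] signed_permutation_diag_form[OF P]
    by (simp add: objective_def objective3_def objective4_def)
qed

text \<open>A matrix with the single entry c at (i, i) becomes c u u^T with u the i-th column of U,
  whose diagonal has squared norm c^2 times the sum of the fourth powers of u. The guard on b covers
  skewness alone, where the fourth-order slot of the moments is set to zero.\<close>

lemma objective_diagonal_cumulants:
  fixes U :: "real^'p^'p"
  assumes U: "orthogonal_matrix U"
    and c3: "\<And>i j k. cent3 m i j k = (if i = j \<and> j = k then \<gamma> i else 0)"
    and c4: "b \<noteq> 0 \<Longrightarrow> \<forall>i j k l. cum4 m i j k l = (if i = j \<and> j = k \<and> k = l then \<kappa> i else 0)"
  shows "objective a b U m = (\<Sum>i\<in>UNIV. (a * (\<gamma> i)\<^sup>2 + b * (\<kappa> i)\<^sup>2) * (\<Sum>k\<in>UNIV. (U $ k $ i) ^ 4))"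
proof -
  have df: "diag_form U C = c\<^sup>2 * (\<Sum>k\<in>UNIV. (U $ k $ i) ^ 4)"
    if "\<And>x y. C x y = (if i = x \<and> x = y then c else 0)" for C :: "'p \<Rightarrow> 'p \<Rightarrow> real" and i c
  proof -
    have ct: "contract U (C x) k = (if i = x then U $ k $ i * c else 0)" for x k
      unfolding contract_def that by (simp add: if_distrib if_distribR cong: if_cong conj_cong)
    have "contract U (\<lambda>x. contract U (C x) k) k = (U $ k $ i)\<^sup>2 * c" for k
      unfolding ct by (simp add: contract_def if_distrib power2_eq_square mult.assoc cong: if_cong)
    then show ?thesis
      by (simp add: diag_form_def power_mult_distrib sum_distrib_left mult.commute flip: power_mult)
  qed
  have t3: "transform3 (mat 1) c = c" for c :: "'p \<Rightarrow> 'p \<Rightarrow> 'p \<Rightarrow> real" by (intro ext) (simp add: transform3_def)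
  have t4: "transform4 (mat 1) c = c" for c :: "'p \<Rightarrow> 'p \<Rightarrow> 'p \<Rightarrow> 'p \<Rightarrow> real" by (intro ext) (simp add: transform4_def t3)
  have "(\<Sum>i\<in>UNIV. diag_form U (cent3 m i)) = (\<Sum>i\<in>UNIV. (\<gamma> i)\<^sup>2 * (\<Sum>k\<in>UNIV. (U $ k $ i) ^ 4))"
    by (intro sum.cong refl df) (auto simp: c3)
  moreover have "b * (\<Sum>i\<in>UNIV. \<Sum>j\<in>UNIV. diag_form U (cum4 m i j)) = b * (\<Sum>i\<in>UNIV. (\<kappa> i)\<^sup>2 * (\<Sum>k\<in>UNIV. (U $ k $ i) ^ 4))"
  proof (cases "b = 0")
    case False
    have d4: "diag_form U (cum4 m i j) = (if i = j then (\<kappa> i)\<^sup>2 * (\<Sum>k\<in>UNIV. (U $ k $ i) ^ 4) else 0)" for i j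
      using df[of "cum4 m i j" i "if i = j then \<kappa> i else 0"] c4[OF False] by auto
    show ?thesis unfolding d4 by simp
  qed simp
  ultimately show ?thesis
    using objective_rotate[OF U, of a b "mat 1" m]
    by (simp add: t3 t4 distrib_right sum.distrib sum_distrib_left mult.assoc)
qed

text \<open>The entries of an orthogonal matrix are at most 1 in absolute value, so in each column
  the fourth powers sum to at most the sum 1 of the squares, with equality only for squared entries
  0 and 1. Maximality forces equality in every column of positive weight.\<close>

lemma objective_maximiser_signed_permutation:
  fixes U :: "real^'p^'p"
  assumes U: "orthogonal_matrix U" and w: "\<And>i. w i \<ge> 0" and w2: "\<And>i j. i \<noteq> j \<Longrightarrow> w i > 0 \<or> w j > 0"
    and max: "(\<Sum>i\<in>UNIV. w i * (\<Sum>k\<in>UNIV. (U $ k $ i) ^ 4)) \<ge> (\<Sum>i\<in>UNIV. w i)"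
  shows "signed_permutation U"
proof -
  have le1: "(U $ k $ i)\<^sup>2 \<le> 1" for k i
    using member_le_sum[of k UNIV "\<lambda>k. (U $ k $ i)\<^sup>2"] orthogonal_column_sum[OF U, of i] by simp
  have le4: "(U $ k $ i) ^ 4 \<le> (U $ k $ i)\<^sup>2" for k i
  proof -
    have "(U $ k $ i)\<^sup>2 * (U $ k $ i)\<^sup>2 \<le> (U $ k $ i)\<^sup>2 * 1" using le1 by (intro mult_left_mono) auto
    then show ?thesis by (simp flip: power_add)
  qed
  have s4: "(\<Sum>k\<in>UNIV. (U $ k $ i) ^ 4) \<le> 1" for i
    using sum_mono[of UNIV "\<lambda>k. (U $ k $ i) ^ 4" "\<lambda>k. (U $ k $ i)\<^sup>2"] le4 orthogonal_column_sum[OF U, of i] by simp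
  have "(\<Sum>i\<in>UNIV. w i * (1 - (\<Sum>k\<in>UNIV. (U $ k $ i) ^ 4))) \<le> 0"
    using max by (simp add: right_diff_distrib sum_subtractf)
  moreover have nn: "w i * (1 - (\<Sum>k\<in>UNIV. (U $ k $ i) ^ 4)) \<ge> 0" for i
    using w[of i] s4[of i] by simp
  ultimately have "(\<Sum>i\<in>UNIV. w i * (1 - (\<Sum>k\<in>UNIV. (U $ k $ i) ^ 4))) = 0"
    by (meson antisym sum_nonneg)
  then have z: "w i * (1 - (\<Sum>k\<in>UNIV. (U $ k $ i) ^ 4)) = 0" for i
    using nn by (simp add: sum_nonneg_eq_0_iff)
  have col: "(U $ k $ i)\<^sup>2 = 0 \<or> (U $ k $ i)\<^sup>2 = 1" if "w i > 0" for i k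
  proof -
    have "(\<Sum>k\<in>UNIV. (U $ k $ i)\<^sup>2 - (U $ k $ i) ^ 4) = 0"
      using z[of i] that orthogonal_column_sum[OF U, of i] by (simp add: sum_subtractf)
    then have "(U $ k $ i)\<^sup>2 - (U $ k $ i) ^ 4 = 0"
      using le4 by (subst (asm) sum_nonneg_eq_0_iff) auto
    moreover have "(U $ k $ i) ^ 4 = (U $ k $ i)\<^sup>2 * (U $ k $ i)\<^sup>2" by (simp add: power4_eq_xxxx power2_eq_square)
    moreover have "x = 0 \<or> x = 1" if "x - x * x = 0" for x :: real using that by algebra
    ultimately show ?thesis by metis
  qed
  have "(U $ k $ i)\<^sup>2 = 0 \<or> (U $ k $ i)\<^sup>2 = 1" for i k
  proof (cases "w i > 0")
    \<comment> \<open>The one column without weight: in each row all other squared entries are 0 or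
      1, and the unit length of the row determines the remaining one.\<close>
    case False
    then have other: "w j > 0" if "j \<noteq> i" for j using w2[OF that] by blast
    have row: "(U $ k $ i)\<^sup>2 + (\<Sum>j\<in>UNIV - {i}. (U $ k $ j)\<^sup>2) = 1"
      using orthogonal_row_sum[OF U, of k] sum.remove[of UNIV i "\<lambda>j. (U $ k $ j)\<^sup>2"] by simp
    show ?thesis
    proof (cases "\<exists>j. j \<noteq> i \<and> (U $ k $ j)\<^sup>2 = 1")
      case True
      then obtain j where j: "j \<in> UNIV - {i}" "(U $ k $ j)\<^sup>2 = 1" by blast
      have "(U $ k $ j)\<^sup>2 \<le> (\<Sum>j\<in>UNIV - {i}. (U $ k $ j)\<^sup>2)"
        by (rule member_le_sum[OF j(1)]) auto
      then have "(U $ k $ i)\<^sup>2 \<le> 0" using row j(2) by linarith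
      then show ?thesis by simp
    next
      case False
      then have "(\<Sum>j\<in>UNIV - {i}. (U $ k $ j)\<^sup>2) = 0"
        using col[OF other, of _ k] by (intro sum.neutral) auto
      then show ?thesis using row by simp
    qed
  qed (rule col)
  then show ?thesis using U by (auto simp: signed_permutation_def)
qed

section \<open>The estimator as a differentiable functional of the moments\<close>

lemma continuous_on_objective:
  "continuous_on A (\<lambda>p. objective a b (fst p) (snd p) :: real)"
  for A :: "((real^'p^'p) \<times> 'p::finite moments) set"
  unfolding objective_def objective3_def objective4_def transform3_def transform4_def contract_def
    cent3_def cum4_def cent4_def cent2_def mom1_def mom2_def mom3_def mom4_def
  by (intro continuous_intros)

lemma continuous_on_cov_matrix: "continuous_on A (cov_matrix :: 'p::finite moments \<Rightarrow> real^'p^'p)"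
  unfolding cov_matrix_def cent2_def mom1_def mom2_def by (intro continuous_intros)

lemma continuous_on_matrix_mult [continuous_intros]:
  fixes f g :: "'a::topological_space \<Rightarrow> real^'p^'p"
  assumes "continuous_on A f" "continuous_on A g"
  shows "continuous_on A (\<lambda>x. f x ** g x)"
  unfolding matrix_matrix_mult_def by (intro continuous_intros assms)

lemma tendsto_matrix_mult:
  fixes f g :: "'a \<Rightarrow> real^'p^'p"
  assumes "(f \<longlongrightarrow> A) F" "(g \<longlongrightarrow> B) F"
  shows "((\<lambda>x. f x ** g x) \<longlongrightarrow> A ** B) F"
  unfolding matrix_matrix_mult_def by (intro tendsto_intros assms)

lemma borel_measurable_matrix_mult [measurable]:
  fixes f g :: "'a \<Rightarrow> real^'p^'p"
  assumes "f \<in> borel_measurable M" "g \<in> borel_measurable M"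
  shows "(\<lambda>x. f x ** g x) \<in> borel_measurable M"
  by (rule borel_measurable_continuous_Pair[OF assms]) (intro continuous_intros)

text \<open>The value 0 outside the positive definite covariances makes this a Borel function on the
  whole moment space, where the selection of the rotation then makes sense too.\<close>

definition whitener :: "'p::finite moments \<Rightarrow> real^'p^'p" where
  "whitener m = (if sym_pos_def (cov_matrix m) then inv_sqrt_matrix (cov_matrix m) else 0)"

lemma measurable_whitener [measurable]: "(whitener :: 'p::finite moments \<Rightarrow> real^'p^'p) \<in> borel_measurable borel"
proof -
  have "(\<lambda>A::real^'p^'p. if A \<in> {A. sym_pos_def A} then inv_sqrt_matrix A else 0) \<in> borel_measurable borel"
    by (rule borel_measurable_continuous_on_if[OF borel_sym_pos_def continuous_on_inv_sqrt_matrix]) auto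
  moreover have "(cov_matrix :: 'p moments \<Rightarrow> real^'p^'p) \<in> borel_measurable borel"
    by (rule borel_measurable_continuous_onI[OF continuous_on_cov_matrix])
  ultimately have "(\<lambda>A::real^'p^'p. if A \<in> {A. sym_pos_def A} then inv_sqrt_matrix A else 0) \<circ> cov_matrix \<in> borel_measurable borel"
    by (rule measurable_comp[rotated])
  then show ?thesis by (simp add: whitener_def[abs_def] comp_def)
qed

lemma compact_orthogonal_matrices: "compact {U :: real^'p^'p. orthogonal_matrix U}"
proof -
  have "{U :: real^'p^'p. orthogonal_matrix U} = {U. transpose U ** U = mat 1}"
    by (simp add: orthogonal_matrix)
  moreover have "closed {U :: real^'p^'p. transpose U ** U = mat 1}"
    unfolding transpose_def by (intro closed_Collect_eq continuous_intros)
  ultimately have "closed {U :: real^'p^'p. orthogonal_matrix U}" by simp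
  moreover have "bounded {U :: real^'p^'p. orthogonal_matrix U}"
    unfolding bounded_iff
  proof (intro exI ballI)
    fix U :: "real^'p^'p" assume "U \<in> {U. orthogonal_matrix U}"
    then have "orthogonal_matrix U" by simp
    from orthogonal_row_sum[OF this] have "U $ k \<bullet> U $ k = 1" for k
      by (simp add: inner_vec_def power2_eq_square)
    then have "U \<bullet> U = (\<Sum>k\<in>(UNIV::'p set). 1)" unfolding inner_vec_def[of U] by simp
    then show "norm U \<le> sqrt CARD('p)" by (simp add: norm_eq_sqrt_inner)
  qed
  ultimately show ?thesis by (simp add: compact_eq_bounded_closed)
qed

text \<open>Signed permutations of a maximiser are maximisers, and the last clause picks a
  representative. It is imposed at every moment vector, so that the choice can be followed as the
  sample moments approach the population.\<close>

definition rotation_selection :: "real \<Rightarrow> real \<Rightarrow> ('p::finite moments \<Rightarrow> real^'p^'p) \<Rightarrow> bool" where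
  "rotation_selection a b sel \<longleftrightarrow> (\<forall>m. orthogonal_matrix (sel m) \<and>
     (\<forall>U. orthogonal_matrix U \<longrightarrow> objective a b (U ** whitener m) m \<le> objective a b (sel m ** whitener m) m) \<and>
     (\<forall>U. orthogonal_matrix U \<longrightarrow> objective a b (U ** whitener m) m = objective a b (sel m ** whitener m) m
        \<longrightarrow> norm (sel m - mat 1) \<le> norm (U - mat 1)))"

lemma rotation_selection_exists:
  obtains sel :: "'p::finite moments \<Rightarrow> real^'p^'p" where
    "sel \<in> borel_measurable borel" "rotation_selection a b sel"
proof -
  let ?K = "{U :: real^'p^'p. orthogonal_matrix U}"
  let ?f = "\<lambda>m U. objective a b (U ** whitener m) m"
  have ne: "?K \<noteq> {}" using orthogonal_matrix_id by blast
  have meas: "(\<lambda>m. ?f m U) \<in> borel_measurable borel" for U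
  proof -
    have "(\<lambda>m. (U ** whitener m, m)) \<in> borel_measurable borel"
      by measurable
    from borel_measurable_continuous_on[OF continuous_on_objective[of UNIV a b] this]
    show ?thesis by simp
  qed
  have cont: "continuous_on ?K (?f m)" for m
    using continuous_on_compose2[OF continuous_on_objective[of UNIV a b], of ?K "\<lambda>U. (U ** whitener m, m)"]
    by (simp add: continuous_intros)
  have g: "continuous_on UNIV (\<lambda>U :: real^'p^'p. norm (U - mat 1))" by (intro continuous_intros)
  obtain sel where sel: "sel \<in> borel_measurable borel" "\<forall>m\<in>space borel. sel m \<in> ?K \<and> (\<forall>U\<in>?K. ?f m U \<le> ?f m (sel m)) \<and>
      (\<forall>U\<in>?K. (\<forall>V\<in>?K. ?f m V \<le> ?f m U) \<longrightarrow> norm (sel m - mat 1) \<le> norm (U - mat 1))"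
    using measurable_argmax_selection[OF compact_orthogonal_matrices ne meas cont g] by (rule bexE)
  have "rotation_selection a b sel"
    unfolding rotation_selection_def
    using sel(2) by auto
  then show thesis using that sel(1) by blast
qed

section \<open>Implicit differentiation at a single point\<close>

lemma norm_matrix_vector_le:
  fixes A :: "real^'n^'m"
  shows "norm (A *v v) \<le> norm A * norm v"
proof -
  have "norm (A *v v) \<le> L2_set (\<lambda>i. norm (A $ i) * norm v) UNIV"
    unfolding norm_vec_def[of "A *v v"]
    by (rule L2_set_mono) (auto simp: matrix_vector_mul_component Cauchy_Schwarz_ineq2)
  also have "\<dots> = norm A * norm v" by (simp add: norm_vec_def[of A] L2_set_left_distrib)
  finally show ?thesis .
qed

lemma pos_def_near_identity:
  fixes A :: "real^'n^'n"
  assumes "norm (A - mat 1) < 1"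
  shows "pos_def_matrix A"
  unfolding pos_def_matrix_def
proof (intro allI impI)
  fix v :: "real^'n" assume v: "v \<noteq> 0"
  have "\<bar>v \<bullet> ((A - mat 1) *v v)\<bar> \<le> norm v * (norm (A - mat 1) * norm v)"
    using Cauchy_Schwarz_ineq2[of v "(A - mat 1) *v v"] mult_left_mono[OF norm_matrix_vector_le, of "norm v" "A - mat 1" v]
    by (meson norm_ge_zero order_trans)
  also have "\<dots> < norm v * (1 * norm v)"
    using assms v by (intro mult_strict_left_mono mult_strict_right_mono) auto
  finally have "\<bar>v \<bullet> ((A - mat 1) *v v)\<bar> < v \<bullet> v" by (simp add: dot_square_norm power2_eq_square)
  moreover have "v \<bullet> (A *v v) = v \<bullet> v + v \<bullet> ((A - mat 1) *v v)"
    by (simp add: matrix_vector_mult_diff_rdistrib inner_diff_right)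
  ultimately show "v \<bullet> (A *v v) > 0" by linarith
qed

lemma symmetric_cov_matrix: "symmetric_moments m \<Longrightarrow> transpose (cov_matrix m) = cov_matrix m"
  by (simp add: cov_matrix_def transpose_def cent2_def symmetric_moments_def vec_eq_iff mult.commute)

text \<open>Write Delta and h for the increments of tau and of m. As the equations hold along the
  graph of tau, the linearised equations are satisfied up to o(|Delta| + |h|), and
  \<open>solve\<close> converts this into |Delta - T h| = o(|Delta| + |h|). Boundedness of T then
  gives |Delta| = O(|h|), so the error is o(|h|). The hypothesis \<open>solve\<close> is a
  quantitative form of unique solvability.\<close>

lemma implicit_linearisation:
  fixes \<tau> :: "'e::euclidean_space \<Rightarrow> 'v::euclidean_space" and G :: "'j \<Rightarrow> 'v \<times> 'e \<Rightarrow> real"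
  assumes J: "finite J"
    and der: "\<And>j. j \<in> J \<Longrightarrow> (G j has_derivative G' j) (at (\<tau> \<mu>, \<mu>))"
    and zero: "\<forall>\<^sub>F m in at \<mu> within A. \<forall>j\<in>J. G j (\<tau> m, m) = G j (\<tau> \<mu>, \<mu>)"
    and cont: "(\<tau> \<longlongrightarrow> \<tau> \<mu>) (at \<mu> within A)"
    and T: "bounded_linear T"
    and solve: "\<And>\<Delta> h. norm (\<Delta> - T h) \<le> C * (\<Sum>j\<in>J. \<bar>G' j (\<Delta>, h)\<bar>)"
  shows "(\<tau> has_derivative T) (at \<mu> within A)"
  unfolding has_derivative_within_alt2
proof (intro conjI allI impI T)
  fix e :: real assume e: "e > 0"
  obtain K where K: "K > 0" "\<And>h. norm (T h) \<le> norm h * K" using bounded_linear.pos_bounded[OF T] by blast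
  \<comment> \<open>The bound 1/2 allows the Delta on the right to be absorbed on the left, giving
    |Delta| + |h| <= (2 + 2 K) |h|; the other bound then turns s times this into at most e
    |h|.\<close>
  define s where "s = min (1/2) (e / (2 + 2 * K))"
  have s: "s > 0" "s \<le> 1/2" "s * (2 + 2 * K) \<le> e"
  proof -
    show "s > 0" using e K(1) by (auto simp: s_def)
    show "s \<le> 1/2" unfolding s_def by (rule min.cobounded1)
    have "s \<le> e / (2 + 2 * K)" by (simp add: s_def)
    then show "s * (2 + 2 * K) \<le> e" using K(1) by (simp add: le_divide_eq)
  qed
  \<comment> \<open>Distributes the error s over the equations: |C| card J / D is at most 1, and the
    summand 1 keeps D positive.\<close>
  define D where "D = \<bar>C\<bar> * card J + 1"
  have D: "D > 0" by (simp add: D_def add_nonneg_pos)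
  have "s / D > 0" using s D by simp
  then have "\<forall>j\<in>J. \<forall>\<^sub>F y in at (\<tau> \<mu>, \<mu>). norm (G j y - G j (\<tau> \<mu>, \<mu>) - G' j (y - (\<tau> \<mu>, \<mu>))) \<le> s / D * norm (y - (\<tau> \<mu>, \<mu>))"
    using der unfolding has_derivative_within_alt2 by blast
  then have "\<forall>\<^sub>F y in at (\<tau> \<mu>, \<mu>). \<forall>j\<in>J. norm (G j y - G j (\<tau> \<mu>, \<mu>) - G' j (y - (\<tau> \<mu>, \<mu>))) \<le> s / D * norm (y - (\<tau> \<mu>, \<mu>))"
    using J by (simp add: eventually_ball_finite_distrib)
  then have "\<forall>\<^sub>F y in nhds (\<tau> \<mu>, \<mu>). y \<noteq> (\<tau> \<mu>, \<mu>) \<longrightarrow> (\<forall>j\<in>J. norm (G j y - G j (\<tau> \<mu>, \<mu>) - G' j (y - (\<tau> \<mu>, \<mu>))) \<le> s / D * norm (y - (\<tau> \<mu>, \<mu>)))"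
    by (simp add: eventually_at_filter)
  moreover have "filterlim (\<lambda>m. (\<tau> m, m)) (nhds (\<tau> \<mu>, \<mu>)) (at \<mu> within A)"
    by (intro tendsto_Pair cont tendsto_ident_at)
  ultimately have ev: "\<forall>\<^sub>F m in at \<mu> within A. (\<tau> m, m) \<noteq> (\<tau> \<mu>, \<mu>) \<longrightarrow>
      (\<forall>j\<in>J. norm (G j (\<tau> m, m) - G j (\<tau> \<mu>, \<mu>) - G' j ((\<tau> m, m) - (\<tau> \<mu>, \<mu>))) \<le> s / D * norm ((\<tau> m, m) - (\<tau> \<mu>, \<mu>)))"
    unfolding filterlim_iff by blast
  show "\<forall>\<^sub>F m in at \<mu> within A. norm (\<tau> m - \<tau> \<mu> - T (m - \<mu>)) \<le> e * norm (m - \<mu>)"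
    using ev zero
  proof eventually_elim
    case (elim m)
    define \<Delta> where "\<Delta> = \<tau> m - \<tau> \<mu>"
    define h where "h = m - \<mu>"
    show ?case
    proof (cases "(\<tau> m, m) = (\<tau> \<mu>, \<mu>)")
      case True
      then show ?thesis using T by (simp add: linear_simps)
    next
      case False
      have "\<bar>G' j (\<Delta>, h)\<bar> \<le> s / D * (norm \<Delta> + norm h)" if "j \<in> J" for j
      proof -
        have "\<bar>G' j (\<Delta>, h)\<bar> \<le> s / D * norm (\<Delta>, h)"
          using elim False that by (simp add: \<Delta>_def h_def)
        also have "\<dots> \<le> s / D * (norm \<Delta> + norm h)"
          using \<open>s / D > 0\<close> by (intro mult_left_mono norm_Pair_le) auto
        finally show ?thesis .
      qed
      then have "(\<Sum>j\<in>J. \<bar>G' j (\<Delta>, h)\<bar>) \<le> card J * (s / D * (norm \<Delta> + norm h))"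
        by (rule sum_bounded_above)
      then have "\<bar>C\<bar> * (\<Sum>j\<in>J. \<bar>G' j (\<Delta>, h)\<bar>) \<le> \<bar>C\<bar> * (card J * (s / D * (norm \<Delta> + norm h)))"
        by (rule mult_left_mono) simp
      also have "\<dots> = (\<bar>C\<bar> * card J / D) * (s * (norm \<Delta> + norm h))" by simp
      also have "\<dots> \<le> 1 * (s * (norm \<Delta> + norm h))"
        using s(1) D by (intro mult_right_mono) (auto simp: D_def divide_le_eq)
      finally have "\<bar>C\<bar> * (\<Sum>j\<in>J. \<bar>G' j (\<Delta>, h)\<bar>) \<le> s * (norm \<Delta> + norm h)" by simp
      moreover have "norm (\<Delta> - T h) \<le> \<bar>C\<bar> * (\<Sum>j\<in>J. \<bar>G' j (\<Delta>, h)\<bar>)"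
        using solve[of \<Delta> h] mult_right_mono[of C "\<bar>C\<bar>" "\<Sum>j\<in>J. \<bar>G' j (\<Delta>, h)\<bar>"] by (force simp: sum_nonneg)
      ultimately have 1: "norm (\<Delta> - T h) \<le> s * (norm \<Delta> + norm h)" by linarith
      also have "\<dots> \<le> 1/2 * (norm \<Delta> + norm h)" using s(2) by (intro mult_right_mono) auto
      finally have "norm \<Delta> \<le> 1/2 * (norm \<Delta> + norm h) + norm h * K"
        using norm_triangle_sub[of \<Delta> "T h"] K(2)[of h] by linarith
      moreover have "(2 + 2 * K) * norm h = 2 * norm h + 2 * (norm h * K)" by (simp add: algebra_simps)
      moreover have "x + y \<le> 2 * y + 2 * z" if "x \<le> 1/2 * (x + y) + z" for x y z :: real using that by argo
      ultimately have "norm \<Delta> + norm h \<le> (2 + 2 * K) * norm h" by metis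
      then have "s * (norm \<Delta> + norm h) \<le> s * ((2 + 2 * K) * norm h)" using s(1) by (intro mult_left_mono) auto
      also have "\<dots> \<le> e * norm h" using mult_right_mono[OF s(3), of "norm h"] by (simp add: mult.assoc)
      finally show ?thesis using 1 by (simp add: \<Delta>_def h_def)
    qed
  qed
qed

text \<open>Differentiation at a point where W is the identity: the product rule gives the
  derivative of W acting on this index of the unperturbed tensor, plus the derivative of the tensor
  itself.\<close>

lemma contract_has_derivative:
  fixes W :: "'x::real_normed_vector \<Rightarrow> real^'p^'p"
  assumes W: "(W has_derivative W') (at x within A)" and W1: "W x = mat 1"
    and f: "\<And>a. ((\<lambda>y. f y a) has_derivative f' a) (at x within A)"
  shows "((\<lambda>y. contract (W y) (f y) i) has_derivative (\<lambda>h. (\<Sum>a\<in>UNIV. W' h $ i $ a * f x a) + f' i h)) (at x within A)"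
proof -
  have We: "((\<lambda>y. W y $ i $ a) has_derivative (\<lambda>h. W' h $ i $ a)) (at x within A)" for i a
    using W by (intro bounded_linear.has_derivative[OF bounded_linear_vec_nth])
  have "((\<lambda>y. contract (W y) (f y) i) has_derivative (\<lambda>h. \<Sum>a\<in>UNIV. W x $ i $ a * f' a h + W' h $ i $ a * f x a)) (at x within A)"
    unfolding contract_def by (intro has_derivative_sum has_derivative_mult We f)
  moreover have "(\<Sum>a\<in>UNIV. W x $ i $ a * f' a h) = f' i h" for h
    using contract_mat_1[of "\<lambda>a. f' a h" i] by (simp add: W1 contract_def)
  ultimately show ?thesis by (simp add: sum.distrib add.commute)
qed

lemma transform3_has_derivative:
  fixes W :: "'x::real_normed_vector \<Rightarrow> real^'p^'p"
  assumes W: "(W has_derivative W') (at x within A)" "W x = mat 1"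
    and c: "\<And>i j k. ((\<lambda>y. c y i j k) has_derivative c' i j k) (at x within A)"
  shows "((\<lambda>y. transform3 (W y) (c y) i k l) has_derivative
     (\<lambda>h. (\<Sum>a\<in>UNIV. W' h $ i $ a * c x a k l) + ((\<Sum>a\<in>UNIV. W' h $ k $ a * c x i a l) + ((\<Sum>a\<in>UNIV. W' h $ l $ a * c x i k a) + c' i k l h)))) (at x within A)"
  unfolding transform3_def
  by (rule has_derivative_eq_rhs[OF contract_has_derivative[OF W contract_has_derivative[OF W contract_has_derivative[OF W c]]]])
    (simp add: W(2))

lemma transform3_mat_1: "transform3 (mat 1) c i k l = c i k l"
  by (simp add: transform3_def)

lemma transform4_mat_1: "transform4 (mat 1) c i j k l = c i j k l"
  by (simp add: transform4_def transform3_mat_1)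

lemma transform4_has_derivative:
  fixes W :: "'x::real_normed_vector \<Rightarrow> real^'p^'p"
  assumes W: "(W has_derivative W') (at x within A)" "W x = mat 1"
    and c: "\<And>i j k l. ((\<lambda>y. c y i j k l) has_derivative c' i j k l) (at x within A)"
  shows "((\<lambda>y. transform4 (W y) (c y) i j k l) has_derivative
     (\<lambda>h. (\<Sum>a\<in>UNIV. W' h $ i $ a * c x a j k l) + ((\<Sum>a\<in>UNIV. W' h $ j $ a * c x i a k l) + ((\<Sum>a\<in>UNIV. W' h $ k $ a * c x i j a l)
        + ((\<Sum>a\<in>UNIV. W' h $ l $ a * c x i j k a) + c' i j k l h))))) (at x within A)"
  unfolding transform4_def
  by (rule has_derivative_eq_rhs[OF contract_has_derivative[OF W transform3_has_derivative[OF W c]]])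
    (simp add: W(2) transform3_mat_1)

lemma mom_linear:
  "mom1 (x + y) i = mom1 x i + mom1 y i" "mom1 (r *\<^sub>R x) i = r * mom1 x i"
  "mom2 (x + y) i j = mom2 x i j + mom2 y i j" "mom2 (r *\<^sub>R x) i j = r * mom2 x i j"
  "mom3 (x + y) i j k = mom3 x i j k + mom3 y i j k" "mom3 (r *\<^sub>R x) i j k = r * mom3 x i j k"
  "mom4 (x + y) i j k l = mom4 x i j k l + mom4 y i j k l" "mom4 (r *\<^sub>R x) i j k l = r * mom4 x i j k l"
  by (simp_all add: mom1_def mom2_def mom3_def mom4_def)

lemma mom_has_derivative:
  fixes F :: "((real^'p^'p) \<times> 'p::finite moments) filter"
  shows "((\<lambda>x. mom1 (snd x) i) has_derivative (\<lambda>h. mom1 (snd h) i)) F"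
    "((\<lambda>x. mom2 (snd x) i j) has_derivative (\<lambda>h. mom2 (snd h) i j)) F"
    "((\<lambda>x. mom3 (snd x) i j k) has_derivative (\<lambda>h. mom3 (snd h) i j k)) F"
    "((\<lambda>x. mom4 (snd x) i j k l) has_derivative (\<lambda>h. mom4 (snd h) i j k l)) F"
  by (intro linear_imp_has_derivative linearI; simp add: mom_linear)+

text \<open>The weights of third and fourth order are kept as separate numbers a and b. The form of
  the fourth cumulants is assumed for b different from 0 only, so that the skewness case can be run
  with the fourth moments replaced by zero.\<close>

locale independent_moments =
  fixes a b :: real and \<mu> :: "'p::finite moments" and \<gamma> \<kappa> :: "'p \<Rightarrow> real"
    and sel :: "'p moments \<Rightarrow> real^'p^'p"
  assumes ab: "a \<ge> 0" "b \<ge> 0"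
    and mom1: "mom1 \<mu> i = 0"
    and mom2: "mom2 \<mu> i j = (if i = j then 1 else 0)"
    and mom3: "mom3 \<mu> i j k = (if i = j \<and> j = k then \<gamma> i else 0)"
    and cum4: "b \<noteq> 0 \<Longrightarrow> cum4 \<mu> i j k l = (if i = j \<and> j = k \<and> k = l then \<kappa> i else 0)"
    and weight2: "i \<noteq> j \<Longrightarrow> a * (\<gamma> i)\<^sup>2 + b * (\<kappa> i)\<^sup>2 > 0 \<or> a * (\<gamma> j)\<^sup>2 + b * (\<kappa> j)\<^sup>2 > 0"
    and symmetric: "symmetric_moments \<mu>"
    and sel: "rotation_selection a b sel"
begin

definition weight :: "'p \<Rightarrow> real" where "weight i = a * (\<gamma> i)\<^sup>2 + b * (\<kappa> i)\<^sup>2"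

definition unmixing :: "'p moments \<Rightarrow> real^'p^'p" where "unmixing m = sel m ** whitener m"

lemma weight_nonneg: "weight i \<ge> 0"
  using ab by (simp add: weight_def)

lemma weight_sum_pos: "i \<noteq> j \<Longrightarrow> weight i + weight j > 0"
  using weight2[of i j] weight_nonneg[of i] weight_nonneg[of j] by (auto simp: weight_def)

section \<open>Population values and consistency\<close>

lemma cent2_\<mu>: "cent2 \<mu> i j = (if i = j then 1 else 0)"
  by (simp add: cent2_def mom1 mom2)

lemma cent3_\<mu>: "cent3 \<mu> i j k = (if i = j \<and> j = k then \<gamma> i else 0)"
  by (simp add: cent3_def mom1 mom3)

lemma cov_\<mu>: "cov_matrix \<mu> = mat 1"
  by (simp add: cov_matrix_def cent2_\<mu> mat_def)

lemma sym_pos_def_mat_1: "sym_pos_def (mat 1 :: real^'n^'n)"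
  by (auto simp: sym_pos_def_def pos_def_matrix_def)

lemma whitener_\<mu>: "whitener \<mu> = mat 1"
  by (simp add: whitener_def cov_\<mu> sym_pos_def_mat_1 inv_sqrt_matrix_mat_1)

lemma objective_\<mu>: "orthogonal_matrix U \<Longrightarrow> objective a b U \<mu> = (\<Sum>i\<in>UNIV. weight i * (\<Sum>k\<in>UNIV. (U $ k $ i) ^ 4))"
  unfolding weight_def by (rule objective_diagonal_cumulants) (auto simp: cent3_\<mu> cum4)

lemma objective_\<mu>_mat_1: "objective a b (mat 1) \<mu> = (\<Sum>i\<in>UNIV. weight i)"
proof -
  have "(\<Sum>k\<in>UNIV. ((mat 1 :: real^'p^'p) $ k $ i) ^ 4) = 1" for i
    by (simp add: mat_def if_distrib[of "\<lambda>x. x ^ 4"] cong: if_cong)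
  then show ?thesis by (simp add: objective_\<mu>[OF orthogonal_matrix_id])
qed

lemma sel_orthogonal: "orthogonal_matrix (sel m)"
  and sel_max: "orthogonal_matrix U \<Longrightarrow> objective a b (U ** whitener m) m \<le> objective a b (sel m ** whitener m) m"
  and sel_nearest: "orthogonal_matrix U \<Longrightarrow> objective a b (U ** whitener m) m = objective a b (sel m ** whitener m) m
    \<Longrightarrow> norm (sel m - mat 1) \<le> norm (U - mat 1)"
  using sel unfolding rotation_selection_def by blast+

text \<open>At the population the identity is itself a maximiser, at distance 0 from itself, so the
  nearest maximiser is the identity.\<close>

lemma sel_\<mu>: "sel \<mu> = mat 1"
proof -
  have "objective a b (sel \<mu>) \<mu> \<le> objective a b (mat 1) \<mu>"
    unfolding objective_\<mu>[OF sel_orthogonal] objective_\<mu>_mat_1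
  proof (intro sum_mono)
    fix i
    have "(\<Sum>k\<in>UNIV. (sel \<mu> $ k $ i) ^ 4) \<le> (\<Sum>k\<in>UNIV. (sel \<mu> $ k $ i)\<^sup>2)"
    proof (rule sum_mono)
      fix k
      have "(sel \<mu> $ k $ i)\<^sup>2 \<le> 1"
        using member_le_sum[of k UNIV "\<lambda>k. (sel \<mu> $ k $ i)\<^sup>2"] orthogonal_column_sum[OF sel_orthogonal, of \<mu> i] by simp
      then have "(sel \<mu> $ k $ i)\<^sup>2 * (sel \<mu> $ k $ i)\<^sup>2 \<le> (sel \<mu> $ k $ i)\<^sup>2 * 1" by (intro mult_left_mono) auto
      then show "(sel \<mu> $ k $ i) ^ 4 \<le> (sel \<mu> $ k $ i)\<^sup>2" by (simp flip: power_add)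
    qed
    then have "weight i * (\<Sum>k\<in>UNIV. (sel \<mu> $ k $ i) ^ 4) \<le> weight i * 1"
      using orthogonal_column_sum[OF sel_orthogonal, of \<mu> i] weight_nonneg by (intro mult_left_mono) auto
    then show "weight i * (\<Sum>k\<in>UNIV. (sel \<mu> $ k $ i) ^ 4) \<le> weight i" by simp
  qed
  moreover have "objective a b (mat 1) \<mu> \<le> objective a b (sel \<mu>) \<mu>"
    using sel_max[OF orthogonal_matrix_id, of \<mu>] by (simp add: whitener_\<mu>)
  ultimately have "norm (sel \<mu> - mat 1) \<le> norm (mat 1 - mat 1 :: real^'p^'p)"
    using sel_nearest[OF orthogonal_matrix_id, of \<mu>] by (simp add: whitener_\<mu>)
  then show ?thesis by simp
qed

lemma unmixing_\<mu>: "unmixing \<mu> = mat 1"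
  by (simp add: unmixing_def sel_\<mu> whitener_\<mu>)

lemma tendsto_cov: "(cov_matrix \<longlongrightarrow> mat 1) (at \<mu> within S)"
  unfolding cov_\<mu>[symmetric]
  by (rule tendsto_within_subset[OF continuous_on_cov_matrix[of UNIV, unfolded continuous_on_def, rule_format]]) auto

lemma eventually_sym_pos_def: "\<forall>\<^sub>F m in at \<mu> within Collect symmetric_moments. sym_pos_def (cov_matrix m)"
proof -
  have "\<forall>\<^sub>F m in at \<mu> within Collect symmetric_moments. dist (cov_matrix m) (mat 1) < 1"
    using tendstoD[OF tendsto_cov zero_less_one] .
  moreover have "\<forall>\<^sub>F m in at \<mu> within Collect symmetric_moments. m \<in> Collect symmetric_moments"
    by (auto simp: eventually_at_filter)
  ultimately show ?thesis
    by eventually_elim (auto simp: sym_pos_def_def symmetric_cov_matrix pos_def_near_identity dist_norm)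
qed

lemma tendsto_whitener: "(whitener \<longlongrightarrow> mat 1) (at \<mu> within Collect symmetric_moments)"
proof -
  have "((\<lambda>m. inv_sqrt_matrix (cov_matrix m)) \<longlongrightarrow> inv_sqrt_matrix (mat 1)) (at \<mu> within Collect symmetric_moments)"
    by (rule continuous_on_tendsto_compose[OF continuous_on_inv_sqrt_matrix tendsto_cov])
      (use eventually_sym_pos_def in \<open>auto simp: sym_pos_def_mat_1\<close>)
  moreover have "\<forall>\<^sub>F m in at \<mu> within Collect symmetric_moments. inv_sqrt_matrix (cov_matrix m) = whitener m"
    using eventually_sym_pos_def by eventually_elim (simp add: whitener_def)
  ultimately show ?thesis unfolding inv_sqrt_matrix_mat_1 by (rule Lim_transform_eventually)
qed

text \<open>Suppose the selections stay away from the identity along moments tending to the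
  population. A subsequence converges to some orthogonal P, which maximises the population objective
  and so is a signed permutation. Then \<open>transpose P ** sel m\<close> attains the same
  objective value as \<open>sel m\<close>, yet converges to the identity along the subsequence,
  against the choice of the nearest maximiser.\<close>

lemma tendsto_sel: "(sel \<longlongrightarrow> mat 1) (at \<mu> within Collect symmetric_moments)"
  unfolding tendsto_iff
proof (intro allI impI, rule ccontr)
  fix e :: real assume e: "e > 0"
  assume no: "\<not> (\<forall>\<^sub>F m in at \<mu> within Collect symmetric_moments. dist (sel m) (mat 1) < e)"
  have "\<exists>m. symmetric_moments m \<and> m \<noteq> \<mu> \<and> dist m \<mu> < 1 / Suc n \<and> dist (sel m) (mat 1) \<ge> e" for n
  proof (rule ccontr)
    assume "\<not> ?thesis"
    then have "\<forall>m\<in>Collect symmetric_moments. m \<noteq> \<mu> \<and> dist m \<mu> < 1 / Suc n \<longrightarrow> dist (sel m) (mat 1) < e" by force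
    moreover have "1 / real (Suc n) > 0" by simp
    ultimately show False using no unfolding eventually_at by blast
  qed
  then obtain X where X: "\<And>n. symmetric_moments (X n)" "\<And>n. X n \<noteq> \<mu>" "\<And>n. dist (X n) \<mu> < 1 / Suc n"
    "\<And>n. dist (sel (X n)) (mat 1) \<ge> e" by metis
  have "X \<longlonglongrightarrow> \<mu>"
  proof (rule tendstoI)
    fix d :: real assume "d > 0"
    then obtain N where N: "1 / Suc N < d" using nat_approx_posE by metis
    show "\<forall>\<^sub>F n in sequentially. dist (X n) \<mu> < d"
      using eventually_ge_at_top[of N]
    proof eventually_elim
      case (elim n)
      have "1 / real (Suc n) \<le> 1 / real (Suc N)" using elim by (intro divide_left_mono) auto
      then show ?case using X(3)[of n] N by linarith
    qed
  qed
  have lim_within: "filterlim X (at \<mu> within Collect symmetric_moments) sequentially"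
    using \<open>X \<longlonglongrightarrow> \<mu>\<close> X(1,2) by (auto simp: filterlim_at)
  have "\<exists>P\<in>{U. orthogonal_matrix U}. \<exists>r. strict_mono r \<and> ((\<lambda>n. sel (X n)) \<circ> r) \<longlonglongrightarrow> P"
    by (rule compact_orthogonal_matrices[unfolded compact_def, rule_format]) (simp add: sel_orthogonal)
  then obtain P r where P: "P \<in> {U. orthogonal_matrix U}" "strict_mono r" "((\<lambda>n. sel (X n)) \<circ> r) \<longlonglongrightarrow> P"
    by (elim bexE exE conjE)
  have oP: "orthogonal_matrix P" using P(1) by simp
  have Xr: "filterlim (\<lambda>n. X (r n)) (at \<mu> within Collect symmetric_moments) sequentially"
    using filterlim_compose[OF lim_within filterlim_subseq[OF P(2)]] .
  then have Xr': "(\<lambda>n. X (r n)) \<longlonglongrightarrow> \<mu>" by (simp add: filterlim_at)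
  have wr: "(\<lambda>n. whitener (X (r n))) \<longlonglongrightarrow> mat 1" by (rule filterlim_compose[OF tendsto_whitener Xr])
  have Ur: "(\<lambda>n. sel (X (r n))) \<longlonglongrightarrow> P" using P(3) by (simp add: comp_def)
  have obj_lim: "(\<lambda>n. objective a b (V n ** whitener (X (r n))) (X (r n))) \<longlonglongrightarrow> objective a b V0 \<mu>"
    if "V \<longlonglongrightarrow> V0" for V V0
    using continuous_on_tendsto_compose[OF continuous_on_objective[of UNIV a b] tendsto_Pair[OF tendsto_matrix_mult[OF that wr] Xr']]
    by simp
  have "objective a b (mat 1) \<mu> \<le> objective a b P \<mu>"
  proof (rule LIMSEQ_le[OF obj_lim obj_lim[OF Ur]])
    show "(\<lambda>n. mat 1 :: real^'p^'p) \<longlonglongrightarrow> mat 1" by simp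
    show "\<exists>N. \<forall>n\<ge>N. objective a b (mat 1 ** whitener (X (r n))) (X (r n)) \<le> objective a b (sel (X (r n)) ** whitener (X (r n))) (X (r n))"
      using sel_max[OF orthogonal_matrix_id] by blast
  qed
  then have sP: "signed_permutation P"
    by (intro objective_maximiser_signed_permutation[OF oP weight_nonneg])
      (use weight2 in \<open>auto simp: objective_\<mu>[OF oP] objective_\<mu>_mat_1 weight_def\<close>)
  then have sP': "signed_permutation (transpose P)" by (rule signed_permutation_transpose)
  have "norm (sel m - mat 1) \<le> norm (transpose P ** sel m - mat 1)" for m
  proof (rule sel_nearest)
    show "orthogonal_matrix (transpose P ** sel m)"
      using oP sel_orthogonal by (intro orthogonal_matrix_mul) auto
    show "objective a b (transpose P ** sel m ** whitener m) m = objective a b (sel m ** whitener m) m"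
      unfolding matrix_mul_assoc[symmetric] by (rule objective_signed_permutation[OF sP'])
  qed
  then have le: "e \<le> norm (transpose P ** sel (X (r n)) - mat 1)" for n
    using X(4)[of "r n"] by (metis dist_norm order_trans)
  have "(\<lambda>n. transpose P ** sel (X (r n))) \<longlonglongrightarrow> transpose P ** P"
    by (intro tendsto_matrix_mult tendsto_const Ur)
  then have "(\<lambda>n. norm (transpose P ** sel (X (r n)) - mat 1)) \<longlonglongrightarrow> norm (mat 1 - mat 1 :: real^'p^'p)"
    using oP by (intro tendsto_norm tendsto_diff tendsto_const) (simp add: orthogonal_matrix)
  then have "e \<le> norm (mat 1 - mat 1 :: real^'p^'p)"
    using le by (intro LIMSEQ_le_const) auto
  then show False using e by simp
qed

lemma tendsto_unmixing: "(unmixing \<longlongrightarrow> mat 1) (at \<mu> within Collect symmetric_moments)"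
  using tendsto_matrix_mult[OF tendsto_sel tendsto_whitener] by (simp add: unmixing_def[abs_def])

text \<open>The (k, l) entry of \<open>W Sigma W^T\<close>.\<close>

definition whitening_eq :: "'p \<Rightarrow> 'p \<Rightarrow> (real^'p^'p) \<times> 'p moments \<Rightarrow> real" where
  "whitening_eq k l x = contract (fst x) (\<lambda>i. contract (fst x) (cent2 (snd x) i) l) k"

definition rotation_eq :: "'p \<Rightarrow> 'p \<Rightarrow> (real^'p^'p) \<times> 'p moments \<Rightarrow> real" where
  "rotation_eq k l x = a * estimating3 k l (fst x) (snd x) + b * estimating4 k l (fst x) (snd x)"

lemma unmixing_equations:
  assumes "symmetric_moments m" "sym_pos_def (cov_matrix m)"
  shows "whitening_eq k l (unmixing m, m) = (if k = l then 1 else 0)"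
    and "k \<noteq> l \<Longrightarrow> rotation_eq k l (unmixing m, m) = 0"
proof -
  let ?S = "inv_sqrt_matrix (cov_matrix m)"
  have S: "whitener m = ?S" using assms(2) by (simp add: whitener_def)
  have tS: "transpose ?S = ?S" using inv_sqrt_matrix(1)[OF assms(2)] by (simp add: sym_pos_def_def)
  have "unmixing m ** cov_matrix m ** transpose (unmixing m) = sel m ** (?S ** cov_matrix m ** ?S) ** transpose (sel m)"
    by (simp add: unmixing_def S matrix_transpose_mul tS matrix_mul_assoc)
  also have "\<dots> = mat 1"
    using sel_orthogonal[of m] by (simp add: inv_sqrt_matrix_whitens[OF assms(2)] orthogonal_matrix_def)
  finally have "(unmixing m ** cov_matrix m ** transpose (unmixing m)) $ k $ l = (mat 1 :: real^'p^'p) $ k $ l" by simp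
  then show "whitening_eq k l (unmixing m, m) = (if k = l then 1 else 0)"
    by (simp add: matrix_congruence_contract whitening_eq_def cov_matrix_def mat_def)
  show "rotation_eq k l (unmixing m, m) = 0" if "k \<noteq> l"
    unfolding rotation_eq_def fst_conv snd_conv
  proof (rule objective_first_order[OF assms(1) that])
    fix V :: "real^'p^'p" assume "orthogonal_matrix V"
    then have "orthogonal_matrix (V ** sel m)" using sel_orthogonal by (rule orthogonal_matrix_mul)
    from sel_max[OF this] show "objective a b (V ** unmixing m) m \<le> objective a b (unmixing m) m"
      by (simp add: unmixing_def matrix_mul_assoc)
  qed
qed

section \<open>Linearised equations and the influence map\<close>

abbreviation "base \<equiv> (mat 1 :: real^'p^'p, \<mu>)"

lemma fst_has_derivative: "((\<lambda>x. fst x) has_derivative fst) (at base)"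
  by (rule bounded_linear_imp_has_derivative[OF bounded_linear_fst])

text \<open>The population means vanish, so products of means have no first-order part and central
  moments linearise to few terms.\<close>

lemma cent2_has_derivative: "((\<lambda>x. cent2 (snd x) i j) has_derivative (\<lambda>h. mom2 (snd h) i j)) (at base)"
  unfolding cent2_def
  by (rule has_derivative_eq_rhs, (rule derivative_intros mom_has_derivative)+) (simp add: mom1)

lemma cent3_has_derivative:
  "((\<lambda>x. cent3 (snd x) i j k) has_derivative
     (\<lambda>h. mom3 (snd h) i j k - mom1 (snd h) i * mom2 \<mu> j k - mom1 (snd h) j * mom2 \<mu> i k - mom1 (snd h) k * mom2 \<mu> i j)) (at base)"
  unfolding cent3_def
  by (rule has_derivative_eq_rhs, (rule derivative_intros mom_has_derivative)+) (simp add: mom1)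

lemma cum4_has_derivative:
  "((\<lambda>x. cum4 (snd x) i j k l) has_derivative
     (\<lambda>h. mom4 (snd h) i j k l - mom1 (snd h) i * mom3 \<mu> j k l - mom1 (snd h) j * mom3 \<mu> i k l - mom1 (snd h) k * mom3 \<mu> i j l - mom1 (snd h) l * mom3 \<mu> i j k
       - (mom2 (snd h) i j * mom2 \<mu> k l + mom2 \<mu> i j * mom2 (snd h) k l)
       - (mom2 (snd h) i k * mom2 \<mu> j l + mom2 \<mu> i k * mom2 (snd h) j l)
       - (mom2 (snd h) j k * mom2 \<mu> i l + mom2 \<mu> j k * mom2 (snd h) i l))) (at base)"
  unfolding cum4_def cent4_def
  by (rule has_derivative_eq_rhs, (rule derivative_intros mom_has_derivative cent2_has_derivative)+) (simp add: mom1 cent2_def fun_eq_iff)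

lemma whitening_eq_has_derivative:
  "(whitening_eq k l has_derivative (\<lambda>h. fst h $ k $ l + fst h $ l $ k + mom2 (snd h) k l)) (at base)"
  unfolding whitening_eq_def[abs_def]
  by (rule has_derivative_eq_rhs[OF contract_has_derivative[OF fst_has_derivative _ contract_has_derivative[OF fst_has_derivative _ cent2_has_derivative]]])
    (simp_all add: cent2_\<mu> if_distrib fun_eq_iff cong: if_cong)

text \<open>The parts of the linearised rotation equation that stem from the perturbation \<open>h\<close> of the
  moments rather than from that of the unmixing matrix.\<close>

definition skew_term :: "'p \<Rightarrow> 'p \<Rightarrow> 'p moments \<Rightarrow> real" where
  "skew_term k l h = \<gamma> k * (mom3 h k k l - mom1 h l) - \<gamma> l * (mom3 h l k l - mom1 h k)"

text \<open>The covariance terms come from the three pairings subtracted in the fourth cumulant. The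
  indices k l and l k are told apart since the linearisation admits every direction h, symmetric or
  not.\<close>

definition kurt_term :: "'p \<Rightarrow> 'p \<Rightarrow> 'p moments \<Rightarrow> real" where
  "kurt_term k l h = \<kappa> k * (mom4 h k k k l - \<gamma> k * mom1 h l - 3 * mom2 h k l)
     - \<kappa> l * (mom4 h l l k l - \<gamma> l * mom1 h k - mom2 h k l - 2 * mom2 h l k)"

text \<open>At the population the factor with distinct last indices k, l is zero. The product rule
  therefore leaves the derivative of this factor times the difference of diagonal entries, which is
  nonzero at most for i = k and i = l.\<close>

lemma estimating3_has_derivative:
  assumes kl: "k \<noteq> l"
  shows "((\<lambda>x. estimating3 k l (fst x) (snd x)) has_derivative
     (\<lambda>h. (\<gamma> k)\<^sup>2 * fst h $ l $ k - (\<gamma> l)\<^sup>2 * fst h $ k $ l + skew_term k l (snd h))) (at base)"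
proof -
  define T' where "T' i k l h = (\<Sum>s\<in>UNIV. fst h $ i $ s * cent3 \<mu> s k l) + ((\<Sum>s\<in>UNIV. fst h $ k $ s * cent3 \<mu> i s l) + ((\<Sum>s\<in>UNIV. fst h $ l $ s * cent3 \<mu> i k s)
     + (mom3 (snd h) i k l - mom1 (snd h) i * mom2 \<mu> k l - mom1 (snd h) k * mom2 \<mu> i l - mom1 (snd h) l * mom2 \<mu> i k)))"
    for i k l and h :: "(real^'p^'p) \<times> 'p moments"
  have T: "((\<lambda>x. transform3 (fst x) (cent3 (snd x)) i k l) has_derivative T' i k l) (at base)" for i k l
    unfolding T'_def[abs_def] using transform3_has_derivative[OF fst_has_derivative _ cent3_has_derivative] by simp
  have lk: "l \<noteq> k" using kl by simp
  have z: "cent3 \<mu> s k l = 0" "cent3 \<mu> k s l = 0" "cent3 \<mu> l k s = 0" "cent3 \<mu> k k s = (if s = k then \<gamma> k else 0)"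
    "cent3 \<mu> l s l = (if s = l then \<gamma> l else 0)" for s
    using kl by (auto simp: cent3_\<mu>)
  show ?thesis
    unfolding estimating3_def
  proof (rule has_derivative_eq_rhs[OF has_derivative_sum[OF has_derivative_mult[OF T has_derivative_diff[OF T T]]]], rule ext)
    fix h :: "(real^'p^'p) \<times> 'p moments"
    have "(\<Sum>i\<in>UNIV. transform3 (fst base) (cent3 (snd base)) i k l * (T' i k k h - T' i l l h)
       + T' i k l h * (transform3 (fst base) (cent3 (snd base)) i k k - transform3 (fst base) (cent3 (snd base)) i l l))
      = (\<Sum>i\<in>UNIV. (if i = k then T' i k l h * \<gamma> i else 0) - (if i = l then T' i k l h * \<gamma> i else 0))"
      using kl by (intro sum.cong refl) (auto simp: transform3_mat_1 cent3_\<mu>)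
    also have "\<dots> = T' k k l h * \<gamma> k - T' l k l h * \<gamma> l"
      by (simp add: sum_subtractf)
    also have "T' k k l h = fst h $ l $ k * \<gamma> k + (mom3 (snd h) k k l - mom1 (snd h) l)"
      using kl lk by (simp add: T'_def z mom2 if_distrib cong: if_cong)
    also have "T' l k l h = fst h $ k $ l * \<gamma> l + (mom3 (snd h) l k l - mom1 (snd h) k)"
      using kl lk by (simp add: T'_def z mom2 if_distrib cong: if_cong)
    finally show "(\<Sum>i\<in>UNIV. transform3 (fst base) (cent3 (snd base)) i k l * (T' i k k h - T' i l l h)
       + T' i k l h * (transform3 (fst base) (cent3 (snd base)) i k k - transform3 (fst base) (cent3 (snd base)) i l l))
      = (\<gamma> k)\<^sup>2 * fst h $ l $ k - (\<gamma> l)\<^sup>2 * fst h $ k $ l + skew_term k l (snd h)"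
      by (simp add: skew_term_def power2_eq_square algebra_simps)
  qed
qed

lemma estimating4_has_derivative:
  assumes kl: "k \<noteq> l" and b: "b \<noteq> 0"
  shows "((\<lambda>x. estimating4 k l (fst x) (snd x)) has_derivative
     (\<lambda>h. (\<kappa> k)\<^sup>2 * fst h $ l $ k - (\<kappa> l)\<^sup>2 * fst h $ k $ l + kurt_term k l (snd h))) (at base)"
proof -
  define C' where "C' i j k l h = mom4 h i j k l - mom1 h i * mom3 \<mu> j k l - mom1 h j * mom3 \<mu> i k l - mom1 h k * mom3 \<mu> i j l - mom1 h l * mom3 \<mu> i j k
       - (mom2 h i j * mom2 \<mu> k l + mom2 \<mu> i j * mom2 h k l)
       - (mom2 h i k * mom2 \<mu> j l + mom2 \<mu> i k * mom2 h j l)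
       - (mom2 h j k * mom2 \<mu> i l + mom2 \<mu> j k * mom2 h i l)" for i j k l h
  define T' where "T' i j k l h = (\<Sum>s\<in>UNIV. fst h $ i $ s * cum4 \<mu> s j k l) + ((\<Sum>s\<in>UNIV. fst h $ j $ s * cum4 \<mu> i s k l) + ((\<Sum>s\<in>UNIV. fst h $ k $ s * cum4 \<mu> i j s l)
     + ((\<Sum>s\<in>UNIV. fst h $ l $ s * cum4 \<mu> i j k s) + C' i j k l (snd h))))"
    for i j k l and h :: "(real^'p^'p) \<times> 'p moments"
  have T: "((\<lambda>x. transform4 (fst x) (cum4 (snd x)) i j k l) has_derivative T' i j k l) (at base)" for i j k l
    unfolding T'_def[abs_def] C'_def using transform4_has_derivative[OF fst_has_derivative _ cum4_has_derivative] by simp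
  have lk: "l \<noteq> k" using kl by simp
  note c4 = cum4[OF b]
  have z: "cum4 \<mu> s k k l = 0" "cum4 \<mu> k s k l = 0" "cum4 \<mu> k k s l = 0" "cum4 \<mu> k k k s = (if s = k then \<kappa> k else 0)"
    "cum4 \<mu> s l k l = 0" "cum4 \<mu> l s k l = 0" "cum4 \<mu> l l k s = 0" "cum4 \<mu> l l s l = (if s = l then \<kappa> l else 0)" for s
    using kl by (auto simp: c4)
  show ?thesis
    unfolding estimating4_def
  proof (rule has_derivative_eq_rhs[OF has_derivative_sum[OF has_derivative_sum[OF has_derivative_mult[OF T has_derivative_diff[OF T T]]]]], rule ext)
    fix h :: "(real^'p^'p) \<times> 'p moments"
    have "(\<Sum>i\<in>UNIV. \<Sum>j\<in>UNIV. transform4 (fst base) (cum4 (snd base)) i j k l * (T' i j k k h - T' i j l l h)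
       + T' i j k l h * (transform4 (fst base) (cum4 (snd base)) i j k k - transform4 (fst base) (cum4 (snd base)) i j l l))
      = (\<Sum>i\<in>UNIV. \<Sum>j\<in>UNIV. (if j = k then if i = k then T' i j k l h * \<kappa> i else 0 else 0) - (if j = l then if i = l then T' i j k l h * \<kappa> i else 0 else 0))"
      using kl by (intro sum.cong refl) (auto simp: transform4_mat_1 c4)
    also have "\<dots> = T' k k k l h * \<kappa> k - T' l l k l h * \<kappa> l"
      by (simp add: sum_subtractf)
    also have "T' k k k l h = fst h $ l $ k * \<kappa> k + (mom4 (snd h) k k k l - \<gamma> k * mom1 (snd h) l - 3 * mom2 (snd h) k l)"
      using kl lk by (simp add: T'_def C'_def z mom2 mom3 if_distrib cong: if_cong)
    also have "T' l l k l h = fst h $ k $ l * \<kappa> l + (mom4 (snd h) l l k l - \<gamma> l * mom1 (snd h) k - mom2 (snd h) k l - 2 * mom2 (snd h) l k)"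
      using kl lk by (simp add: T'_def C'_def z mom2 mom3 if_distrib cong: if_cong)
    finally show "(\<Sum>i\<in>UNIV. \<Sum>j\<in>UNIV. transform4 (fst base) (cum4 (snd base)) i j k l * (T' i j k k h - T' i j l l h)
       + T' i j k l h * (transform4 (fst base) (cum4 (snd base)) i j k k - transform4 (fst base) (cum4 (snd base)) i j l l))
      = (\<kappa> k)\<^sup>2 * fst h $ l $ k - (\<kappa> l)\<^sup>2 * fst h $ k $ l + kurt_term k l (snd h)"
      by (simp add: kurt_term_def power2_eq_square algebra_simps)
  qed
qed

lemma rotation_eq_has_derivative:
  assumes kl: "k \<noteq> l"
  shows "(rotation_eq k l has_derivative
     (\<lambda>h. weight k * fst h $ l $ k - weight l * fst h $ k $ l + (a * skew_term k l (snd h) + b * kurt_term k l (snd h)))) (at base)"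
proof -
  have "((\<lambda>x. b * estimating4 k l (fst x) (snd x)) has_derivative
     (\<lambda>h. b * ((\<kappa> k)\<^sup>2 * fst h $ l $ k - (\<kappa> l)\<^sup>2 * fst h $ k $ l + kurt_term k l (snd h)))) (at base)"
    using estimating4_has_derivative[OF kl] by (cases "b = 0") (auto intro: has_derivative_mult_right)
  from has_derivative_add[OF has_derivative_mult_right[OF estimating3_has_derivative[OF kl], of a] this]
  show ?thesis
    unfolding rotation_eq_def[abs_def]
    by (rule has_derivative_eq_rhs) (simp add: fun_eq_iff weight_def algebra_simps)
qed

text \<open>The solution of the linearised equations. On the diagonal whitening reads 2 D_kk = -
  h_kk. Off the diagonal it gives D_lk = - h_kl - D_kl, and inserting this in the rotation equation
  leaves D_kl multiplied by the sum of the two weights.\<close>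

definition influence_map :: "'p moments \<Rightarrow> real^'p^'p" where
  "influence_map h = (\<chi> k l. if k = l then - mom2 h k k / 2
     else (a * skew_term k l h + b * kurt_term k l h - weight k * mom2 h k l) / (weight k + weight l))"

lemma bounded_linear_influence_map: "bounded_linear influence_map"
  unfolding linear_conv_bounded_linear[symmetric]
proof (rule linearI)
  have sum: "skew_term k l (x + y) = skew_term k l x + skew_term k l y" "kurt_term k l (x + y) = kurt_term k l x + kurt_term k l y"
    and scale: "skew_term k l (r *\<^sub>R x) = r * skew_term k l x" "kurt_term k l (r *\<^sub>R x) = r * kurt_term k l x" for k l x y r
    by (simp_all add: skew_term_def kurt_term_def mom_linear algebra_simps)
  fix x y :: "'p moments" and r :: real
  show "influence_map (x + y) = influence_map x + influence_map y"
    by (simp add: influence_map_def vec_eq_iff sum mom_linear add_divide_distrib[symmetric] algebra_simps)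
  show "influence_map (r *\<^sub>R x) = r *\<^sub>R influence_map x"
    by (simp add: influence_map_def vec_eq_iff scale mom_linear algebra_simps)
qed

theorem unmixing_has_derivative: "(unmixing has_derivative influence_map) (at \<mu> within Collect symmetric_moments)"
proof -
  \<comment> \<open>All equations in one family: the flag tells whitening from rotation, and the
    diagonal, which carries no rotation, is padded with the trivial equation 0 = 0.\<close>
  define G where "G = (\<lambda>(r, k, l). if r then whitening_eq k l else if k = l then (\<lambda>x. 0) else rotation_eq k l)"
  define G' where "G' = (\<lambda>(r, k, l). if r then (\<lambda>h. fst h $ k $ l + fst h $ l $ k + mom2 (snd h) k l)
     else if k = l then (\<lambda>h. 0) else
     (\<lambda>h. weight k * fst h $ l $ k - weight l * fst h $ k $ l + (a * skew_term k l (snd h) + b * kurt_term k l (snd h))))"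
  \<comment> \<open>With p and g the residuals of the two linearised equations, the error in an
    off-diagonal entry is (weight k p - g) / (weight k + weight l); in a diagonal entry it is half
    of the whitening residual.\<close>
  define c where "c k l = (if k = l then 1/2 else (weight k + 1) / (weight k + weight l))" for k l
  show ?thesis
  proof (rule implicit_linearisation[where J = "UNIV :: (bool \<times> 'p \<times> 'p) set" and G = G and G' = G' and C = "\<Sum>k\<in>UNIV. \<Sum>l\<in>UNIV. c k l"])
    show "(G j has_derivative G' j) (at (unmixing \<mu>, \<mu>))" for j
      by (cases j) (auto simp: G_def G'_def unmixing_\<mu> whitening_eq_has_derivative rotation_eq_has_derivative)
    have sym: "\<forall>\<^sub>F m in at \<mu> within Collect symmetric_moments. symmetric_moments m"
      by (auto simp: eventually_at_filter)
    have "symmetric_moments \<mu>"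
      by (rule symmetric)
    then have base: "whitening_eq k l (unmixing \<mu>, \<mu>) = (if k = l then 1 else 0)" "k \<noteq> l \<Longrightarrow> rotation_eq k l (unmixing \<mu>, \<mu>) = 0" for k l
      using unmixing_equations[of \<mu>] by (simp_all add: cov_\<mu> sym_pos_def_mat_1)
    show "\<forall>\<^sub>F m in at \<mu> within Collect symmetric_moments. \<forall>j\<in>UNIV. G j (unmixing m, m) = G j (unmixing \<mu>, \<mu>)"
      using sym eventually_sym_pos_def
      by eventually_elim (auto simp: G_def unmixing_equations base)
    show "(unmixing \<longlongrightarrow> unmixing \<mu>) (at \<mu> within Collect symmetric_moments)"
      unfolding unmixing_\<mu> by (rule tendsto_unmixing)
    fix \<Delta> :: "real^'p^'p" and h :: "'p moments"
    let ?s = "\<Sum>j\<in>UNIV. \<bar>G' j (\<Delta>, h)\<bar>"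
    have mem: "\<bar>G' j (\<Delta>, h)\<bar> \<le> ?s" for j by (rule member_le_sum) auto
    have s0: "?s \<ge> 0" by (intro sum_nonneg) auto
    have entry: "\<bar>(\<Delta> - influence_map h) $ k $ l\<bar> \<le> c k l * ?s" for k l
    proof (cases "k = l")
      case True
      have "(\<Delta> - influence_map h) $ k $ l = G' (True, k, k) (\<Delta>, h) / 2"
        using True by (simp add: influence_map_def G'_def)
      then have "\<bar>(\<Delta> - influence_map h) $ k $ l\<bar> = \<bar>G' (True, k, k) (\<Delta>, h)\<bar> / 2"
        by (simp only: abs_divide abs_numeral)
      also have "\<dots> \<le> ?s / 2" by (intro divide_right_mono mem) simp
      finally show ?thesis using True by (simp add: c_def)
    next
      case False
      define p where "p = G' (True, k, l) (\<Delta>, h)"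
      define g where "g = G' (False, k, l) (\<Delta>, h)"
      have w: "weight k + weight l > 0" using weight_sum_pos[OF False] .
      have "(\<Delta> $ k $ l) * (weight k + weight l) = weight k * p - g + (a * skew_term k l h + b * kurt_term k l h - weight k * mom2 h k l)"
        using False by (simp add: p_def g_def G'_def algebra_simps)
      then have "(\<Delta> - influence_map h) $ k $ l = (weight k * p - g) / (weight k + weight l)"
        using False w by (simp add: influence_map_def field_simps)
      moreover have "\<bar>weight k * p - g\<bar> \<le> (weight k + 1) * ?s"
      proof -
        have "\<bar>weight k * p - g\<bar> \<le> weight k * \<bar>p\<bar> + \<bar>g\<bar>"
          using abs_triangle_ineq4[of "weight k * p" g] weight_nonneg[of k] by (simp add: abs_mult)
        also have "\<dots> \<le> weight k * ?s + ?s"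
          using mem[of "(True, k, l)"] mem[of "(False, k, l)"] weight_nonneg[of k]
          unfolding p_def g_def by (intro add_mono mult_left_mono) auto
        finally show ?thesis by (simp add: algebra_simps)
      qed
      ultimately show ?thesis using False w by (simp add: c_def abs_divide divide_right_mono)
    qed
    have "norm (\<Delta> - influence_map h) \<le> (\<Sum>k\<in>UNIV. norm ((\<Delta> - influence_map h) $ k))"
      unfolding norm_vec_def by (rule L2_set_le_sum) simp
    also have "\<dots> \<le> (\<Sum>k\<in>UNIV. \<Sum>l\<in>UNIV. \<bar>(\<Delta> - influence_map h) $ k $ l\<bar>)"
      by (intro sum_mono norm_le_l1_cart)
    also have "\<dots> \<le> (\<Sum>k\<in>UNIV. \<Sum>l\<in>UNIV. c k l * ?s)" by (intro sum_mono entry)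
    finally show "norm (\<Delta> - influence_map h) \<le> (\<Sum>k\<in>UNIV. \<Sum>l\<in>UNIV. c k l) * ?s"
      by (simp add: sum_distrib_right)
  qed (auto simp: bounded_linear_influence_map)
qed

end

section \<open>Sample moments\<close>

text \<open>The factor c, which will be 0 or 1, switches the fourth moments off or on without a
  change of the moment space.\<close>

definition moment_vector :: "real \<Rightarrow> real^'p \<Rightarrow> 'p::finite moments" where
  "moment_vector c v = (v, \<chi> i j. v $ i * v $ j, \<chi> i j k. v $ i * v $ j * v $ k,
     \<chi> i j k l. c * (v $ i * v $ j * v $ k * v $ l))"

definition sample_moments :: "real \<Rightarrow> nat \<Rightarrow> (nat \<Rightarrow> real^'p) \<Rightarrow> 'p::finite moments" where
  "sample_moments c n x = (1 / real n) *\<^sub>R (\<Sum>s<n. moment_vector c (x s))"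

section \<open>Empirical moments, covariances and cumulants\<close>

definition average :: "nat \<Rightarrow> (nat \<Rightarrow> real) \<Rightarrow> real" where
  "average n f = (1 / real n) * (\<Sum>s<n. f s)"

lemma average_add: "average n (\<lambda>s. f s + g s) = average n f + average n g"
  and average_diff: "average n (\<lambda>s. f s - g s) = average n f - average n g"
  and average_cmult: "average n (\<lambda>s. r * f s) = r * average n f"
  and average_cmult_right: "average n (\<lambda>s. f s * r) = average n f * r"
  by (simp_all add: average_def sum.distrib sum_subtractf sum_distrib_left[symmetric] sum_distrib_right[symmetric] algebra_simps)

lemma average_const: "n > 0 \<Longrightarrow> average n (\<lambda>s. r) = r"
  by (simp add: average_def)

lemma mom_sum:
  "mom1 (\<Sum>s\<in>A. f s) i = (\<Sum>s\<in>A. mom1 (f s) i)"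
  "mom2 (\<Sum>s\<in>A. f s) i j = (\<Sum>s\<in>A. mom2 (f s) i j)"
  "mom3 (\<Sum>s\<in>A. f s) i j k = (\<Sum>s\<in>A. mom3 (f s) i j k)"
  "mom4 (\<Sum>s\<in>A. f s) i j k l = (\<Sum>s\<in>A. mom4 (f s) i j k l)"
  by (simp_all add: mom1_def mom2_def mom3_def mom4_def fst_sum snd_sum)

lemma mom_moment_vector:
  "mom1 (moment_vector c v) i = v $ i"
  "mom2 (moment_vector c v) i j = v $ i * v $ j"
  "mom3 (moment_vector c v) i j k = v $ i * v $ j * v $ k"
  "mom4 (moment_vector c v) i j k l = c * (v $ i * v $ j * v $ k * v $ l)"
  by (simp_all add: mom1_def mom2_def mom3_def mom4_def moment_vector_def)

lemma mom_sample_moments: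
  "mom1 (sample_moments c n x) i = average n (\<lambda>s. x s $ i)"
  "mom2 (sample_moments c n x) i j = average n (\<lambda>s. x s $ i * x s $ j)"
  "mom3 (sample_moments c n x) i j k = average n (\<lambda>s. x s $ i * x s $ j * x s $ k)"
  "mom4 (sample_moments c n x) i j k l = c * average n (\<lambda>s. x s $ i * x s $ j * x s $ k * x s $ l)"
  by (simp_all add: sample_moments_def mom_linear mom_sum mom_moment_vector average_def sum_distrib_left[symmetric])

lemma symmetric_sample_moments: "symmetric_moments (sample_moments c n x)"
  by (simp add: symmetric_moments_def mom_sample_moments mult_ac)

definition centred :: "nat \<Rightarrow> (nat \<Rightarrow> real^'p) \<Rightarrow> nat \<Rightarrow> 'p::finite \<Rightarrow> real" where
  "centred n x s i = x s $ i - average n (\<lambda>s. x s $ i)"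

lemma sample_mean_component: "sample_mean n x $ i = average n (\<lambda>s. x s $ i)"
  by (simp add: sample_mean_def average_def)

lemma centred_sample_mean: "(x s - sample_mean n x) $ i = centred n x s i"
  by (simp add: centred_def sample_mean_component)

lemma cent_sample_moments:
  assumes n: "n > 0"
  shows "cent2 (sample_moments c n x) i j = average n (\<lambda>s. centred n x s i * centred n x s j)"
    and "cent3 (sample_moments c n x) i j k = average n (\<lambda>s. centred n x s i * centred n x s j * centred n x s k)"
    and "cent4 (sample_moments 1 n x) i j k l = average n (\<lambda>s. centred n x s i * centred n x s j * centred n x s k * centred n x s l)"
proof -
  let ?A = "\<lambda>i. average n (\<lambda>s. x s $ i)"
  note lin = average_add average_diff average_cmult average_cmult_right average_const[OF n]
  \<comment> \<open>The centring constants are generalised to arbitrary reals, so that the linearity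
    rules treat them as constants; the same is done for the two higher orders.\<close>
  have "average n (\<lambda>s. (x s $ i - p) * (x s $ j - q)) = average n (\<lambda>s. x s $ i * x s $ j) - p * ?A j - q * ?A i + p * q" for p q
  proof -
    have "(\<lambda>s. (x s $ i - p) * (x s $ j - q)) = (\<lambda>s. x s $ i * x s $ j - p * x s $ j - q * x s $ i + p * q)"
      by (simp add: fun_eq_iff algebra_simps)
    then show ?thesis by (simp only: lin)
  qed
  then show "cent2 (sample_moments c n x) i j = average n (\<lambda>s. centred n x s i * centred n x s j)"
    by (simp add: cent2_def mom_sample_moments centred_def)
  have "average n (\<lambda>s. (x s $ i - p) * (x s $ j - q) * (x s $ k - r)) = average n (\<lambda>s. x s $ i * x s $ j * x s $ k)
      - p * average n (\<lambda>s. x s $ j * x s $ k) - q * average n (\<lambda>s. x s $ i * x s $ k) - r * average n (\<lambda>s. x s $ i * x s $ j)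
      + p * q * ?A k + p * r * ?A j + q * r * ?A i - p * q * r" for p q r
  proof -
    have "(\<lambda>s. (x s $ i - p) * (x s $ j - q) * (x s $ k - r)) = (\<lambda>s. x s $ i * x s $ j * x s $ k
      - p * (x s $ j * x s $ k) - q * (x s $ i * x s $ k) - r * (x s $ i * x s $ j)
      + p * q * x s $ k + p * r * x s $ j + q * r * x s $ i - p * q * r)"
      by (simp add: fun_eq_iff algebra_simps)
    then show ?thesis by (simp only: lin)
  qed
  then show "cent3 (sample_moments c n x) i j k = average n (\<lambda>s. centred n x s i * centred n x s j * centred n x s k)"
    by (simp add: cent3_def mom_sample_moments centred_def)
  have "average n (\<lambda>s. (x s $ i - p) * (x s $ j - q) * (x s $ k - r) * (x s $ l - t)) = average n (\<lambda>s. x s $ i * x s $ j * x s $ k * x s $ l)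
      - p * average n (\<lambda>s. x s $ j * x s $ k * x s $ l) - q * average n (\<lambda>s. x s $ i * x s $ k * x s $ l)
      - r * average n (\<lambda>s. x s $ i * x s $ j * x s $ l) - t * average n (\<lambda>s. x s $ i * x s $ j * x s $ k)
      + p * q * average n (\<lambda>s. x s $ k * x s $ l) + p * r * average n (\<lambda>s. x s $ j * x s $ l) + p * t * average n (\<lambda>s. x s $ j * x s $ k)
      + q * r * average n (\<lambda>s. x s $ i * x s $ l) + q * t * average n (\<lambda>s. x s $ i * x s $ k) + r * t * average n (\<lambda>s. x s $ i * x s $ j)
      - p * q * r * ?A l - p * q * t * ?A k - p * r * t * ?A j - q * r * t * ?A i + p * q * r * t" for p q r t
  proof -
    have "(\<lambda>s. (x s $ i - p) * (x s $ j - q) * (x s $ k - r) * (x s $ l - t)) = (\<lambda>s. x s $ i * x s $ j * x s $ k * x s $ l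
      - p * (x s $ j * x s $ k * x s $ l) - q * (x s $ i * x s $ k * x s $ l)
      - r * (x s $ i * x s $ j * x s $ l) - t * (x s $ i * x s $ j * x s $ k)
      + p * q * (x s $ k * x s $ l) + p * r * (x s $ j * x s $ l) + p * t * (x s $ j * x s $ k)
      + q * r * (x s $ i * x s $ l) + q * t * (x s $ i * x s $ k) + r * t * (x s $ i * x s $ j)
      - p * q * r * x s $ l - p * q * t * x s $ k - p * r * t * x s $ j - q * r * t * x s $ i + p * q * r * t)"
      by (simp add: fun_eq_iff algebra_simps)
    then show ?thesis by (simp only: lin)
  qed
  then show "cent4 (sample_moments 1 n x) i j k l = average n (\<lambda>s. centred n x s i * centred n x s j * centred n x s k * centred n x s l)"
    by (simp add: cent4_def mom_sample_moments centred_def)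
qed

lemma cov_sample_moments: "n > 0 \<Longrightarrow> cov_matrix (sample_moments c n x) = sample_cov n x"
  by (simp add: cov_matrix_def sample_cov_def cent_sample_moments(1) centred_def sample_mean_component average_def)

lemma sample_cov_quadratic_form:
  "sample_cov n x *v v = (1 / real n) *\<^sub>R (\<Sum>s<n. (v \<bullet> (x s - sample_mean n x)) *\<^sub>R (x s - sample_mean n x))"
proof (subst vec_eq_iff, intro allI)
  fix i
  have "(sample_cov n x *v v) $ i = (\<Sum>j\<in>UNIV. \<Sum>s<n. (1 / real n) * ((x s - sample_mean n x) $ i * (x s - sample_mean n x) $ j) * v $ j)"
    by (simp add: sample_cov_def matrix_vector_mult_def sum_distrib_left sum_distrib_right)
  also have "\<dots> = (1 / real n) * (\<Sum>s<n. (v \<bullet> (x s - sample_mean n x)) * (x s - sample_mean n x) $ i)"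
    unfolding inner_vec_def sum_distrib_left sum_distrib_right
    by (subst sum.swap) (simp add: mult_ac)
  finally show "(sample_cov n x *v v) $ i = ((1 / real n) *\<^sub>R (\<Sum>s<n. (v \<bullet> (x s - sample_mean n x)) *\<^sub>R (x s - sample_mean n x))) $ i"
    by simp
qed

text \<open>The quadratic form at v is the average of the squared inner products of v with the
  centred observations. If it vanishes, so does the covariance applied to v, which invertibility
  excludes for nonzero v; the empty sample is excluded because its covariance is zero.\<close>

lemma invertible_sample_cov:
  fixes x :: "nat \<Rightarrow> real^'p"
  assumes inv: "invertible (sample_cov n x)"
  shows "n > 0" "sym_pos_def (sample_cov n x)"
proof -
  have inj: "v = 0" if "sample_cov n x *v v = 0" for v
  proof -
    have "matrix_inv (sample_cov n x) *v (sample_cov n x *v v) = v"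
      by (simp only: matrix_vector_mul_assoc matrix_inv_inverse(2)[OF inv] matrix_vector_mul_lid)
    then show ?thesis using that by simp
  qed
  show n: "n > 0"
  proof (rule ccontr)
    assume "\<not> n > 0"
    then have "sample_cov n x *v axis undefined 1 = 0" by (simp add: sample_cov_quadratic_form)
    from inj[OF this] show False by (simp add: axis_eq_0_iff)
  qed
  have "transpose (sample_cov n x) = sample_cov n x"
    by (simp add: sample_cov_def transpose_def mult.commute)
  moreover have "pos_def_matrix (sample_cov n x)"
    unfolding pos_def_matrix_def
  proof (intro allI impI)
    fix v :: "real^'p" assume v: "v \<noteq> 0"
    have q: "v \<bullet> (sample_cov n x *v v) = (1 / real n) * (\<Sum>s<n. (v \<bullet> (x s - sample_mean n x))\<^sup>2)"
      by (simp add: sample_cov_quadratic_form inner_sum_right power2_eq_square)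
    have "(\<Sum>s<n. (v \<bullet> (x s - sample_mean n x))\<^sup>2) \<noteq> 0"
    proof
      assume "(\<Sum>s<n. (v \<bullet> (x s - sample_mean n x))\<^sup>2) = 0"
      then have "\<forall>s<n. v \<bullet> (x s - sample_mean n x) = 0" by (simp add: sum_nonneg_eq_0_iff)
      then have "sample_cov n x *v v = 0" by (simp add: sample_cov_quadratic_form)
      then show False using inj v by blast
    qed
    moreover have "(\<Sum>s<n. (v \<bullet> (x s - sample_mean n x))\<^sup>2) \<ge> 0" by (intro sum_nonneg) simp
    ultimately show "v \<bullet> (sample_cov n x *v v) > 0" using n q by simp
  qed
  ultimately show "sym_pos_def (sample_cov n x)" by (simp add: sym_pos_def_def)
qed

lemma contract_cmult: "contract W (\<lambda>a. r * f a) i = r * contract W f i" "contract W (\<lambda>a. f a * r) i = contract W f i * r"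
  by (simp_all add: contract_def sum_distrib_left sum_distrib_right mult_ac)

lemma contract_diff: "contract W (\<lambda>a. f a - g a) i = contract W f i - contract W g i"
  by (simp add: contract_def right_diff_distrib sum_subtractf)

lemma average_contract: "average n (\<lambda>s. contract W (f s) i) = contract W (\<lambda>a. average n (\<lambda>s. f s a)) i"
proof -
  have "(\<Sum>s<n. \<Sum>a\<in>UNIV. W $ i $ a * f s a) = (\<Sum>a\<in>UNIV. W $ i $ a * (\<Sum>s<n. f s a))"
    by (subst sum.swap) (simp add: sum_distrib_left)
  then show ?thesis by (simp add: average_def contract_def sum_distrib_left mult.left_commute)
qed

lemma standardized_component:
  "standardized n x s $ i = contract (inv_sqrt_matrix (sample_cov n x)) (centred n x s) i"
proof -
  have "(\<chi> a. centred n x s a) = x s - sample_mean n x"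
    by (simp add: vec_eq_iff centred_sample_mean[symmetric])
  then show ?thesis by (simp add: standardized_def contract_matrix_vector)
qed

lemma expectation_uniform_index:
  fixes f :: "nat \<Rightarrow> real"
  shows "n > 0 \<Longrightarrow> measure_pmf.expectation (pmf_of_set {..<n}) f = average n f"
  by (subst integral_pmf_of_set) (auto simp: average_def)

text \<open>Standardised data are a contraction of centred data. By multilinearity the product of
  contractions is an iterated contraction of the product, and averaging commutes with it. Third
  cumulants do not see the fourth-order slot, so c is arbitrary here.\<close>

lemma sample_cumulant3_transform:
  assumes n: "n > 0"
  shows "sample_cumulant3 n x i $ k $ l = transform3 (inv_sqrt_matrix (sample_cov n x)) (cent3 (sample_moments c n x)) i k l"
proof -
  let ?S = "inv_sqrt_matrix (sample_cov n x)"
  have "sample_cumulant3 n x i $ k $ l = average n (\<lambda>s. contract ?S (centred n x s) i * (contract ?S (centred n x s) k * contract ?S (centred n x s) l))"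
    by (simp add: sample_cumulant3_def cumulant3_def expectation_uniform_index[OF n] standardized_component)
  also have "\<dots> = average n (\<lambda>s. contract ?S (\<lambda>a. contract ?S (\<lambda>b. contract ?S (\<lambda>d. centred n x s a * centred n x s b * centred n x s d) l) k) i)"
    by (simp add: contract_cmult mult_ac)
  also have "\<dots> = transform3 ?S (cent3 (sample_moments c n x)) i k l"
    unfolding transform3_def cent_sample_moments(2)[OF n] average_contract ..
  finally show ?thesis .
qed

lemma sample_second_moment_transform:
  assumes n: "n > 0"
  shows "average n (\<lambda>s. standardized n x s $ i * standardized n x s $ j) =
     contract (inv_sqrt_matrix (sample_cov n x)) (\<lambda>a. contract (inv_sqrt_matrix (sample_cov n x)) (cent2 (sample_moments c n x) a) j) i"
proof -
  let ?S = "inv_sqrt_matrix (sample_cov n x)"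
  have "average n (\<lambda>s. standardized n x s $ i * standardized n x s $ j) =
    average n (\<lambda>s. contract ?S (\<lambda>a. contract ?S (\<lambda>b. centred n x s a * centred n x s b) j) i)"
    by (simp add: standardized_component contract_cmult mult_ac)
  also have "\<dots> = contract ?S (\<lambda>a. contract ?S (\<lambda>b. cent2 (sample_moments c n x) a b) j) i"
    unfolding cent_sample_moments(1)[OF n] average_contract ..
  finally show ?thesis by simp
qed

lemma sample_cumulant4_transform:
  assumes n: "n > 0"
  shows "sample_cumulant4 n x i j $ k $ l = transform4 (inv_sqrt_matrix (sample_cov n x)) (cum4 (sample_moments 1 n x)) i j k l"
proof -
  let ?S = "inv_sqrt_matrix (sample_cov n x)" and ?m = "sample_moments 1 n x" and ?y = "standardized n x"
  let ?P = "\<lambda>i j. contract ?S (\<lambda>a. contract ?S (cent2 ?m a) j) i"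
  have "average n (\<lambda>s. ?y s $ i * ?y s $ j * (?y s $ k * ?y s $ l)) =
    average n (\<lambda>s. contract ?S (\<lambda>a. contract ?S (\<lambda>b. contract ?S (\<lambda>d. contract ?S (\<lambda>e. centred n x s a * centred n x s b * centred n x s d * centred n x s e) l) k) j) i)"
    by (simp add: standardized_component contract_cmult mult_ac)
  also have "\<dots> = transform4 ?S (cent4 ?m) i j k l"
    unfolding transform4_def transform3_def cent_sample_moments(3)[OF n] average_contract ..
  finally have 1: "average n (\<lambda>s. ?y s $ i * ?y s $ j * (?y s $ k * ?y s $ l)) = transform4 ?S (cent4 ?m) i j k l" .
  have 2: "transform4 ?S (cum4 ?m) i j k l = transform4 ?S (cent4 ?m) i j k l - ?P i j * ?P k l - ?P i k * ?P j l - ?P j k * ?P i l"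
    unfolding transform4_def transform3_def cum4_def[abs_def] by (simp add: contract_diff contract_cmult)
  have "sample_cumulant4 n x i j $ k $ l = average n (\<lambda>s. ?y s $ i * ?y s $ j * (?y s $ k * ?y s $ l))
     - ?P i j * ?P k l - ?P i k * ?P j l - ?P j k * ?P i l"
    by (simp add: sample_cumulant4_def cumulant4_def expectation_uniform_index[OF n] sample_second_moment_transform[OF n, of x _ _ 1])
  then show ?thesis by (simp only: 1 2)
qed

text \<open>If c differs from 1, the fourth-order parts of both sides disagree in general, but then
  alpha = 1 and they are multiplied by 0.\<close>

lemma cumulant_objective_eq:
  assumes n: "n > 0" and U: "orthogonal_matrix U" and c: "\<alpha> = 1 \<or> c = 1"
  shows "cumulant_objective \<alpha> n x U = objective \<alpha> (1 - \<alpha>) (U ** inv_sqrt_matrix (sample_cov n x)) (sample_moments c n x)"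
proof -
  have "(\<lambda>k l. sample_cumulant3 n x i $ k $ l) = transform3 (inv_sqrt_matrix (sample_cov n x)) (cent3 (sample_moments c n x)) i" for i
    by (intro ext sample_cumulant3_transform n)
  moreover have "(\<lambda>k l. sample_cumulant4 n x i j $ k $ l) = transform4 (inv_sqrt_matrix (sample_cov n x)) (cum4 (sample_moments 1 n x)) i j" for i j
    by (intro ext sample_cumulant4_transform n)
  ultimately show ?thesis
    using c unfolding objective_rotate[OF U] cumulant_objective_def norm_diag_congruence by auto
qed

lemma borel_measurable_moment_vector [measurable]: "(moment_vector c :: real^'p \<Rightarrow> 'p::finite moments) \<in> borel_measurable borel"
  unfolding moment_vector_def by (intro borel_measurable_continuous_onI continuous_intros)

lemma all_cumulant_estimate_selection:
  fixes sel :: "'p::finite moments \<Rightarrow> real^'p^'p"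
  assumes meas: "sel \<in> borel_measurable borel" and sel: "rotation_selection \<alpha> (1 - \<alpha>) sel" and c: "\<alpha> = 1 \<or> c = 1"
  shows "all_cumulant_estimate \<alpha> n (\<lambda>x. sel (sample_moments c n x) ** whitener (sample_moments c n x))"
  unfolding all_cumulant_estimate_def
proof (intro conjI ballI impI)
  have [measurable]: "sel \<in> borel_measurable borel" by fact
  have [measurable]: "sample_moments c n \<in> borel_measurable (Pi\<^sub>M {..<n} (\<lambda>_. borel :: (real^'p) measure))"
  proof -
    have "(\<lambda>x. moment_vector c (x s)) \<in> borel_measurable (Pi\<^sub>M {..<n} (\<lambda>_. borel :: (real^'p) measure))" if "s \<in> {..<n}" for s
      using that by measurable
    then show ?thesis unfolding sample_moments_def[abs_def]
      by (intro borel_measurable_scaleR borel_measurable_sum) auto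
  qed
  show "(\<lambda>x. sel (sample_moments c n x) ** whitener (sample_moments c n x)) \<in> borel_measurable (Pi\<^sub>M {..<n} (\<lambda>_. borel))"
    by measurable
  fix x :: "nat \<Rightarrow> real^'p" assume "invertible (sample_cov n x)"
  note inv = invertible_sample_cov[OF this]
  let ?m = "sample_moments c n x"
  have w: "whitener ?m = inv_sqrt_matrix (sample_cov n x)"
    using inv by (simp add: whitener_def cov_sample_moments)
  have "is_arg_max (cumulant_objective \<alpha> n x) orthogonal_matrix (sel ?m)"
    unfolding is_arg_max_linorder
  proof (intro conjI allI impI)
    show o: "orthogonal_matrix (sel ?m)" using sel unfolding rotation_selection_def by blast
    fix U :: "real^'p^'p" assume U: "orthogonal_matrix U"
    have "objective \<alpha> (1 - \<alpha>) (U ** whitener ?m) ?m \<le> objective \<alpha> (1 - \<alpha>) (sel ?m ** whitener ?m) ?m"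
      using sel U unfolding rotation_selection_def by blast
    then show "cumulant_objective \<alpha> n x U \<le> cumulant_objective \<alpha> n x (sel ?m)"
      by (simp only: cumulant_objective_eq[OF inv(1) U c] cumulant_objective_eq[OF inv(1) o c] w)
  qed
  then show "all_cumulant_solution \<alpha> n x (sel ?m ** whitener ?m)"
    unfolding all_cumulant_solution_def w by blast
qed

section \<open>Population moments and asymptotic variances\<close>

lemma mom_diff:
  "mom1 (x - y) i = mom1 x i - mom1 y i" "mom2 (x - y) i j = mom2 x i j - mom2 y i j"
  "mom3 (x - y) i j k = mom3 x i j k - mom3 y i j k" "mom4 (x - y) i j k l = mom4 x i j k l - mom4 y i j k l"
  by (simp_all add: mom1_def mom2_def mom3_def mom4_def)

text \<open>A monomial is given by its list of indices. Collecting equal indices makes it a product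
  of powers of distinct components, to which independence applies.\<close>

lemma prod_list_map_count:
  fixes v :: "'p::finite \<Rightarrow> real"
  shows "prod_list (map v is) = (\<Prod>a\<in>UNIV. v a ^ count_list is a)"
proof (induction "is")
  case (Cons i "is")
  have "v a ^ count_list (i # is) a = (if i = a then v i else 1) * v a ^ count_list is a" for a by simp
  then show ?case by (simp only: prod.distrib) (simp add: Cons)
qed simp

lemma abs_power_le_one_plus: "j \<le> r \<Longrightarrow> \<bar>x\<bar> ^ j \<le> 1 + \<bar>x :: real\<bar> ^ r"
proof (cases "\<bar>x\<bar> \<le> 1")
  case True
  then have "\<bar>x\<bar> ^ j \<le> 1" by (simp add: power_le_one)
  then show ?thesis by (simp add: add_increasing2)
next
  case False
  moreover assume "j \<le> r"
  ultimately have "\<bar>x\<bar> ^ j \<le> \<bar>x\<bar> ^ r" by (intro power_increasing) auto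
  then show ?thesis by simp
qed

lemma integrable_power_mono:
  assumes "prob_space N" and X: "X \<in> borel_measurable N"
    and int: "integrable N (\<lambda>\<omega>. (X \<omega> :: real) ^ r)" and j: "j \<le> r" "even r"
  shows "integrable N (\<lambda>\<omega>. X \<omega> ^ j)"
proof (rule Bochner_Integration.integrable_bound[where f = "\<lambda>\<omega>. 1 + X \<omega> ^ r"])
  interpret prob_space N by fact
  show "integrable N (\<lambda>\<omega>. 1 + X \<omega> ^ r)" using int by simp
  have "\<bar>x ^ j\<bar> \<le> \<bar>1 + x ^ r\<bar>" for x :: real
    using abs_power_le_one_plus[OF j(1), of x] j(2) unfolding power_abs power_even_abs[OF j(2)]
    by (meson abs_ge_self order_trans)
  then show "AE \<omega> in N. norm (X \<omega> ^ j) \<le> norm (1 + X \<omega> ^ r)" by simp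
qed (use X in auto)

locale independent_components = prob_space N for N :: "'b measure" +
  fixes z :: "'b \<Rightarrow> real^'p"
  assumes z_meas [measurable]: "z \<in> borel_measurable N"
    and indep: "indep_vars (\<lambda>_. borel) (\<lambda>k \<omega>. z \<omega> $ k) UNIV"
    and mean: "\<And>k. expectation (\<lambda>\<omega>. z \<omega> $ k) = 0"
    and var: "\<And>k. variance (\<lambda>\<omega>. z \<omega> $ k) = 1"
    and int6: "\<And>k. integrable N (\<lambda>\<omega>. z \<omega> $ k ^ 6)"
begin

definition pmom :: "nat \<Rightarrow> 'p \<Rightarrow> real" where "pmom j k = (\<integral>\<omega>. z \<omega> $ k ^ j \<partial>N)"

lemma component_meas [measurable]: "(\<lambda>\<omega>. z \<omega> $ k) \<in> borel_measurable N"
  using indep unfolding indep_vars_def by auto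

lemma integrable_power: "j \<le> 6 \<Longrightarrow> integrable N (\<lambda>\<omega>. z \<omega> $ k ^ j)"
  using integrable_power_mono[OF prob_space_axioms component_meas int6] by simp

lemma pmom_small: "pmom 0 k = 1" "pmom (Suc 0) k = 0" "pmom 1 k = 0" "pmom 2 k = 1"
  using mean[of k] var[of k] by (simp_all add: pmom_def prob_space)

lemma list_moment:
  assumes "length is \<le> 6"
  shows "integrable N (\<lambda>\<omega>. prod_list (map (($) (z \<omega>)) is))"
    and "(\<integral>\<omega>. prod_list (map (($) (z \<omega>)) is) \<partial>N) = (\<Prod>a\<in>UNIV. pmom (count_list is a) a)"
proof -
  have ind: "indep_vars (\<lambda>_. borel) (\<lambda>a \<omega>. z \<omega> $ a ^ count_list is a) UNIV"
    using indep by (rule indep_vars_compose2) auto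
  have int: "integrable N (\<lambda>\<omega>. z \<omega> $ a ^ count_list is a)" for a
    using count_le_length[of "is" a] assms by (intro integrable_power) simp
  show "integrable N (\<lambda>\<omega>. prod_list (map (($) (z \<omega>)) is))"
    unfolding prod_list_map_count by (rule indep_vars_integrable[OF _ ind int]) auto
  show "(\<integral>\<omega>. prod_list (map (($) (z \<omega>)) is) \<partial>N) = (\<Prod>a\<in>UNIV. pmom (count_list is a) a)"
    unfolding prod_list_map_count pmom_def by (rule indep_vars_lebesgue_integral[OF _ ind int]) auto
qed

lemma list_moment_single:
  assumes "length is \<le> 6" "count_list is i = 1"
  shows "(\<integral>\<omega>. prod_list (map (($) (z \<omega>)) is) \<partial>N) = 0"
  unfolding list_moment(2)[OF assms(1)]
  by (rule prod_zero) (use assms(2) pmom_small in \<open>auto intro!: exI[of _ i]\<close>)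

lemma list_moment_pairs:
  assumes "length is \<le> 6" "\<And>i. count_list is i = 0 \<or> count_list is i = 2"
  shows "(\<integral>\<omega>. prod_list (map (($) (z \<omega>)) is) \<partial>N) = 1"
  unfolding list_moment(2)[OF assms(1)]
proof (rule prod.neutral, rule ballI)
  fix i show "pmom (count_list is i) i = 1" using assms(2)[of i] pmom_small by auto
qed

lemma moment2: "(\<integral>\<omega>. z \<omega> $ i * z \<omega> $ j \<partial>N) = (if i = j then 1 else 0)"
proof (cases "i = j")
  case True
  then show ?thesis using pmom_small(4)[of j] by (simp add: pmom_def power2_eq_square)
next
  case False
  then show ?thesis using list_moment_single[of "[i, j]" i] by simp
qed

lemma moment3: "(\<integral>\<omega>. z \<omega> $ i * z \<omega> $ j * z \<omega> $ k \<partial>N) = (if i = j \<and> j = k then pmom 3 i else 0)"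
proof -
  have single: "(\<integral>\<omega>. z \<omega> $ i * z \<omega> $ j * z \<omega> $ k \<partial>N) = 0" if "count_list [i, j, k] s = 1" for s
    using list_moment_single[OF _ that] by (simp add: mult.assoc)
  consider "i = j \<and> j = k" | "i = j \<and> j \<noteq> k" | "i \<noteq> j \<and> i = k" | "i \<noteq> j \<and> i \<noteq> k" by blast
  then show ?thesis
  proof cases
    case 1
    then show ?thesis by (simp add: pmom_def power3_eq_cube)
  next
    case 2
    then have c: "count_list [i, j, k] k = 1" by auto
    show ?thesis unfolding single[OF c] by (rule if_not_P[symmetric]) (use 2 in blast)
  next
    case 3
    then have c: "count_list [i, j, k] j = 1" by auto
    show ?thesis unfolding single[OF c] by (rule if_not_P[symmetric]) (use 3 in blast)
  next
    case 4
    then have c: "count_list [i, j, k] i = 1" by auto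
    show ?thesis unfolding single[OF c] by (rule if_not_P[symmetric]) (use 4 in blast)
  qed
qed

text \<open>The last three summands form the Gaussian moment. They are exactly what the fourth
  cumulant subtracts, leaving the excess kurtosis on the diagonal.\<close>

lemma moment4: "(\<integral>\<omega>. z \<omega> $ i * z \<omega> $ j * z \<omega> $ k * z \<omega> $ l \<partial>N) =
   (if i = j \<and> j = k \<and> k = l then pmom 4 i - 3 else 0)
     + (if i = j \<and> k = l then 1 else 0) + (if i = k \<and> j = l then 1 else 0) + (if j = k \<and> i = l then 1 else 0)"
proof -
  have single: "(\<integral>\<omega>. z \<omega> $ i * z \<omega> $ j * z \<omega> $ k * z \<omega> $ l \<partial>N) = 0" if "count_list [i, j, k, l] s = 1" for s
    using list_moment_single[OF _ that] by (simp add: mult.assoc)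
  have pairs: "(\<integral>\<omega>. z \<omega> $ i * z \<omega> $ j * z \<omega> $ k * z \<omega> $ l \<partial>N) = 1"
    if "\<And>s. count_list [i, j, k, l] s = 0 \<or> count_list [i, j, k, l] s = 2"
    using list_moment_pairs[OF _ that] by (simp add: mult.assoc)
  \<comment> \<open>All four indices agree, or they split into two distinct pairs, or some index
    occurs exactly once and annihilates the moment.\<close>
  consider "i = j \<and> j = k \<and> k = l" | "i = j \<and> k = l \<and> i \<noteq> k" | "i = k \<and> j = l \<and> i \<noteq> j" | "i = l \<and> j = k \<and> i \<noteq> j"
    | "i \<noteq> j \<and> i \<noteq> k \<and> i \<noteq> l" | "j \<noteq> i \<and> j \<noteq> k \<and> j \<noteq> l" | "k \<noteq> i \<and> k \<noteq> j \<and> k \<noteq> l" | "l \<noteq> i \<and> l \<noteq> j \<and> l \<noteq> k"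
    by metis
  then show ?thesis
  proof cases
    case 1
    then show ?thesis by (simp add: pmom_def power4_eq_xxxx)
  next
    case 2
    then have c: "count_list [i, j, k, l] s = 0 \<or> count_list [i, j, k, l] s = 2" for s by auto
    have "i = j \<and> j = k \<and> k = l \<longleftrightarrow> False" "i = j \<and> k = l \<longleftrightarrow> True"
      "i = k \<and> j = l \<longleftrightarrow> False" "j = k \<and> i = l \<longleftrightarrow> False"
      using 2 by blast+
    then show ?thesis unfolding pairs[OF c] by (simp only: if_True if_False add_0_left add_0_right)
  next
    case 3
    then have c: "count_list [i, j, k, l] s = 0 \<or> count_list [i, j, k, l] s = 2" for s by auto
    have "i = j \<and> j = k \<and> k = l \<longleftrightarrow> False" "i = j \<and> k = l \<longleftrightarrow> False"
      "i = k \<and> j = l \<longleftrightarrow> True" "j = k \<and> i = l \<longleftrightarrow> False"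
      using 3 by blast+
    then show ?thesis unfolding pairs[OF c] by (simp only: if_True if_False add_0_left add_0_right)
  next
    case 4
    then have c: "count_list [i, j, k, l] s = 0 \<or> count_list [i, j, k, l] s = 2" for s by auto
    have "i = j \<and> j = k \<and> k = l \<longleftrightarrow> False" "i = j \<and> k = l \<longleftrightarrow> False"
      "i = k \<and> j = l \<longleftrightarrow> False" "j = k \<and> i = l \<longleftrightarrow> True"
      using 4 by blast+
    then show ?thesis unfolding pairs[OF c] by (simp only: if_True if_False add_0_left add_0_right)
  next
    case 5
    then have c: "count_list [i, j, k, l] i = 1" by auto
    have "i = j \<and> j = k \<and> k = l \<longleftrightarrow> False" "i = j \<and> k = l \<longleftrightarrow> False"
      "i = k \<and> j = l \<longleftrightarrow> False" "j = k \<and> i = l \<longleftrightarrow> False"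
      using 5 by blast+
    then show ?thesis unfolding single[OF c] by (simp only: if_True if_False add_0_left add_0_right)
  next
    case 6
    then have c: "count_list [i, j, k, l] j = 1" by auto
    have "i = j \<and> j = k \<and> k = l \<longleftrightarrow> False" "i = j \<and> k = l \<longleftrightarrow> False"
      "i = k \<and> j = l \<longleftrightarrow> False" "j = k \<and> i = l \<longleftrightarrow> False"
      using 6 by blast+
    then show ?thesis unfolding single[OF c] by (simp only: if_True if_False add_0_left add_0_right)
  next
    case 7
    then have c: "count_list [i, j, k, l] k = 1" by auto
    have "i = j \<and> j = k \<and> k = l \<longleftrightarrow> False" "i = j \<and> k = l \<longleftrightarrow> False"
      "i = k \<and> j = l \<longleftrightarrow> False" "j = k \<and> i = l \<longleftrightarrow> False"
      using 7 by blast+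
    then show ?thesis unfolding single[OF c] by (simp only: if_True if_False add_0_left add_0_right)
  next
    case 8
    then have c: "count_list [i, j, k, l] l = 1" by auto
    have "i = j \<and> j = k \<and> k = l \<longleftrightarrow> False" "i = j \<and> k = l \<longleftrightarrow> False"
      "i = k \<and> j = l \<longleftrightarrow> False" "j = k \<and> i = l \<longleftrightarrow> False"
      using 8 by blast+
    then show ?thesis unfolding single[OF c] by (simp only: if_True if_False add_0_left add_0_right)
  qed
qed

lemma independent_pair:
  assumes kl: "k \<noteq> l" and [measurable]: "f \<in> borel_measurable borel" "g \<in> borel_measurable borel"
    and f: "integrable N (\<lambda>\<omega>. f (z \<omega> $ k))" and g: "integrable N (\<lambda>\<omega>. g (z \<omega> $ l))"
  shows "integrable N (\<lambda>\<omega>. f (z \<omega> $ k) * g (z \<omega> $ l) :: real)"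
    and "(\<integral>\<omega>. f (z \<omega> $ k) * g (z \<omega> $ l) \<partial>N) = (\<integral>\<omega>. f (z \<omega> $ k) \<partial>N) * (\<integral>\<omega>. g (z \<omega> $ l) \<partial>N)"
proof -
  define X where "X i \<omega> = (if i = k then f (z \<omega> $ i) else g (z \<omega> $ i))" for i \<omega>
  have "indep_vars (\<lambda>_. borel) (\<lambda>k \<omega>. z \<omega> $ k) {k, l}" by (rule indep_vars_subset[OF indep]) simp
  then have "indep_vars (\<lambda>_. borel) (\<lambda>i \<omega>. (if i = k then f else g) (z \<omega> $ i)) {k, l}"
    by (rule indep_vars_compose2) auto
  moreover have "(\<lambda>i \<omega>. (if i = k then f else g) (z \<omega> $ i)) = X" by (auto simp: X_def fun_eq_iff)
  ultimately have ind: "indep_vars (\<lambda>_. borel) X {k, l}" by simp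
  have int: "integrable N (X i)" if "i \<in> {k, l}" for i
    using that kl f g by (auto simp: X_def[abs_def])
  have pr: "(\<Prod>i\<in>{k, l}. X i \<omega>) = f (z \<omega> $ k) * g (z \<omega> $ l)" for \<omega>
    using kl by (simp add: X_def)
  show "integrable N (\<lambda>\<omega>. f (z \<omega> $ k) * g (z \<omega> $ l))"
    using indep_vars_integrable[OF _ ind int] unfolding pr by simp
  have "(\<Prod>i\<in>{k, l}. \<integral>\<omega>. X i \<omega> \<partial>N) = (\<integral>\<omega>. f (z \<omega> $ k) \<partial>N) * (\<integral>\<omega>. g (z \<omega> $ l) \<partial>N)"
    using kl by (simp add: X_def)
  then show "(\<integral>\<omega>. f (z \<omega> $ k) * g (z \<omega> $ l) \<partial>N) = (\<integral>\<omega>. f (z \<omega> $ k) \<partial>N) * (\<integral>\<omega>. g (z \<omega> $ l) \<partial>N)"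
    using indep_vars_lebesgue_integral[OF _ ind int] unfolding pr by simp
qed

lemma sextic_expectation:
  fixes f :: "real \<Rightarrow> real"
  assumes f: "\<And>x. f x = c0 + c1 * x + c2 * x ^ 2 + c3 * x ^ 3 + c4 * x ^ 4 + c5 * x ^ 5 + c6 * x ^ 6"
  shows "integrable N (\<lambda>\<omega>. f (z \<omega> $ k))"
    and "(\<integral>\<omega>. f (z \<omega> $ k) \<partial>N) = c0 + c2 + c3 * pmom 3 k + c4 * pmom 4 k + c5 * pmom 5 k + c6 * pmom 6 k"
    and "f \<in> borel_measurable borel"
proof -
  have i1: "integrable N (\<lambda>\<omega>. z \<omega> $ k)" using integrable_power[of 1] by simp
  note i = i1 integrable_power[of 2] integrable_power[of 3] integrable_power[of 4] integrable_power[of 5] integrable_power[of 6]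
  show "integrable N (\<lambda>\<omega>. f (z \<omega> $ k))" unfolding f using i by simp
  have "(\<integral>\<omega>. f (z \<omega> $ k) \<partial>N) = c0 + c1 * pmom 1 k + c2 * pmom 2 k + c3 * pmom 3 k + c4 * pmom 4 k + c5 * pmom 5 k + c6 * pmom 6 k"
    unfolding f pmom_def using i by (simp add: prob_space)
  then show "(\<integral>\<omega>. f (z \<omega> $ k) \<partial>N) = c0 + c2 + c3 * pmom 3 k + c4 * pmom 4 k + c5 * pmom 5 k + c6 * pmom 6 k"
    by (simp add: pmom_small)
  show "f \<in> borel_measurable borel" unfolding f[abs_def] by measurable
qed

text \<open>The nonlinearity of the influence function: off the diagonal, the influence of an
  observation is score_k(z_k) z_l - score_l(z_l) z_k - w_k z_k z_l, divided by w_k + w_l. The terms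
  -1 and \<open>- pmom 3 k\<close> come from estimating the mean, \<open>- 3 * x\<close> from the
  covariance products in the fourth cumulant.\<close>

definition score :: "real \<Rightarrow> real \<Rightarrow> 'p \<Rightarrow> real \<Rightarrow> real" where
  "score a b k x = a * pmom 3 k * (x\<^sup>2 - 1) + b * (pmom 4 k - 3) * (x ^ 3 - pmom 3 k - 3 * x)"

lemma score_expectation:
  fixes a b :: real
  defines "p \<equiv> \<lambda>k. a * pmom 3 k" and "q \<equiv> \<lambda>k. b * (pmom 4 k - 3)"
  shows "integrable N (\<lambda>\<omega>. score a b k (z \<omega> $ k) * z \<omega> $ k)" "integrable N (\<lambda>\<omega>. (score a b k (z \<omega> $ k))\<^sup>2)"
    "(\<integral>\<omega>. score a b k (z \<omega> $ k) * z \<omega> $ k \<partial>N) = p k * pmom 3 k + q k * (pmom 4 k - 3)"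
    "(\<integral>\<omega>. (score a b k (z \<omega> $ k))\<^sup>2 \<partial>N) = (p k)\<^sup>2 * (pmom 4 k - 1)
       + (q k)\<^sup>2 * (pmom 6 k - (pmom 3 k)\<^sup>2 + 9 - 6 * pmom 4 k) + 2 * p k * q k * (pmom 5 k - 4 * pmom 3 k)"
    "score a b k \<in> borel_measurable borel"
proof -
  let ?g = "pmom 3 k"
  have 1: "score a b k x * x = 0 + (- p k - q k * ?g) * x + (- 3 * q k) * x ^ 2 + p k * x ^ 3 + q k * x ^ 4 + 0 * x ^ 5 + 0 * x ^ 6" for x
    unfolding score_def p_def q_def by algebra
  have 2: "(score a b k x)\<^sup>2 = ((p k)\<^sup>2 + (q k)\<^sup>2 * ?g\<^sup>2 + 2 * p k * q k * ?g) + (6 * (q k)\<^sup>2 * ?g + 6 * p k * q k) * x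
     + (- 2 * (p k)\<^sup>2 + 9 * (q k)\<^sup>2 - 2 * p k * q k * ?g) * x ^ 2 + (- 2 * (q k)\<^sup>2 * ?g - 8 * p k * q k) * x ^ 3
     + ((p k)\<^sup>2 - 6 * (q k)\<^sup>2) * x ^ 4 + (2 * p k * q k) * x ^ 5 + (q k)\<^sup>2 * x ^ 6" for x
    unfolding score_def p_def q_def by algebra
  show "integrable N (\<lambda>\<omega>. score a b k (z \<omega> $ k) * z \<omega> $ k)" by (rule sextic_expectation(1)[OF 1])
  show "integrable N (\<lambda>\<omega>. (score a b k (z \<omega> $ k))\<^sup>2)" by (rule sextic_expectation(1)[OF 2])
  show "(\<integral>\<omega>. score a b k (z \<omega> $ k) * z \<omega> $ k \<partial>N) = p k * pmom 3 k + q k * (pmom 4 k - 3)"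
    unfolding sextic_expectation(2)[OF 1] by (simp add: algebra_simps)
  show "(\<integral>\<omega>. (score a b k (z \<omega> $ k))\<^sup>2 \<partial>N) = (p k)\<^sup>2 * (pmom 4 k - 1)
       + (q k)\<^sup>2 * (pmom 6 k - (pmom 3 k)\<^sup>2 + 9 - 6 * pmom 4 k) + 2 * p k * q k * (pmom 5 k - 4 * pmom 3 k)"
    unfolding sextic_expectation(2)[OF 2] by (simp add: algebra_simps power2_eq_square)
  show "score a b k \<in> borel_measurable borel" unfolding score_def[abs_def] by measurable
qed

text \<open>The expectation of score_i(z_i) z_i is w_i. By independence the mixed terms of the
  square contribute -2 w_k w_l, -2 w_k^2 and 2 w_k w_l, and the last square contributes w_k^2; what
  remains besides the two score variances is - w_k^2.\<close>

lemma influence_variance: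
  fixes a b :: real
  assumes kl: "k \<noteq> l"
  defines "w \<equiv> \<lambda>k. a * (pmom 3 k)\<^sup>2 + b * (pmom 4 k - 3)\<^sup>2"
  shows "(\<integral>\<omega>. (score a b k (z \<omega> $ k) * z \<omega> $ l - score a b l (z \<omega> $ l) * z \<omega> $ k - w k * (z \<omega> $ k * z \<omega> $ l))\<^sup>2 \<partial>N)
    = (\<integral>\<omega>. (score a b k (z \<omega> $ k))\<^sup>2 \<partial>N) + (\<integral>\<omega>. (score a b l (z \<omega> $ l))\<^sup>2 \<partial>N) - (w k)\<^sup>2"
proof -
  let ?A = "score a b k" and ?B = "score a b l"
  note [measurable] = score_expectation(5)
  have w: "(\<integral>\<omega>. score a b i (z \<omega> $ i) * z \<omega> $ i \<partial>N) = w i" for i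
    unfolding score_expectation(3) w_def by (simp add: power2_eq_square)
  have s: "integrable N (\<lambda>\<omega>. (z \<omega> $ i)\<^sup>2)" "(\<integral>\<omega>. (z \<omega> $ i)\<^sup>2 \<partial>N) = 1" for i
    using integrable_power[of 2 i] pmom_small(4)[of i] by (simp_all add: pmom_def)
  have m2: "(\<lambda>x::real. x\<^sup>2) \<in> borel_measurable borel" and mA: "(\<lambda>x. (score a b i x)\<^sup>2) \<in> borel_measurable borel"
    and mAx: "(\<lambda>x. score a b i x * x) \<in> borel_measurable borel" for i
    by measurable
  note t1 = independent_pair[OF kl mA m2 score_expectation(2) s(1)]
  note t2 = independent_pair[OF kl m2 mA s(1) score_expectation(2)]
  note t3 = independent_pair[OF kl m2 m2 s(1) s(1)]
  note t4 = independent_pair[OF kl mAx mAx score_expectation(1) score_expectation(1)]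
  note t5 = independent_pair[OF kl mAx m2 score_expectation(1) s(1)]
  note t6 = independent_pair[OF kl m2 mAx s(1) score_expectation(1)]
  have square: "(?A (z \<omega> $ k) * z \<omega> $ l - ?B (z \<omega> $ l) * z \<omega> $ k - w k * (z \<omega> $ k * z \<omega> $ l))\<^sup>2 =
      (?A (z \<omega> $ k))\<^sup>2 * (z \<omega> $ l)\<^sup>2 + (z \<omega> $ k)\<^sup>2 * (?B (z \<omega> $ l))\<^sup>2 + (w k)\<^sup>2 * ((z \<omega> $ k)\<^sup>2 * (z \<omega> $ l)\<^sup>2)
      - 2 * ((?A (z \<omega> $ k) * z \<omega> $ k) * (?B (z \<omega> $ l) * z \<omega> $ l))
      - (2 * w k) * ((?A (z \<omega> $ k) * z \<omega> $ k) * (z \<omega> $ l)\<^sup>2)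
      + (2 * w k) * ((z \<omega> $ k)\<^sup>2 * (?B (z \<omega> $ l) * z \<omega> $ l))" for \<omega>
    by algebra
  have "(\<integral>\<omega>. (?A (z \<omega> $ k) * z \<omega> $ l - ?B (z \<omega> $ l) * z \<omega> $ k - w k * (z \<omega> $ k * z \<omega> $ l))\<^sup>2 \<partial>N)
    = (\<integral>\<omega>. (?A (z \<omega> $ k))\<^sup>2 \<partial>N) + (\<integral>\<omega>. (?B (z \<omega> $ l))\<^sup>2 \<partial>N) + (w k)\<^sup>2 - 2 * (w k * w l) - (2 * w k) * w k + (2 * w k) * w l"
    unfolding square
    by (subst Bochner_Integration.integral_add Bochner_Integration.integral_diff
        | simp only: t1 t2 t3 t4 t5 t6 w s integrable_mult_right integral_mult_right_zero
            Bochner_Integration.integrable_add Bochner_Integration.integrable_diff mult_1_left mult_1_right)+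
  then show ?thesis by (simp add: power2_eq_square)
qed

end

section \<open>Integrability, variances and the limit theorem\<close>

lemma linear_vec_matrix: "linear (vec_matrix :: real^'p^'q \<Rightarrow> real^('q \<times> 'p))"
  by (intro linearI) (simp_all add: vec_matrix_def vec_eq_iff)

text \<open>The moment vector is square integrable if each component has moments of twice the order
  in question: these bounds reduce mixed squares to powers of single components.\<close>

lemma prod_le_sum_powers:
  fixes x y u v :: real
  shows "(x * y)\<^sup>2 \<le> x ^ 4 + y ^ 4" "(x * y * u)\<^sup>2 \<le> x ^ 6 + y ^ 6 + u ^ 6" "(x * y * u * v)\<^sup>2 \<le> x ^ 8 + y ^ 8 + u ^ 8 + v ^ 8"
proof -
  have 2: "(s * t)\<^sup>2 \<le> s ^ 4 + t ^ 4" for s t :: real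
  proof -
    have "0 \<le> (s\<^sup>2 - t\<^sup>2)\<^sup>2 + s ^ 4 + t ^ 4" by simp
    then show ?thesis by (simp add: power2_diff power_mult_distrib flip: power_mult)
  qed
  show "(x * y)\<^sup>2 \<le> x ^ 4 + y ^ 4" by (rule 2)
  have 3: "A * B * C \<le> A ^ 3 + B ^ 3 + C ^ 3" if "A \<ge> 0" "B \<ge> 0" "C \<ge> 0" for A B C :: real
  proof -
    define m where "m = max A (max B C)"
    have "A * B * C \<le> m * m * m" using that by (intro mult_mono) (auto simp: m_def)
    also have "m * m * m = m ^ 3" by (simp add: power3_eq_cube)
    also have "m ^ 3 \<le> A ^ 3 + B ^ 3 + C ^ 3"
      using that by (auto simp: m_def max_def)
    finally show ?thesis .
  qed
  show "(x * y * u)\<^sup>2 \<le> x ^ 6 + y ^ 6 + u ^ 6"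
    using 3[of "x\<^sup>2" "y\<^sup>2" "u\<^sup>2"] by (simp add: power_mult_distrib flip: power_mult)
  have "(x * y * u * v)\<^sup>2 = ((x * y) * (u * v))\<^sup>2" by (simp add: mult.assoc)
  also have "\<dots> \<le> (x * y) ^ 4 + (u * v) ^ 4" by (rule 2)
  also have "\<dots> = (x\<^sup>2 * y\<^sup>2)\<^sup>2 + (u\<^sup>2 * v\<^sup>2)\<^sup>2"
    by (simp add: power_mult_distrib flip: power_mult)
  also have "\<dots> \<le> ((x\<^sup>2) ^ 4 + (y\<^sup>2) ^ 4) + ((u\<^sup>2) ^ 4 + (v\<^sup>2) ^ 4)"
    by (intro add_mono 2)
  finally show "(x * y * u * v)\<^sup>2 \<le> x ^ 8 + y ^ 8 + u ^ 8 + v ^ 8" by (simp flip: power_mult)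
qed

lemma bounded_linear_mom:
  "bounded_linear (\<lambda>m. mom1 m i)" "bounded_linear (\<lambda>m. mom2 m i j)"
  "bounded_linear (\<lambda>m. mom3 m i j k)" "bounded_linear (\<lambda>m. mom4 m i j k l)"
  unfolding linear_conv_bounded_linear[symmetric] by (intro linearI; simp add: mom_linear)+

context independent_components
begin

definition asv :: "real \<Rightarrow> 'p \<Rightarrow> 'p \<Rightarrow> real" where
  "asv \<alpha> k l = (if k = l then (m_kappa N z k + 2) / 4
     else (\<alpha>\<^sup>2 * zeta11 N z k l + (1 - \<alpha>)\<^sup>2 * zeta22 N z k l + 2 * \<alpha> * (1 - \<alpha>) * zeta12 N z k l)
       / (\<alpha> * ((m_gamma N z k)\<^sup>2 + (m_gamma N z l)\<^sup>2) + (1 - \<alpha>) * ((m_kappa N z k)\<^sup>2 + (m_kappa N z l)\<^sup>2))\<^sup>2)"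

lemma m_gamma_pmom: "m_gamma N z k = pmom 3 k"
  and m_kappa_pmom: "m_kappa N z k = pmom 4 k - 3"
  by (simp_all add: m_gamma_def m_kappa_def m_beta_def pmom_def)

text \<open>Since kappa = beta - 3, beta^2 = kappa^2 + 6 beta - 9, so omega - beta^2 is the
  coefficient omega + 9 - 6 beta of the score variance less kappa^2. The terms gamma_l^4, kappa_l^4
  and gamma_l^2 kappa_l^2 of the zetas restore what this removes for l; for k the removed terms add
  up to the square of the weight. The skewness and mixed terms work alike.\<close>

lemma score_variance_zeta:
  fixes \<alpha> :: real
  defines "w \<equiv> \<lambda>k. \<alpha> * (pmom 3 k)\<^sup>2 + (1 - \<alpha>) * (pmom 4 k - 3)\<^sup>2"
  shows "(\<integral>\<omega>. (score \<alpha> (1 - \<alpha>) k (z \<omega> $ k))\<^sup>2 \<partial>N) + (\<integral>\<omega>. (score \<alpha> (1 - \<alpha>) l (z \<omega> $ l))\<^sup>2 \<partial>N) - (w k)\<^sup>2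
    = \<alpha>\<^sup>2 * zeta11 N z k l + (1 - \<alpha>)\<^sup>2 * zeta22 N z k l + 2 * \<alpha> * (1 - \<alpha>) * zeta12 N z k l"
proof -
  have eqs: "m_beta N z k = pmom 4 k" "m_omega N z k = pmom 6 k - (pmom 3 k)\<^sup>2" "m_nu N z k = pmom 4 k - 1"
    "m_eta N z k = pmom 5 k - pmom 3 k" for k
    by (simp_all add: m_beta_def m_omega_def m_nu_def m_eta_def pmom_def)
  show ?thesis
    unfolding score_expectation(4) w_def zeta11_def zeta22_def zeta12_def eqs m_gamma_pmom m_kappa_pmom
    by algebra
qed

lemma score_variance_gives_asv:
  fixes \<alpha> :: real
  assumes kl: "k \<noteq> l"
  defines "w \<equiv> \<lambda>k. \<alpha> * (pmom 3 k)\<^sup>2 + (1 - \<alpha>) * (pmom 4 k - 3)\<^sup>2"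
  shows "(\<integral>\<omega>. ((score \<alpha> (1 - \<alpha>) k (z \<omega> $ k) * z \<omega> $ l - score \<alpha> (1 - \<alpha>) l (z \<omega> $ l) * z \<omega> $ k - w k * (z \<omega> $ k * z \<omega> $ l)) / (w k + w l))\<^sup>2 \<partial>N)
    = asv \<alpha> k l"
proof -
  have den: "\<alpha> * ((m_gamma N z k)\<^sup>2 + (m_gamma N z l)\<^sup>2) + (1 - \<alpha>) * ((m_kappa N z k)\<^sup>2 + (m_kappa N z l)\<^sup>2) = w k + w l"
    unfolding w_def m_gamma_pmom m_kappa_pmom by algebra
  show ?thesis
    unfolding power_divide integral_divide_zero asv_def den
    using kl influence_variance[OF kl, of \<alpha> "1 - \<alpha>"] score_variance_zeta[of \<alpha> k l] by (simp add: w_def)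
qed

theorem asymptotically_normal_solutions:
  fixes M :: "'a measure" and Z :: "nat \<Rightarrow> 'a \<Rightarrow> real^'p"
  assumes M: "prob_space M" and indepZ: "prob_space.indep_vars M (\<lambda>_. borel) Z UNIV"
    and distrZ: "\<And>i. distr M borel (Z i) = distr N borel z"
    and \<alpha>: "0 \<le> \<alpha>" "\<alpha> \<le> 1"
    and int8: "\<alpha> \<noteq> 1 \<Longrightarrow> \<forall>k. integrable N (\<lambda>\<omega>. z \<omega> $ k ^ 8)"
    and weights: "\<And>k l. k \<noteq> l \<Longrightarrow> \<alpha> * (m_gamma N z k)\<^sup>2 + (1 - \<alpha>) * (m_kappa N z k)\<^sup>2 > 0
       \<or> \<alpha> * (m_gamma N z l)\<^sup>2 + (1 - \<alpha>) * (m_kappa N z l)\<^sup>2 > 0"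
  shows "has_asymptotically_normal_solutions M Z \<alpha> (asv \<alpha>)"
proof -
  interpret M: prob_space M by fact
  text \<open>With skewness alone the fourth moments carry no weight; switching them off avoids
    moment conditions of order eight.\<close>
  define c :: real where "c = (if \<alpha> = 1 then 0 else 1)"
  have c: "\<alpha> = 1 \<or> c = 1" by (simp add: c_def)
  define D where "D = distr N borel (\<lambda>\<omega>. moment_vector c (z \<omega>))"
  define \<mu> where "\<mu> = (\<integral>x. x \<partial>D)"
  have hz[measurable]: "(\<lambda>\<omega>. moment_vector c (z \<omega>)) \<in> borel_measurable N" by measurable
  have int4c: "integrable N (\<lambda>\<omega>. (c * (z \<omega> $ i * z \<omega> $ j * z \<omega> $ k * z \<omega> $ l))\<^sup>2)" for i j k l
  proof (cases "\<alpha> = 1")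
    case False
    have "integrable N (\<lambda>\<omega>. (z \<omega> $ i * z \<omega> $ j * z \<omega> $ k * z \<omega> $ l)\<^sup>2)"
      by (rule Bochner_Integration.integrable_bound[where f = "\<lambda>\<omega>. z \<omega> $ i ^ 8 + z \<omega> $ j ^ 8 + z \<omega> $ k ^ 8 + z \<omega> $ l ^ 8"])
        (use int8[OF False] prod_le_sum_powers(3) in \<open>auto intro!: AE_I2 intro: order_trans[OF _ abs_ge_self]\<close>)
    then show ?thesis by (simp add: c_def)
  qed (simp add: c_def)
  have int3: "integrable N (\<lambda>\<omega>. (z \<omega> $ i * z \<omega> $ j * z \<omega> $ k)\<^sup>2)" for i j k
    by (rule Bochner_Integration.integrable_bound[where f = "\<lambda>\<omega>. z \<omega> $ i ^ 6 + z \<omega> $ j ^ 6 + z \<omega> $ k ^ 6"])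
      (use int6 prod_le_sum_powers(2) in \<open>auto intro!: AE_I2 intro: order_trans[OF _ abs_ge_self]\<close>)
  have int2: "integrable N (\<lambda>\<omega>. (z \<omega> $ i * z \<omega> $ j)\<^sup>2)" for i j
    by (rule Bochner_Integration.integrable_bound[where f = "\<lambda>\<omega>. z \<omega> $ i ^ 4 + z \<omega> $ j ^ 4"])
      (use integrable_power[of 4] prod_le_sum_powers(1) in \<open>auto intro!: AE_I2 intro: order_trans[OF _ abs_ge_self]\<close>)
  have normsq: "(norm (moment_vector c v))\<^sup>2 = (\<Sum>i\<in>UNIV. (v $ i)\<^sup>2) + ((\<Sum>i\<in>UNIV. \<Sum>j\<in>UNIV. (v $ i * v $ j)\<^sup>2)
     + ((\<Sum>i\<in>UNIV. \<Sum>j\<in>UNIV. \<Sum>k\<in>UNIV. (v $ i * v $ j * v $ k)\<^sup>2)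
     + (\<Sum>i\<in>UNIV. \<Sum>j\<in>UNIV. \<Sum>k\<in>UNIV. \<Sum>l\<in>UNIV. (c * (v $ i * v $ j * v $ k * v $ l))\<^sup>2)))" for v :: "real^'p"
    unfolding power2_norm_eq_inner moment_vector_def inner_Pair inner_vec_def
    by (simp add: power2_eq_square)
  have sqD: "integrable D (\<lambda>x. (norm x)\<^sup>2)"
    unfolding D_def using int4c int3 int2 integrable_power[of 2]
    by (subst integrable_distr_eq) (auto simp: normsq)
  define X where "X i \<omega> = moment_vector c (Z i \<omega>)" for i \<omega>
  have Zm[measurable]: "Z i \<in> borel_measurable M" for i
    using indepZ unfolding M.indep_vars_def by simp
  have indX: "M.indep_vars (\<lambda>_. borel) X UNIV"
    unfolding X_def using indepZ by (rule M.indep_vars_compose2) auto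
  have distrX: "distr M borel (X i) = D" for i
  proof -
    have "distr M borel (X i) = distr (distr M borel (Z i)) borel (moment_vector c)"
      by (subst distr_distr) (auto simp: X_def[abs_def] comp_def)
    also have "\<dots> = D" unfolding distrZ D_def by (subst distr_distr) (auto simp: comp_def)
    finally show ?thesis .
  qed
  obtain L where L: "prob_space L" "sets L = sets borel"
    "\<And>t. distr L borel (\<lambda>x. t \<bullet> x) = centred_normal (sqrt (\<integral>x. (t \<bullet> (x - \<mu>))\<^sup>2 \<partial>D))"
    "converges_in_distribution M (\<lambda>n \<omega>. sqrt n *\<^sub>R ((1 / real n) *\<^sub>R (\<Sum>i<n. X i \<omega>) - \<mu>)) L"
    by (rule multivariate_clt[OF M indX distrX sqD \<mu>_def[symmetric]]) (rule that; assumption)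
  have int_sq: "integrable N f" if "integrable N (\<lambda>\<omega>. (f \<omega>)\<^sup>2)" "f \<in> borel_measurable N" for f :: "'b \<Rightarrow> real"
    using square_integrable_imp_integrable[OF that(2,1)] .
  have int_h: "integrable N (\<lambda>\<omega>. moment_vector c (z \<omega>))"
  proof (rule integrable_norm_cancel[OF int_sq])
    show "integrable N (\<lambda>\<omega>. (norm (moment_vector c (z \<omega>)))\<^sup>2)"
      using sqD unfolding D_def by (subst (asm) integrable_distr_eq[OF hz]) auto
    show "(\<lambda>\<omega>. norm (moment_vector c (z \<omega>))) \<in> borel_measurable N" by measurable
  qed (rule hz)
  have \<mu>_N: "\<mu> = (\<integral>\<omega>. moment_vector c (z \<omega>) \<partial>N)"
    unfolding \<mu>_def D_def by (rule integral_distr) auto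
  have mom_\<mu>: "mom1 \<mu> i = (\<integral>\<omega>. z \<omega> $ i \<partial>N)" "mom2 \<mu> i j = (\<integral>\<omega>. z \<omega> $ i * z \<omega> $ j \<partial>N)"
    "mom3 \<mu> i j k = (\<integral>\<omega>. z \<omega> $ i * z \<omega> $ j * z \<omega> $ k \<partial>N)"
    "mom4 \<mu> i j k l = (\<integral>\<omega>. c * (z \<omega> $ i * z \<omega> $ j * z \<omega> $ k * z \<omega> $ l) \<partial>N)" for i j k l
    unfolding \<mu>_N by (simp_all add: integral_bounded_linear[OF bounded_linear_mom(1) int_h, symmetric]
        integral_bounded_linear[OF bounded_linear_mom(2) int_h, symmetric] integral_bounded_linear[OF bounded_linear_mom(3) int_h, symmetric]
        integral_bounded_linear[OF bounded_linear_mom(4) int_h, symmetric] mom_moment_vector)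
  have mom_\<mu>_vals: "mom1 \<mu> i = 0" "mom2 \<mu> i j = (if i = j then 1 else 0)" "mom3 \<mu> i j k = (if i = j \<and> j = k then pmom 3 i else 0)" for i j k
    unfolding mom_\<mu> moment2 moment3 by (simp_all add: mean)
  obtain sel :: "'p moments \<Rightarrow> real^'p^'p" where sel: "sel \<in> borel_measurable borel" "rotation_selection \<alpha> (1 - \<alpha>) sel"
    using rotation_selection_exists by blast
  interpret F: independent_moments \<alpha> "1 - \<alpha>" \<mu> "pmom 3" "\<lambda>k. pmom 4 k - 3" sel
  proof
    show "0 \<le> \<alpha>" "0 \<le> 1 - \<alpha>" using \<alpha> by auto
    show "mom1 \<mu> i = 0" "mom2 \<mu> i j = (if i = j then 1 else 0)" "mom3 \<mu> i j k = (if i = j \<and> j = k then pmom 3 i else 0)" for i j k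
      by (rule mom_\<mu>_vals)+
    show "cum4 \<mu> i j k l = (if i = j \<and> j = k \<and> k = l then pmom 4 i - 3 else 0)" if "1 - \<alpha> \<noteq> 0" for i j k l
    proof -
      have "c = 1" using that by (simp add: c_def)
      then have m4: "mom4 \<mu> i j k l = (\<integral>\<omega>. z \<omega> $ i * z \<omega> $ j * z \<omega> $ k * z \<omega> $ l \<partial>N)"
        by (simp only: mom_\<mu>(4) mult_1_left)
      have d: "(if P then 1 else 0) * (if R then 1 else 0) = (if P \<and> R then 1 else (0 :: real))" for P R by simp
      have "cum4 \<mu> i j k l = mom4 \<mu> i j k l
         - (if i = j \<and> k = l then 1 else 0) - (if i = k \<and> j = l then 1 else 0) - (if j = k \<and> i = l then 1 else 0)"
        by (simp only: cum4_def cent4_def cent2_def mom_\<mu>_vals(1,2) d mult_zero_left mult_zero_right add_0_right diff_0_right)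
      moreover have "x + p + q + r - p - q - r = x" for x p q r :: real by simp
      ultimately show ?thesis unfolding m4 moment4 by (simp only:)
    qed
    show "\<alpha> * (pmom 3 i)\<^sup>2 + (1 - \<alpha>) * (pmom 4 i - 3)\<^sup>2 > 0 \<or> \<alpha> * (pmom 3 j)\<^sup>2 + (1 - \<alpha>) * (pmom 4 j - 3)\<^sup>2 > 0" if "i \<noteq> j" for i j
      using weights[OF that] by (simp add: m_gamma_pmom m_kappa_pmom)
    show "symmetric_moments \<mu>"
      unfolding symmetric_moments_def mom_\<mu> by (simp only: mult_ac simp_thms)
  qed (rule sel(2))
  define T where "T n x = F.unmixing (sample_moments c n x)" for n and x :: "nat \<Rightarrow> real^'p"
  define W where "W n \<omega> = T n (\<lambda>i\<in>{..<n}. Z i \<omega>)" for n \<omega>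
  define m where "m n \<omega> = (1 / real n) *\<^sub>R (\<Sum>i<n. X i \<omega>)" for n :: nat and \<omega>
  have m[measurable]: "m n \<in> borel_measurable M" for n
    unfolding m_def X_def by measurable
  have m_sample: "m n \<omega> = sample_moments c n (\<lambda>i\<in>{..<n}. Z i \<omega>)" for n \<omega>
    by (simp add: m_def X_def sample_moments_def)
  have W: "W n \<omega> = F.unmixing (m n \<omega>)" for n \<omega> by (simp add: W_def T_def m_sample)
  have [measurable]: "F.unmixing \<in> borel_measurable borel"
  proof -
    have [measurable]: "sel \<in> borel_measurable borel" by (rule sel(1))
    show ?thesis unfolding F.unmixing_def[abs_def] by measurable
  qed
  have sym_m: "m n \<omega> \<in> Collect symmetric_moments" for n \<omega>
    by (simp add: m_sample symmetric_sample_moments)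
  have convL: "converges_in_distribution M (\<lambda>n \<omega>. sqrt n *\<^sub>R (m n \<omega> - \<mu>)) L"
    using L(4) by (simp add: m_def[abs_def])
  have cons: "tendsto_in_probability M W (mat 1)"
    using delta_method(1)[OF M m L(1,2) convL _ F.unmixing_has_derivative sym_m] F.symmetric
    by (simp add: W[abs_def] F.unmixing_\<mu>)
  define \<tau> where "\<tau> m = vec_matrix (F.unmixing m)" for m
  define Q where "Q h = vec_matrix (F.influence_map h)" for h
  have blv: "bounded_linear (vec_matrix :: real^'p^'p \<Rightarrow> real^('p \<times> 'p))"
    using linear_vec_matrix linear_conv_bounded_linear by blast
  have der: "(\<tau> has_derivative Q) (at \<mu> within Collect symmetric_moments)"
    unfolding \<tau>_def[abs_def] Q_def[abs_def] by (rule bounded_linear.has_derivative[OF blv F.unmixing_has_derivative])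
  have blQ: "bounded_linear Q" using der by (rule has_derivative_bounded_linear)
  have [measurable]: "(vec_matrix :: real^'p^'p \<Rightarrow> real^('p \<times> 'p)) \<in> borel_measurable borel"
    by (intro borel_measurable_continuous_onI linear_continuous_on blv)
  have [measurable]: "Q \<in> borel_measurable borel"
    by (intro borel_measurable_continuous_onI linear_continuous_on blQ)
  have [measurable_cong]: "sets L = sets borel" by (rule L(2))
  have "converges_in_distribution M (\<lambda>n \<omega>. sqrt n *\<^sub>R (\<tau> (m n \<omega>) - \<tau> \<mu>)) (distr L borel Q)"
    by (rule delta_method(2)[OF M m L(1,2) convL _ der sym_m]) (use F.symmetric in \<open>auto simp: \<tau>_def\<close>)
  moreover have "\<tau> (m n \<omega>) - \<tau> \<mu> = vec_matrix (W n \<omega> - mat 1)" for n \<omega>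
    by (simp add: \<tau>_def W F.unmixing_\<mu> linear_diff[OF linear_vec_matrix])
  ultimately have convW: "converges_in_distribution M (\<lambda>n \<omega>. sqrt n *\<^sub>R vec_matrix (W n \<omega> - mat 1)) (distr L borel Q)"
    by simp
  define v where "v t = (\<integral>x. (t \<bullet> Q (x - \<mu>))\<^sup>2 \<partial>D)" for t
  have projQ: "distr (distr L borel Q) borel (\<lambda>x. t \<bullet> x) = centred_normal (sqrt (v t))" for t
  proof -
    \<comment> \<open>With the adjoint, projections of the image law under Q become projections of
      L, whose laws are known.\<close>
    have adj: "t \<bullet> Q x = adjoint Q t \<bullet> x" for x
      using adjoint_works[of Q x t] blQ by (simp add: linear_conv_bounded_linear inner_commute)
    have "distr (distr L borel Q) borel (\<lambda>x. t \<bullet> x) = distr L borel (\<lambda>x. adjoint Q t \<bullet> x)"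
      by (subst distr_distr) (auto simp: comp_def adj)
    then show ?thesis by (simp add: L(3) v_def adj)
  qed
  have v0: "v t \<ge> 0" for t unfolding v_def by (rule integral_nonneg_AE) simp
  note normal = multivariate_normal_centred[OF prob_space.prob_space_distr[OF L(1)] sets_distr projQ v0]
  have vkl: "v (axis (k, l) 1) = asv \<alpha> k l" for k l
  proof -
    have comp: "axis (k, l) 1 \<bullet> Q h = F.influence_map h $ k $ l" for h
      by (simp add: inner_axis' Q_def vec_matrix_def)
    have "v (axis (k, l) 1) = (\<integral>\<omega>. (F.influence_map (moment_vector c (z \<omega>) - \<mu>) $ k $ l)\<^sup>2 \<partial>N)"
    proof -
      have "(\<lambda>x. (axis (k, l) 1 \<bullet> Q (x - \<mu>))\<^sup>2) \<in> borel_measurable borel" by measurable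
      then show ?thesis unfolding v_def D_def by (subst integral_distr) (auto simp: comp)
    qed
    also have "\<dots> = asv \<alpha> k l"
    proof (cases "k = l")
      case True
      \<comment> \<open>The diagonal influence is (1 - z_k^2) / 2. Its square, padded to a
        polynomial of degree six, has expectation (\<open>pmom 4 k\<close> - 1) / 4, which is
        (kappa_k + 2) / 4.\<close>
      have "(F.influence_map (moment_vector c (z \<omega>) - \<mu>) $ k $ l)\<^sup>2 = 1/4 + 0 * z \<omega> $ k + (- 1/2) * z \<omega> $ k ^ 2 + 0 * z \<omega> $ k ^ 3 + 1/4 * z \<omega> $ k ^ 4 + 0 * z \<omega> $ k ^ 5 + 0 * z \<omega> $ k ^ 6" for \<omega>
        using True by (simp add: F.influence_map_def mom_diff mom_moment_vector mom_\<mu>_vals power2_eq_square power4_eq_xxxx field_simps)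
      then have "(\<integral>\<omega>. (F.influence_map (moment_vector c (z \<omega>) - \<mu>) $ k $ l)\<^sup>2 \<partial>N) = 1/4 + (- 1/2) + 0 * pmom 3 k + 1/4 * pmom 4 k + 0 * pmom 5 k + 0 * pmom 6 k"
        using sextic_expectation(2)[where ?c0.0 = "1/4" and ?c1.0 = 0 and ?c2.0 = "- 1/2" and ?c3.0 = 0 and ?c4.0 = "1/4" and ?c5.0 = 0 and ?c6.0 = 0 and k = k, OF refl] by (simp only:)
      then show ?thesis using True by (simp add: asv_def m_kappa_pmom)
    next
      case False
      have lk: "l \<noteq> k" using False by simp
      \<comment> \<open>In each of these moments one index occurs exactly once, so the centring of
        the fourth-order entries contributes nothing.\<close>
      have m4: "(1 - \<alpha>) * mom4 \<mu> k k k l = 0" "(1 - \<alpha>) * mom4 \<mu> l l k l = 0"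
        using False lk moment4[of k k k l] moment4[of l l k l] unfolding mom_\<mu>(4) by simp_all
      \<comment> \<open>Either alpha = 1 and both sides are 0, or c = 1: behind the kurtosis weight
        the switch c is invisible.\<close>
      have c4: "(1 - \<alpha>) * c = 1 - \<alpha>" using c by auto
      have "F.influence_map (moment_vector c (z \<omega>) - \<mu>) $ k $ l =
        (score \<alpha> (1 - \<alpha>) k (z \<omega> $ k) * z \<omega> $ l - score \<alpha> (1 - \<alpha>) l (z \<omega> $ l) * z \<omega> $ k
          - (\<alpha> * (pmom 3 k)\<^sup>2 + (1 - \<alpha>) * (pmom 4 k - 3)\<^sup>2) * (z \<omega> $ k * z \<omega> $ l))
        / ((\<alpha> * (pmom 3 k)\<^sup>2 + (1 - \<alpha>) * (pmom 4 k - 3)\<^sup>2) + (\<alpha> * (pmom 3 l)\<^sup>2 + (1 - \<alpha>) * (pmom 4 l - 3)\<^sup>2))" for \<omega>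
      proof -
        let ?x = "z \<omega> $ k" and ?y = "z \<omega> $ l"
        have sk: "F.skew_term k l (moment_vector c (z \<omega>) - \<mu>) = pmom 3 k * (?x * ?x * ?y - ?y) - pmom 3 l * (?y * ?x * ?y - ?x)"
          using False lk by (simp add: F.skew_term_def mom_diff mom_moment_vector mom_\<mu>_vals)
        have "(1 - \<alpha>) * F.kurt_term k l (moment_vector c (z \<omega>) - \<mu>) =
          (pmom 4 k - 3) * (((1 - \<alpha>) * c) * (?x * ?x * ?x * ?y) - (1 - \<alpha>) * mom4 \<mu> k k k l - (1 - \<alpha>) * (pmom 3 k * ?y) - (1 - \<alpha>) * (3 * (?x * ?y)))
          - (pmom 4 l - 3) * (((1 - \<alpha>) * c) * (?y * ?y * ?x * ?y) - (1 - \<alpha>) * mom4 \<mu> l l k l - (1 - \<alpha>) * (pmom 3 l * ?x) - (1 - \<alpha>) * (?x * ?y) - (1 - \<alpha>) * (2 * (?y * ?x)))"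
          using False lk by (simp add: F.kurt_term_def mom_diff mom_moment_vector mom_\<mu>_vals algebra_simps)
        then have ku: "(1 - \<alpha>) * F.kurt_term k l (moment_vector c (z \<omega>) - \<mu>) =
          (1 - \<alpha>) * ((pmom 4 k - 3) * (?x * ?x * ?x * ?y - pmom 3 k * ?y - 3 * (?x * ?y))
          - (pmom 4 l - 3) * (?y * ?y * ?x * ?y - pmom 3 l * ?x - 3 * (?x * ?y)))"
          unfolding m4 c4 by algebra
        have num: "\<alpha> * F.skew_term k l (moment_vector c (z \<omega>) - \<mu>) + (1 - \<alpha>) * F.kurt_term k l (moment_vector c (z \<omega>) - \<mu>) - F.weight k * (?x * ?y)
          = score \<alpha> (1 - \<alpha>) k ?x * ?y - score \<alpha> (1 - \<alpha>) l ?y * ?x - (\<alpha> * (pmom 3 k)\<^sup>2 + (1 - \<alpha>) * (pmom 4 k - 3)\<^sup>2) * (?x * ?y)"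
          unfolding sk ku score_def F.weight_def by algebra
        show ?thesis
          using False num by (simp add: F.influence_map_def mom_diff mom_moment_vector mom_\<mu>_vals F.weight_def)
      qed
      then show ?thesis using score_variance_gives_asv[OF False, of \<alpha>] by (simp only:)
    qed
    finally show ?thesis .
  qed
  have var: "prob_space.variance (distr L borel Q) (\<lambda>x. x $ (k, l)) = asv \<alpha> k l" for k l
    using normal(3)[of "axis (k, l) 1"] by (simp add: inner_axis' vkl)
  show ?thesis
    unfolding has_asymptotically_normal_solutions_def
  proof (intro exI conjI allI)
    show "all_cumulant_estimate \<alpha> n (T n)" for n
      using all_cumulant_estimate_selection[OF sel c] by (simp add: T_def[abs_def] F.unmixing_def)
    show "W n \<omega> = T n (\<lambda>i\<in>{..<n}. Z i \<omega>)" for n \<omega> by (rule W_def)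
    show "tendsto_in_probability M W (mat 1)" by (rule cons)
    show "converges_in_distribution M (\<lambda>n \<omega>. sqrt (real n) *\<^sub>R vec_matrix (W n \<omega> - mat 1)) (distr L borel Q)" by (rule convW)
    show "multivariate_normal (distr L borel Q)" by (rule normal(1)) simp
    show "(\<integral>x. x \<partial>distr L borel Q) = 0" by (rule normal(2)) simp
    show "prob_space.variance (distr L borel Q) (\<lambda>x. x $ (k, l)) = asv \<alpha> k l" for k l by (rule var)
  qed
qed

end

lemma card_le_one_alternative:
  assumes "card {k :: 'p::finite. P k} \<le> 1" "k \<noteq> l"
  shows "\<not> P k \<or> \<not> P l"
  using assms card_le_Suc0_iff_eq[of "{k. P k}"] by auto

text \<open>For alpha strictly between 0 and 1 the weight alpha gamma_k^2 + (1 - alpha) kappa_k^2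
  vanishes only if gamma_k and kappa_k both do. At an end point a single cumulant is left in the
  weight, and for two components lacking it the denominator of the variance would be 0; hence the
  conditions of (i) and (ii) reappear in (iii) for alpha = 1 and alpha = 0.\<close>

theorem corollary5p2p1:
  fixes N :: "'b measure" and z :: "'b \<Rightarrow> real^'p"
    and M :: "'a measure" and Z :: "nat \<Rightarrow> 'a \<Rightarrow> real^'p"
  assumes "prob_space N" and "z \<in> borel_measurable N"
    and "prob_space.indep_vars N (\<lambda>_. borel) (\<lambda>k \<omega>. z \<omega> $ k) UNIV"
    and "\<And>k. prob_space.expectation N (\<lambda>\<omega>. z \<omega> $ k) = 0"
    and "\<And>k. prob_space.variance N (\<lambda>\<omega>. z \<omega> $ k) = 1"
    and "prob_space M"
    and "prob_space.indep_vars M (\<lambda>_. borel) Z UNIV"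
    and "\<And>i. distr M borel (Z i) = distr N borel z"
  shows
    "((\<forall>k. integrable N (\<lambda>\<omega>. z \<omega> $ k ^ 6)) \<and> card {k. m_gamma N z k = 0} \<le> 1 \<longrightarrow>
        has_asymptotically_normal_solutions M Z 1
          (\<lambda>k l. if k = l then (m_kappa N z k + 2) / 4
                 else zeta11 N z k l / ((m_gamma N z k)\<^sup>2 + (m_gamma N z l)\<^sup>2)\<^sup>2))
     \<and>
     ((\<forall>k. integrable N (\<lambda>\<omega>. z \<omega> $ k ^ 8)) \<and> card {k. m_kappa N z k = 0} \<le> 1 \<longrightarrow>
        has_asymptotically_normal_solutions M Z 0
          (\<lambda>k l. if k = l then (m_kappa N z k + 2) / 4
                 else zeta22 N z k l / ((m_kappa N z k)\<^sup>2 + (m_kappa N z l)\<^sup>2)\<^sup>2))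
     \<and>
     ((\<forall>k. integrable N (\<lambda>\<omega>. z \<omega> $ k ^ 8)) \<and>
      card {k. m_gamma N z k = 0 \<and> m_kappa N z k = 0} \<le> 1 \<longrightarrow>
        (\<forall>\<alpha>\<in>{0..1}.
           (\<alpha> = 1 \<longrightarrow> card {k. m_gamma N z k = 0} \<le> 1) \<and>
           (\<alpha> = 0 \<longrightarrow> card {k. m_kappa N z k = 0} \<le> 1) \<longrightarrow>
           has_asymptotically_normal_solutions M Z \<alpha>
             (\<lambda>k l. if k = l then (m_kappa N z k + 2) / 4
                    else (\<alpha>\<^sup>2 * zeta11 N z k l + (1 - \<alpha>)\<^sup>2 * zeta22 N z k l
                            + 2 * \<alpha> * (1 - \<alpha>) * zeta12 N z k l)
                         / (\<alpha> * ((m_gamma N z k)\<^sup>2 + (m_gamma N z l)\<^sup>2)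
                            + (1 - \<alpha>) * ((m_kappa N z k)\<^sup>2 + (m_kappa N z l)\<^sup>2))\<^sup>2)))"
proof -
  have meas: "(\<lambda>\<omega>. z \<omega> $ k) \<in> borel_measurable N" for k
    using assms(3) unfolding prob_space.indep_vars_def[OF assms(1)] by auto
  have int68: "\<forall>k. integrable N (\<lambda>\<omega>. z \<omega> $ k ^ 6)" if "\<forall>k. integrable N (\<lambda>\<omega>. z \<omega> $ k ^ 8)"
    using integrable_power_mono[OF assms(1) meas, of _ 8 6] that by simp
  let ?w = "\<lambda>\<alpha> k. \<alpha> * (m_gamma N z k)\<^sup>2 + (1 - \<alpha>) * (m_kappa N z k)\<^sup>2"
  have main: "has_asymptotically_normal_solutions M Z \<alpha>
      (\<lambda>k l. if k = l then (m_kappa N z k + 2) / 4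
        else (\<alpha>\<^sup>2 * zeta11 N z k l + (1 - \<alpha>)\<^sup>2 * zeta22 N z k l + 2 * \<alpha> * (1 - \<alpha>) * zeta12 N z k l)
          / (\<alpha> * ((m_gamma N z k)\<^sup>2 + (m_gamma N z l)\<^sup>2) + (1 - \<alpha>) * ((m_kappa N z k)\<^sup>2 + (m_kappa N z l)\<^sup>2))\<^sup>2)"
    if \<alpha>: "0 \<le> \<alpha>" "\<alpha> \<le> 1" and int6: "\<forall>k. integrable N (\<lambda>\<omega>. z \<omega> $ k ^ 6)"
      and int8: "\<alpha> \<noteq> 1 \<Longrightarrow> \<forall>k. integrable N (\<lambda>\<omega>. z \<omega> $ k ^ 8)"
      and w: "\<And>k l. k \<noteq> l \<Longrightarrow> ?w \<alpha> k > 0 \<or> ?w \<alpha> l > 0" for \<alpha>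
  proof -
    interpret independent_components N z
      by (intro independent_components.intro independent_components_axioms.intro assms int6[rule_format])
    have "has_asymptotically_normal_solutions M Z \<alpha> (asv \<alpha>)"
      by (rule asymptotically_normal_solutions[OF assms(6-8) \<alpha>]) (rule int8 w; assumption)+
    then show ?thesis by (simp only: asv_def[abs_def])
  qed
  show ?thesis
  proof (intro conjI impI ballI)
    assume H: "(\<forall>k. integrable N (\<lambda>\<omega>. z \<omega> $ k ^ 6)) \<and> card {k. m_gamma N z k = 0} \<le> 1"
    have "?w 1 k > 0 \<or> ?w 1 l > 0" if "k \<noteq> l" for k l
      using card_le_one_alternative[OF conjunct2[OF H] that] by simp
    then show "has_asymptotically_normal_solutions M Z 1
          (\<lambda>k l. if k = l then (m_kappa N z k + 2) / 4
                 else zeta11 N z k l / ((m_gamma N z k)\<^sup>2 + (m_gamma N z l)\<^sup>2)\<^sup>2)"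
      using main[of 1] H by (simp cong: if_cong)
  next
    assume H: "(\<forall>k. integrable N (\<lambda>\<omega>. z \<omega> $ k ^ 8)) \<and> card {k. m_kappa N z k = 0} \<le> 1"
    have "?w 0 k > 0 \<or> ?w 0 l > 0" if "k \<noteq> l" for k l
      using card_le_one_alternative[OF conjunct2[OF H] that] by simp
    then show "has_asymptotically_normal_solutions M Z 0
          (\<lambda>k l. if k = l then (m_kappa N z k + 2) / 4
                 else zeta22 N z k l / ((m_kappa N z k)\<^sup>2 + (m_kappa N z l)\<^sup>2)\<^sup>2)"
      using main[of 0] H int68 by (simp cong: if_cong)
  next
    fix \<alpha> :: real
    assume H: "(\<forall>k. integrable N (\<lambda>\<omega>. z \<omega> $ k ^ 8)) \<and> card {k. m_gamma N z k = 0 \<and> m_kappa N z k = 0} \<le> 1"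
      and \<alpha>: "\<alpha> \<in> {0..1}"
      and ends: "(\<alpha> = 1 \<longrightarrow> card {k. m_gamma N z k = 0} \<le> 1) \<and> (\<alpha> = 0 \<longrightarrow> card {k. m_kappa N z k = 0} \<le> 1)"
    have "?w \<alpha> k > 0 \<or> ?w \<alpha> l > 0" if kl: "k \<noteq> l" for k l
    proof -
      consider "\<alpha> = 1" | "\<alpha> = 0" | "0 < \<alpha>" "\<alpha> < 1" using \<alpha> by force
      then show ?thesis
      proof cases
        case 1
        then show ?thesis using card_le_one_alternative[of "\<lambda>k. m_gamma N z k = 0", OF _ kl] ends by simp
      next
        case 2
        then show ?thesis using card_le_one_alternative[of "\<lambda>k. m_kappa N z k = 0", OF _ kl] ends by simp
      next
        case 3
        have "?w \<alpha> i > 0" if "\<not> (m_gamma N z i = 0 \<and> m_kappa N z i = 0)" for i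
          using that 3 by (cases "m_gamma N z i = 0") (auto simp: add_pos_nonneg)
        then show ?thesis using card_le_one_alternative[OF conjunct2[OF H] kl] by blast
      qed
    qed
    then show "has_asymptotically_normal_solutions M Z \<alpha>
             (\<lambda>k l. if k = l then (m_kappa N z k + 2) / 4
                    else (\<alpha>\<^sup>2 * zeta11 N z k l + (1 - \<alpha>)\<^sup>2 * zeta22 N z k l
                            + 2 * \<alpha> * (1 - \<alpha>) * zeta12 N z k l)
                         / (\<alpha> * ((m_gamma N z k)\<^sup>2 + (m_gamma N z l)\<^sup>2)
                            + (1 - \<alpha>) * ((m_kappa N z k)\<^sup>2 + (m_kappa N z l)\<^sup>2))\<^sup>2)"
      using main[of \<alpha>] H \<alpha> int68 by simp
  qed
qed

end
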